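(* Let $\mu$ be Lebesgue measure on $[0,1]$ and let $X_1,\dots,X_n$ be i.i.d. from a probability density $f_o$ on $[0,1]$ (with respect to $\mu$) such that $\log f_o$ is continuous on $[0,1]$ with $\|\log f_o\|_\infty\le M_0$ and such that, for some $H_0>0$ and $\alpha\in(0,1)$, the Haar coefficients $d_{j_1,k_1}$ of $\log f_o$ satisfy $$\sum_{j_1\ge0}(2^{j_1+1}-1)^{2\alpha}\sum_{k_1=0}^{2^{j_1}-1}d_{j_1,k_1}^2\le H_0^2 .$$ Let $J=\{(l,L):l,L\text{ integers},\ l\ge0,\ L\ge1\}$. For $j=(l,L)\in J$ let $m_j=2^{l+1}$ and reindex the Haar functions $\{\psi_{j_1,k_1}:0\le j_1\le l,\ 0\le k_1\le2^{j_1}-1\}$ as $\{B_{j,i}:1\le i\le m_j-1\}$. Let $B=(B_{j,1},\dots,B_{j,m_j-1})'$ and, for $\theta\in\mathbb R^{m_j-1}$, $\log f_{\theta,j}=-\psi(\theta)+\theta'B$ with $\psi(\theta)=\log\int_0^1e^{\theta'B(x)}dx$. Define $$\Theta_j=\{\theta\in\mathbb R^{m_j-1}:\|\theta'B\|_\infty\le L\}$$ and let $\pi_j$ be the (normalized) Lebesgue measure on $\Theta_j$. Put $$A_j=19.28\cdot2^{(l+1)/2}(2L+1)e^L+0.06,\qquad C_j=m_j+L,$$ $$\eta_j=\frac{4m_j}{1-4\gamma}\log\left(\frac{46.2A_j\sqrt{1-4\gamma}}{\gamma}\right)+\frac{8C_j}{1-4\gamma},\qquad a_j=a\exp\left(-\left(1+\frac{1-4\gamma}8\right)\eta_j\right),$$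 where $a$ is the normalizing constant such that $\sum_{j\in J}a_j=1$ and $\gamma\in(0,1/4)$ is the solution of $0.13\gamma/\sqrt{1-4\gamma}=0.0056$. Let $\tilde\pi_j$ be the prior on densities induced by $\pi_j$ via $\theta\mapsto f_{\theta,j}$ and let $\tilde\pi=\sum_{j\in J}a_j\tilde\pi_j$. Then there is a sequence $s_n\propto n^{-\alpha/(1+2\alpha)}(\log n)^{1/2}$ such that the posterior probability $\tilde\pi(\tilde B_{d_H}(s_n)^c\mid X_1,\dots,X_n)$ converges to zero in $P_{f_o}^n$-probability as $n\to\infty$.
   Context: Haar basis of $L_2[0,1]$: $\{\mathbb 1_{[0,1]}\}\cup\{\psi_{j_1,k_1}:j_1\ge0,\ 0\le k_1\le2^{j_1}-1\}$, where $\psi_{j_1,k_1}(x)=2^{j_1/2}\psi^*(2^{j_1}x-k_1)$ and $\psi^*(x)=\mathbb 1_{[0,0.5]}(x)-\mathbb 1_{[0.5,1]}(x)$. The Haar coefficients $d_{j_1,k_1}$ of $\log f_o$ are the coefficients of $\psi_{j_1,k_1}$ in the $L_2[0,1]$ expansion of $\log f_o$, i.e. $d_{j_1,k_1}=\int_0^1\log f_o(x)\,\psi_{j_1,k_1}(x)\,dx$. $\|\cdot\|_\infty$ is the sup norm on $[0,1]$. $s_n\propto t_n$ means $s_n=Kt_n$ for a positive constant $K$ independent of $n$. $P_{f_o}^n$ is the joint law of $X_1,\dots,X_n$. "Normalized Lebesgue measure on $\Theta_j$" is the uniform probability measure on $\Theta_j\subset\mathbb R^{m_j-1}$. Hellinger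 distance: $d_H(f,g)=\sqrt{\int(\sqrt f-\sqrt g)^2d\mu}$. $\tilde B_{d_H}(s)=\{f:d_H(f,f_o)\le s\}$ (among the densities $f_{\theta,j}$), and $$\tilde\pi(\tilde B_{d_H}(s)^c\mid X_1,\dots,X_n)=\frac{\sum_ja_j\int_{\{\theta\in\Theta_j:d_H(f_{\theta,j},f_o)>s\}}\prod_{i=1}^nf_{\theta,j}(X_i)\,d\pi_j(\theta)}{\sum_ja_j\int_{\Theta_j}\prod_{i=1}^nf_{\theta,j}(X_i)\,d\pi_j(\theta)} .$$ *)

theory Defs
  imports "HOL-Probability.Probability"
begin

definition mu :: "real measure" where
  "mu = restrict_space lborel {0..1}"

definition sup_norm :: "(real \<Rightarrow> real) \<Rightarrow> real" where
  "sup_norm f = (SUP x\<in>{0..1}. \<bar>f x\<bar>)"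

(* Both intervals are closed, so haar_mother (1/2) = 0, and two neighbouring Haar functions of the
   same level are both nonzero at the common endpoint of their supports. *)
definition haar_mother :: "real \<Rightarrow> real" where
  "haar_mother x = indicator {0..1/2} x - indicator {1/2..1} x"

definition haar :: "nat \<Rightarrow> nat \<Rightarrow> real \<Rightarrow> real" where
  "haar j1 k1 x = 2 powr (real j1 / 2) * haar_mother (2 ^ j1 * x - real k1)"

definition haar_coeff :: "(real \<Rightarrow> real) \<Rightarrow> nat \<Rightarrow> nat \<Rightarrow> real" where
  "haar_coeff g j1 k1 = (\<integral>x. g x * haar j1 k1 x \<partial>mu)"

definition J :: "(nat \<times> nat) set" where
  "J = {(l, L). L \<ge> 1}"

definition m_dim :: "nat \<times> nat \<Rightarrow> nat" where
  "m_dim j = (case j of (l, L) \<Rightarrow> 2 ^ (l + 1))"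

(* B j is any enumeration of the Haar functions of levels 0, ..., l by 1, ..., m_dim j - 1. *)
definition haar_reindexing :: "(nat \<times> nat \<Rightarrow> nat \<Rightarrow> real \<Rightarrow> real) \<Rightarrow> bool" where
  "haar_reindexing B \<longleftrightarrow>
     (\<forall>(l, L)\<in>J. bij_betw (B (l, L)) {1..m_dim (l, L) - 1}
        {haar j1 k1 |j1 k1. j1 \<le> l \<and> k1 \<le> 2 ^ j1 - 1})"

(* R^(m_j - 1), as extensional functions on {1..m_dim j - 1}, with Lebesgue measure. *)
definition param_space :: "nat \<times> nat \<Rightarrow> (nat \<Rightarrow> real) measure" where
  "param_space j = Pi\<^sub>M {1..m_dim j - 1} (\<lambda>_. lborel)"

definition lin_comb ::
  "(nat \<times> nat \<Rightarrow> nat \<Rightarrow> real \<Rightarrow> real) \<Rightarrow> nat \<times> nat \<Rightarrow> (nat \<Rightarrow> real) \<Rightarrow> real \<Rightarrow> real" where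
  "lin_comb B j \<theta> x = (\<Sum>i\<in>{1..m_dim j - 1}. \<theta> i * B j i x)"

definition log_normalizer ::
  "(nat \<times> nat \<Rightarrow> nat \<Rightarrow> real \<Rightarrow> real) \<Rightarrow> nat \<times> nat \<Rightarrow> (nat \<Rightarrow> real) \<Rightarrow> real" where
  "log_normalizer B j \<theta> = ln (\<integral>x. exp (lin_comb B j \<theta> x) \<partial>mu)"

definition model_density ::
  "(nat \<times> nat \<Rightarrow> nat \<Rightarrow> real \<Rightarrow> real) \<Rightarrow> nat \<times> nat \<Rightarrow> (nat \<Rightarrow> real) \<Rightarrow> real \<Rightarrow> real" where
  "model_density B j \<theta> x = exp (- log_normalizer B j \<theta> + lin_comb B j \<theta> x)"

definition Theta ::
  "(nat \<times> nat \<Rightarrow> nat \<Rightarrow> real \<Rightarrow> real) \<Rightarrow> nat \<times> nat \<Rightarrow> (nat \<Rightarrow> real) set" where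
  "Theta B j = {\<theta> \<in> space (param_space j). sup_norm (lin_comb B j \<theta>) \<le> real (snd j)}"

definition model_prior ::
  "(nat \<times> nat \<Rightarrow> nat \<Rightarrow> real \<Rightarrow> real) \<Rightarrow> nat \<times> nat \<Rightarrow> (nat \<Rightarrow> real) measure" where
  "model_prior B j = uniform_measure (param_space j) (Theta B j)"

definition A_const :: "nat \<times> nat \<Rightarrow> real" where
  "A_const j = (case j of (l, L) \<Rightarrow>
     19.28 * 2 powr ((real l + 1) / 2) * (2 * real L + 1) * exp (real L) + 0.06)"

definition C_const :: "nat \<times> nat \<Rightarrow> real" where
  "C_const j = (case j of (l, L) \<Rightarrow> real (m_dim (l, L)) + real L)"

definition eta :: "real \<Rightarrow> nat \<times> nat \<Rightarrow> real" where
  "eta \<gamma> j =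
     4 * real (m_dim j) / (1 - 4 * \<gamma>) * ln (46.2 * A_const j * sqrt (1 - 4 * \<gamma>) / \<gamma>)
     + 8 * C_const j / (1 - 4 * \<gamma>)"

definition weight :: "real \<Rightarrow> real \<Rightarrow> nat \<times> nat \<Rightarrow> real" where
  "weight a \<gamma> j = a * exp (- (1 + (1 - 4 * \<gamma>) / 8) * eta \<gamma> j)"

definition hellinger :: "(real \<Rightarrow> real) \<Rightarrow> (real \<Rightarrow> real) \<Rightarrow> real" where
  "hellinger f g = sqrt (\<integral>x. (sqrt (f x) - sqrt (g x))\<^sup>2 \<partial>mu)"

definition hellinger_ball :: "(real \<Rightarrow> real) \<Rightarrow> real \<Rightarrow> (real \<Rightarrow> real) set" where
  "hellinger_ball f_o s = {f. hellinger f f_o \<le> s}"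

(* The integral of the likelihood of x 1, ..., x n over the set S of densities with respect to the
   mixture, with weights w j, of the images of model_prior B j under model_density B j. It takes
   values in [0, \<infinity>], so no convention for divergent sums or integrals is involved. *)
definition evidence ::
  "(nat \<times> nat \<Rightarrow> nat \<Rightarrow> real \<Rightarrow> real) \<Rightarrow> (nat \<times> nat \<Rightarrow> real) \<Rightarrow> nat \<Rightarrow> (nat \<Rightarrow> real) \<Rightarrow>
     (real \<Rightarrow> real) set \<Rightarrow> ennreal" where
  "evidence B w n x S =
     (\<Sum>\<^sub>\<infinity>j\<in>J. ennreal (w j) *
        (\<integral>\<^sup>+\<theta>\<in>{\<theta> \<in> Theta B j. model_density B j \<theta> \<in> S}.
           ennreal (\<Prod>i\<in>{1..n}. model_density B j \<theta> (x i)) \<partial>model_prior B j))"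

definition posterior ::
  "(nat \<times> nat \<Rightarrow> nat \<Rightarrow> real \<Rightarrow> real) \<Rightarrow> (nat \<times> nat \<Rightarrow> real) \<Rightarrow> nat \<Rightarrow> (nat \<Rightarrow> real) \<Rightarrow>
     (real \<Rightarrow> real) set \<Rightarrow> real" where
  "posterior B w n x S = enn2real (evidence B w n x S / evidence B w n x UNIV)"

definition joint_law :: "(real \<Rightarrow> real) \<Rightarrow> nat \<Rightarrow> (nat \<Rightarrow> real) measure" where
  "joint_law f n = Pi\<^sub>M {1..n} (\<lambda>_. density mu (\<lambda>x. ennreal (f x)))"

definition proportional :: "(nat \<Rightarrow> real) \<Rightarrow> (nat \<Rightarrow> real) \<Rightarrow> bool" where
  "proportional s t \<longleftrightarrow> (\<exists>K>0. \<forall>n. s n = K * t n)"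

(* The Y n are required to be random variables because measure is 0 on non-measurable sets. *)
definition tends_to_zero_in_prob ::
  "(nat \<Rightarrow> 'a measure) \<Rightarrow> (nat \<Rightarrow> 'a \<Rightarrow> real) \<Rightarrow> bool" where
  "tends_to_zero_in_prob P Y \<longleftrightarrow>
     (\<forall>n. Y n \<in> borel_measurable (P n)) \<and>
     (\<forall>\<epsilon>>0. (\<lambda>n. measure (P n) {x \<in> space (P n). \<bar>Y n x\<bar> > \<epsilon>}) \<longlonglongrightarrow> 0)"

end

theory Submission
  imports Defs
begin

text \<open>Up to a constant and away from dyadic points, the truncated Haar expansion of \<open>log f_o\<close>
  consists of dyadic averages, so it approximates \<open>log f_o\<close> in \<open>L\<^sub>2\<close> with squared error \<open>O(m\<^sub>j powr (-2 \<alpha>))\<close> and stays bounded uniformly in \<open>j\<close>; hence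
  it lies well inside \<open>\<Theta>\<^sub>j\<close> for a fixed \<open>L\<close>. A sup-norm ball of radius \<open>1/n\<close> around it has prior mass
  \<open>(1/(n L)) ^ (m\<^sub>j - 1)\<close>, because \<open>\<Theta>\<^sub>j\<close> is itself a ball of the same norm, and all likelihoods in
  that ball agree up to a constant factor. Markov's inequality for the inverse likelihood ratio,
  whose mean is a power of \<open>\<integral> f_o\<^sup>2 / f\<^sub>\<theta>\<close>, then bounds the denominator of the posterior from below by
  \<open>exp (- C r\<^sub>n)\<close>, where \<open>r\<^sub>n = n powr (1/(1+2\<alpha>)) * log n\<close> and \<open>m\<^sub>j\<close> is of order
  \<open>n powr (1/(1+2\<alpha>))\<close>.

  In the numerator, the likelihood at \<open>\<theta>\<close> is dominated by the square of an average of root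
  likelihoods over the ball of radius \<open>1/n\<close> around \<open>\<theta>\<close>. The mean of a root likelihood ratio is the
  \<open>n\<close>-th power of the Hellinger affinity, hence at most \<open>exp (- n s\<^sup>2 / 2)\<close> up to constants, and
  averaging costs only the volume ratio \<open>(1 + L n) ^ (m\<^sub>j - 1)\<close>. This settles the models with
  \<open>m\<^sub>j \<le> K n powr (1/(1+2\<alpha>))\<close>; the prior weights of the larger ones are negligible, being at most
  \<open>exp (- 2 m\<^sub>j log m\<^sub>j - 4 m\<^sub>j L)\<close> up to a constant.\<close>


section \<open>Truncated Haar expansions\<close>

text \<open>The supremum that defines \<open>Theta\<close> runs over every point of [0,1], and Haar
  functions with closed supports overlap at dyadic points. Almost-everywhere identities therefore
  suffice for integrals but not for membership in \<open>Theta\<close>, which is why partial sums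
  are also computed at dyadic points. The radius 1/n is the scale at which the log likelihood of n
  observations moves by a bounded amount. Ball volumes come from translation and scaling alone, so
  of the volume of the unit ball only positivity and finiteness enter, and it cancels. The integral
  of \<open>(f_o y)\<^sup>2 / model_density B j \<theta> y\<close> factors into two exponential
  moments of the approximation error. Their first-order terms cancel, which leaves a bound quadratic
  in the error. The square of an averaged root likelihood has no controlled mean. Dividing by the
  evidence first makes the contribution of a model at most 1, hence at most its own square root, and
  then the first moment of the average is enough.\<close>

lemma haar_mother_eq:
  "haar_mother y = (if 0 \<le> y \<and> y < 1/2 then 1 else if 1/2 < y \<and> y \<le> 1 then -1 else 0)"
  by (auto simp: haar_mother_def indicator_def)

text \<open>Levels strictly below \<open>n\<close>, so the functions of the model
  \<open>(l, L)\<close> are the sums with \<open>n = Suc l\<close>. The constant function is absent,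
  hence the partial sums of \<open>g\<close> approximate \<open>g\<close> minus its mean.\<close>

definition haar_sum :: "(nat \<Rightarrow> nat \<Rightarrow> real) \<Rightarrow> nat \<Rightarrow> real \<Rightarrow> real" where
  "haar_sum c n x = (\<Sum>j<n. \<Sum>k<2^j. c j k * haar j k x)"

lemma haar_sum_0 [simp]: "haar_sum c 0 x = 0"
  by (simp add: haar_sum_def)

lemma haar_sum_Suc: "haar_sum c (Suc n) x = haar_sum c n x + (\<Sum>k<2^n. c n k * haar n k x)"
  by (simp add: haar_sum_def)

text \<open>Cell index \<open>p\<close> and relative position \<open>t\<close> within a dyadic
  interval of length \<open>1 / 2 ^ n\<close>. Passing between levels becomes arithmetic on
  \<open>p\<close> and \<open>t\<close>; \<open>t = 0\<close> gives the grid points.\<close>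

definition cell_point :: "nat \<Rightarrow> nat \<Rightarrow> real \<Rightarrow> real" where
  "cell_point n p t = (real p + t) / 2 ^ n"

lemma cell_point_even: "cell_point (Suc n) (2 * k) t = cell_point n k (t / 2)"
  and cell_point_odd: "cell_point (Suc n) (2 * k + 1) t = cell_point n k ((1 + t) / 2)"
  by (simp_all add: cell_point_def field_simps)

lemma haar_cell_point: "haar n k (cell_point n p t) = 2 powr (real n / 2) * haar_mother (real p + t - real k)"
  by (simp add: haar_def cell_point_def)

lemma finest_level_cell_point:
  assumes "p < 2 ^ n" "0 < t" "t < 1"
  shows "(\<Sum>k<2^n. c k * haar n k (cell_point n p t)) = c p * 2 powr (real n / 2) * haar_mother t"
proof -
  have "haar_mother (real p + t - real k) = (if k = p then haar_mother t else 0)" for k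
  proof (cases "k = p")
    case False
    then have "real k \<ge> real p + 1 \<or> real k + 1 \<le> real p" by linarith
    then show ?thesis using assms False by (auto simp: haar_mother_eq)
  qed simp
  then have "(\<Sum>k<2^n. c k * haar n k (cell_point n p t)) =
      (\<Sum>k<2^n. if k = p then c p * 2 powr (real n / 2) * haar_mother t else 0)"
    by (intro sum.cong) (auto simp: haar_cell_point)
  then show ?thesis using assms by simp
qed

text \<open>The supports are closed, so at an interior grid point both the cell starting there and
  the cell ending there contribute, with opposite signs. The case distinctions account for 0 and 1,
  where one neighbour is missing.\<close>

lemma finest_level_dyadic:
  assumes "p \<le> 2 ^ n"
  shows "(\<Sum>k<2^n. c k * haar n k (cell_point n p 0)) =
     2 powr (real n / 2) * ((if p < 2 ^ n then c p else 0) - (if 0 < p then c (p - 1) else 0))"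
proof -
  have hm: "haar_mother (real p - real k) = (if k = p then 1 else 0) - (if Suc k = p then 1 else 0)" for k
  proof -
    have "k = p \<or> Suc k = p \<or> real k \<ge> real p + 1 \<or> real k + 2 \<le> real p" by linarith
    then show ?thesis by (auto simp: haar_mother_eq)
  qed
  have "(\<Sum>k<2^n. c k * haar n k (cell_point n p 0)) =
      2 powr (real n / 2) * ((\<Sum>k<2^n. if k = p then c p else 0) - (\<Sum>k<2^n. if Suc k = p then c (p - 1) else 0))"
    unfolding sum_subtractf[symmetric] sum_distrib_left
    by (intro sum.cong) (auto simp: haar_cell_point hm)
  also have "(\<Sum>k<2^n. if Suc k = p then c (p - 1) else 0) = (\<Sum>k<2^n. if 0 < p \<and> k = p - 1 then c (p - 1) else 0)"
    by (intro sum.cong) auto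
  also have "\<dots> = (if 0 < p then c (p - 1) else 0)"
    using assms by (cases "p = 0") (auto simp: Suc_le_eq)
  finally show ?thesis using assms by simp
qed

text \<open>A Haar function of level below \<open>n\<close> jumps only at multiples of
  \<open>1 / 2 ^ n\<close>. In the induction, \<open>t / 2\<close> and \<open>(1 + t) / 2\<close>
  stay strictly inside one half of the parent cell, where \<open>haar_mother\<close> is
  constant.\<close>

lemma haar_sum_const_on_cell:
  assumes "p < 2 ^ n" "0 < t" "t < 1" "0 < t'" "t' < 1"
  shows "haar_sum c n (cell_point n p t) = haar_sum c n (cell_point n p t')"
  using assms
proof (induction n arbitrary: p t t')
  case (Suc n)
  obtain k where k: "p = 2 * k \<or> p = 2 * k + 1" by (metis oddE evenE)
  then have kn: "k < 2 ^ n" using Suc.prems by auto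
  from k show ?case
  proof
    assume [simp]: "p = 2 * k"
    have "haar_mother (t/2) = haar_mother (t'/2)" using Suc.prems by (simp add: haar_mother_eq)
    then show ?thesis using Suc.IH[OF kn, of "t/2" "t'/2"] Suc.prems
      by (simp add: haar_sum_Suc cell_point_even finest_level_cell_point kn)
  next
    assume p: "p = 2 * k + 1"
    have "haar_mother ((1+t)/2) = haar_mother ((1+t')/2)" using Suc.prems by (simp add: haar_mother_eq)
    then show ?thesis using Suc.IH[OF kn, of "(1+t)/2" "(1+t')/2"] Suc.prems(2-)
      unfolding p by (simp add: haar_sum_Suc cell_point_odd[simplified] finest_level_cell_point kn)
  qed
qed simp

text \<open>On the two halves of a finest cell the sum takes the values \<open>u \<plusminus> v\<close>, where \<open>u\<close> is the
  coarser partial sum and \<open>v\<close> the finest term; so both are bounded by \<open>r\<close>.\<close>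

lemma haar_sum_coefficient_bound:
  assumes "\<And>p t. p < 2 ^ n \<Longrightarrow> 0 < t \<Longrightarrow> t < 1 \<Longrightarrow> \<bar>haar_sum c n (cell_point n p t)\<bar> \<le> r"
  and "j < n" "k < 2 ^ j"
  shows "\<bar>c j k\<bar> \<le> r"
  using assms
proof (induction n)
  case (Suc n)
  have split: "\<bar>haar_sum c n (cell_point n k (1/2))\<bar> \<le> r \<and> \<bar>c n k\<bar> \<le> r" if k: "k < 2 ^ n" for k
  proof -
    define u where "u = haar_sum c n (cell_point n k (1/2))"
    define v where "v = c n k * 2 powr (real n / 2)"
    \<comment> \<open>The positions 1/4 and 3/4 of a cell are the midpoints of its two children, at
      which the hypothesis for level \<open>Suc n\<close> is applied.\<close>
    have "haar_sum c n (cell_point n k (1/4)) = u" "haar_sum c n (cell_point n k (3/4)) = u"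
      using haar_sum_const_on_cell k by (simp_all add: u_def)
    then have "haar_sum c (Suc n) (cell_point (Suc n) (2 * k) (1/2)) = u + v"
      "haar_sum c (Suc n) (cell_point (Suc n) (2 * k + 1) (1/2)) = u - v"
      using k by (simp_all add: haar_sum_Suc cell_point_even cell_point_odd[simplified] finest_level_cell_point
         v_def haar_mother_eq)
    then have "\<bar>u + v\<bar> \<le> r" "\<bar>u - v\<bar> \<le> r"
      using Suc.prems(1)[of "2*k" "1/2"] Suc.prems(1)[of "2*k+1" "1/2"] k by auto
    then have uv: "\<bar>u\<bar> \<le> r" "\<bar>v\<bar> \<le> r" by linarith+
    have "\<bar>c n k\<bar> * 1 \<le> \<bar>c n k\<bar> * 2 powr (real n / 2)" by (intro mult_left_mono ge_one_powr_ge_zero) auto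
    then have "\<bar>c n k\<bar> \<le> \<bar>v\<bar>" by (simp add: v_def abs_mult)
    with uv show ?thesis by (simp add: u_def)
  qed
  show ?case
  proof (cases "j = n")
    case False
    show ?thesis
    proof (rule Suc.IH)
      fix p :: nat and t :: real assume "p < 2 ^ n" "0 < t" "t < 1"
      then show "\<bar>haar_sum c n (cell_point n p t)\<bar> \<le> r"
        using split[of p] haar_sum_const_on_cell[of p n t "1/2" c] by simp
    qed (use Suc.prems False in auto)
  qed (use split Suc.prems in auto)
qed simp

section \<open>Dyadic averages and the values of the partial sums\<close>

definition dyadic_int :: "(real \<Rightarrow> real) \<Rightarrow> nat \<Rightarrow> nat \<Rightarrow> real" where
  "dyadic_int g n k = integral {cell_point n k 0..cell_point n k 1} g"

text \<open>The mean of \<open>g\<close> over the cell. At level 0 it is the overall mean, the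
  coefficient of the constant function, which the models leave to the normalizer.\<close>

definition dyadic_avg :: "(real \<Rightarrow> real) \<Rightarrow> nat \<Rightarrow> nat \<Rightarrow> real" where
  "dyadic_avg g n k = 2 ^ n * dyadic_int g n k"

lemma cell_subset:
  assumes "k < 2 ^ n" shows "{cell_point n k 0..cell_point n k 1} \<subseteq> {0..1}"
proof -
  have "real (k + 1) \<le> real (2 ^ n)" using assms by (intro of_nat_mono) linarith
  then show ?thesis
    by (auto simp: cell_point_def field_simps intro: order.trans)
qed

lemma cell_point_mem:
  assumes "k < 2 ^ n" "0 \<le> t" "t \<le> 1" shows "cell_point n k t \<in> {0..1}"
  using cell_subset[OF assms(1)] assms(2,3)
  by (auto simp: cell_point_def divide_right_mono subset_eq)

lemma dyadic_int_split:
  assumes g: "continuous_on {0..1} g" and k: "k < 2 ^ n"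
  shows "dyadic_int g n k = dyadic_int g (Suc n) (2 * k) + dyadic_int g (Suc n) (2 * k + 1)"
proof -
  have "g integrable_on {cell_point n k 0..cell_point n k 1}"
    by (intro integrable_continuous_real continuous_on_subset[OF g] cell_subset k)
  from Henstock_Kurzweil_Integration.integral_combine[OF _ _ this, of "cell_point n k (1/2)"]
  show ?thesis
    by (simp add: dyadic_int_def cell_point_even cell_point_odd[simplified]) (simp add: cell_point_def divide_right_mono)
qed

text \<open>Passage from Bochner integrals with respect to \<open>mu\<close> to gauge integrals over
  intervals, where cells are split at their midpoints.\<close>

lemma set_integral_mu_interval:
  fixes g :: "real \<Rightarrow> real"
  assumes g: "continuous_on {0..1} g" and ab: "{a..b} \<subseteq> {0..1}"
  shows "integrable mu (\<lambda>x. indicator {a..b} x * g x)"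
    "(\<integral>x. indicator {a..b} x * g x \<partial>mu) = integral {a..b} g"
proof -
  have c: "continuous_on {a..b} g" using g ab continuous_on_subset by blast
  then have i: "set_integrable lborel {a..b} g" by (rule borel_integrable_atLeastAtMost')
  have eq: "indicator {0..1} x * (indicator {a..b} x * g x) = indicator {a..b} x * g x" for x
    using ab by (auto simp: indicator_def fun_eq_iff)
  show "integrable mu (\<lambda>x. indicator {a..b} x * g x)"
    unfolding mu_def using i by (subst integrable_restrict_space) (auto simp: eq set_integrable_def)
  have "(\<integral>x. indicator {a..b} x * g x \<partial>mu) = set_lebesgue_integral lborel {a..b} g"
    unfolding mu_def by (subst integral_restrict_space) (auto simp: eq set_lebesgue_integral_def)
  also have "\<dots> = integral {a..b} g" using set_borel_integral_eq_integral(2)[OF i] .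
  finally show "(\<integral>x. indicator {a..b} x * g x \<partial>mu) = integral {a..b} g" .
qed

lemma haar_indicator:
  "haar n k x = 2 powr (real n / 2) *
    (indicator {cell_point n k 0..cell_point n k (1/2)} x - indicator {cell_point n k (1/2)..cell_point n k 1} x)"
  by (simp add: haar_def haar_mother_def cell_point_def indicator_def field_simps)

lemma haar_coeff_dyadic:
  assumes g: "continuous_on {0..1} g" and k: "k < 2 ^ n"
  shows "haar_coeff g n k = 2 powr (real n / 2) * (dyadic_int g (Suc n) (2 * k) - dyadic_int g (Suc n) (2 * k + 1))"
proof -
  have sub: "{cell_point n k 0..cell_point n k (1/2)} \<subseteq> {0..1}" "{cell_point n k (1/2)..cell_point n k 1} \<subseteq> {0..1}"
    using cell_subset[of "2*k" "Suc n"] cell_subset[of "2*k+1" "Suc n"] k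
    by (simp_all add: cell_point_even cell_point_odd[simplified])
  have "haar_coeff g n k = (\<integral>x. 2 powr (real n / 2) *
    (indicator {cell_point n k 0..cell_point n k (1/2)} x * g x - indicator {cell_point n k (1/2)..cell_point n k 1} x * g x) \<partial>mu)"
    unfolding haar_coeff_def haar_indicator by (simp add: algebra_simps)
  also have "\<dots> = 2 powr (real n / 2) * (integral {cell_point n k 0..cell_point n k (1/2)} g - integral {cell_point n k (1/2)..cell_point n k 1} g)"
    using set_integral_mu_interval[OF g sub(1)] set_integral_mu_interval[OF g sub(2)] by simp
  finally show ?thesis by (simp add: dyadic_int_def cell_point_even cell_point_odd[simplified])
qed

lemma powr_half_sq: "2 powr (real n / 2) * 2 powr (real n / 2) = (2::real) ^ n"
  by (simp flip: powr_add add: powr_realpow)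

text \<open>On a cell, adding its level \<open>n\<close> term replaces the mean over the cell by the
  mean over the half that contains the point. These are the increments of the dyadic martingale of
  \<open>g\<close>.\<close>

lemma haar_coeff_avg:
  assumes g: "continuous_on {0..1} g" and k: "k < 2 ^ n"
  shows "haar_coeff g n k * 2 powr (real n / 2) = dyadic_avg g (Suc n) (2 * k) - dyadic_avg g n k"
    and "haar_coeff g n k * 2 powr (real n / 2) = dyadic_avg g n k - dyadic_avg g (Suc n) (2 * k + 1)"
proof -
  have "haar_coeff g n k * 2 powr (real n / 2)
    = 2 ^ n * (dyadic_int g (Suc n) (2 * k) - dyadic_int g (Suc n) (2 * k + 1))"
    unfolding haar_coeff_dyadic[OF assms] powr_half_sq[symmetric] by (simp add: algebra_simps)
  then show "haar_coeff g n k * 2 powr (real n / 2) = dyadic_avg g (Suc n) (2 * k) - dyadic_avg g n k"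
    and "haar_coeff g n k * 2 powr (real n / 2) = dyadic_avg g n k - dyadic_avg g (Suc n) (2 * k + 1)"
    unfolding dyadic_avg_def dyadic_int_split[OF assms] by (simp_all add: algebra_simps)
qed

text \<open>The increments telescope down to level 0: the partial sum is the conditional mean of
  \<open>g\<close> given the cell, minus the overall mean.\<close>

lemma haar_partial_sum_cell:
  assumes g: "continuous_on {0..1} g" and "p < 2 ^ n" "0 < t" "t < 1"
  shows "haar_sum (haar_coeff g) n (cell_point n p t) = dyadic_avg g n p - dyadic_avg g 0 0"
  using assms(2-)
proof (induction n arbitrary: p t)
  case (Suc n)
  obtain k where k: "p = 2 * k \<or> p = 2 * k + 1" by (metis oddE evenE)
  then have kn: "k < 2 ^ n" using Suc.prems by auto
  from k show ?case
  proof
    assume [simp]: "p = 2 * k"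
    have "haar_mother (t/2) = 1" using Suc.prems by (simp add: haar_mother_eq)
    then show ?thesis using Suc.IH[OF kn, of "t/2"] Suc.prems
      by (simp add: haar_sum_Suc cell_point_even finest_level_cell_point kn haar_coeff_avg(1)[OF g kn])
  next
    assume p: "p = 2 * k + 1"
    have "haar_mother ((1+t)/2) = -1" using Suc.prems by (simp add: haar_mother_eq)
    then show ?thesis using Suc.IH[OF kn, of "(1+t)/2"] Suc.prems(2-) haar_coeff_avg(2)[OF g kn]
      unfolding p by (simp add: haar_sum_Suc cell_point_odd[simplified] finest_level_cell_point kn)
  qed
qed simp

text \<open>At a dyadic point \<open>x\<close> the partial sum is not the mean of its one-sided limits, because both
  neighbouring Haar functions of every finer level are nonzero at \<open>x\<close>. The cell \<open>(n', q)\<close> below is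
  the one whose midpoint is \<open>x\<close>.\<close>

lemma haar_partial_sum_dyadic:
  assumes g: "continuous_on {0..1} g" and "0 < p" "p < 2 ^ n"
  shows "\<exists>n' q. q < 2 ^ n' \<and> haar_sum (haar_coeff g) n (cell_point n p 0) =
     dyadic_avg g n (p - 1) + dyadic_avg g n p - dyadic_avg g n' q - dyadic_avg g 0 0"
  using assms(2-)
proof (induction n arbitrary: p)
  case (Suc n)
  obtain k where k: "p = 2 * k \<or> p = 2 * k + 1" by (metis oddE evenE)
  then have kn: "k < 2 ^ n" using Suc.prems by auto
  from k show ?case
  proof
    assume p [simp]: "p = 2 * k"
    \<comment> \<open>An even grid point is already a grid point of the coarser level. The finest
      level updates the means on both sides of it, and the subtracted cell is inherited from the
      induction hypothesis.\<close>
    have k0: "k > 0" using Suc.prems by simp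
    obtain n' q where q: "q < 2 ^ n'" "haar_sum (haar_coeff g) n (cell_point n k 0) =
     dyadic_avg g n (k - 1) + dyadic_avg g n k - dyadic_avg g n' q - dyadic_avg g 0 0" using Suc.IH[OF k0 kn] by auto
    have "2 * (k - 1) + 1 = p - 1" using k0 by simp
    then have "haar_sum (haar_coeff g) (Suc n) (cell_point (Suc n) p 0) =
     dyadic_avg g (Suc n) (p - 1) + dyadic_avg g (Suc n) p - dyadic_avg g n' q - dyadic_avg g 0 0"
      using q(2) k0 kn haar_coeff_avg(1)[OF g kn] haar_coeff_avg(2)[OF g, of "k-1" n]
      unfolding p haar_sum_Suc cell_point_even
      by (simp add: finest_level_dyadic right_diff_distrib mult.commute[of "2 powr _"] del: One_nat_def)
    with q(1) show ?thesis by blast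
  next
    assume p: "p = 2 * k + 1"
    \<comment> \<open>The point is the midpoint of the cell \<open>k\<close>, where the finest term
      vanishes because \<open>haar_mother (1/2) = 0\<close>. The means over the two halves add up to
      twice the mean over the cell, so subtracting the latter once gives the claim with the witness
      \<open>(n, k)\<close>.\<close>
    have "haar_sum (haar_coeff g) (Suc n) (cell_point (Suc n) p 0) = dyadic_avg g n k - dyadic_avg g 0 0"
      unfolding p cell_point_odd by (simp add: haar_sum_Suc finest_level_cell_point kn haar_partial_sum_cell[OF g] haar_mother_eq)
    moreover have "dyadic_avg g (Suc n) (p - 1) + dyadic_avg g (Suc n) p = 2 * dyadic_avg g n k"
      unfolding p using haar_coeff_avg[OF g kn] by simp
    ultimately show ?thesis using kn by (intro exI[of _ n] exI[of _ k]) auto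
  qed
qed simp

text \<open>Only one Haar function per level is nonzero at an end of the interval, so the
  telescoping is the same as inside a cell.\<close>

lemma haar_partial_sum_ends:
  assumes g: "continuous_on {0..1} g"
  shows "haar_sum (haar_coeff g) n 0 = dyadic_avg g n 0 - dyadic_avg g 0 0"
    and "haar_sum (haar_coeff g) n 1 = dyadic_avg g n (2 ^ n - 1) - dyadic_avg g 0 0"
proof (induction n)
  case (Suc n)
  have c0: "(0::real) = cell_point n 0 0" and c1: "(1::real) = cell_point n (2 ^ n) 0" by (simp_all add: cell_point_def)
  {
    case 1 show ?case
      using haar_coeff_avg(1)[OF g, of 0 n] Suc(1) finest_level_dyadic[of 0 n "haar_coeff g n", folded c0]
      by (simp add: haar_sum_Suc algebra_simps)
  next
    case 2
    have e: "2 * (2 ^ n - 1) + 1 = (2 ^ Suc n - 1 :: nat)"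
      using one_le_power[of "2::nat" n] unfolding power_Suc by arith
    show ?case
      using haar_coeff_avg(2)[OF g, of "2^n-1" n, unfolded e] Suc(2) finest_level_dyadic[of "2^n" n "haar_coeff g n", folded c1]
      by (simp add: haar_sum_Suc algebra_simps)
  }
qed simp_all

lemma unit_interval_cell:
  assumes "x \<in> {0..1::real}"
  obtains p t where "p < 2 ^ n" "0 < t" "t < 1" "x = cell_point n p t" | p where "p \<le> 2 ^ n" "x = cell_point n p 0"
proof -
  define p where "p = nat \<lfloor>x * 2 ^ n\<rfloor>"
  define t where "t = frac (x * 2 ^ n)"
  have nn: "0 \<le> x * 2 ^ n" "x * 2 ^ n \<le> 2 ^ n" using assms by auto
  then have "real p = of_int \<lfloor>x * 2 ^ n\<rfloor>" by (simp add: p_def)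
  then have pt: "real p + t = x * 2 ^ n" by (simp add: t_def frac_def)
  then have x: "x = cell_point n p t" by (simp add: cell_point_def)
  have t: "0 \<le> t" "t < 1" by (simp_all add: t_def frac_lt_1)
  show ?thesis
  proof (cases "t = 0")
    case True
    then have "real p \<le> real (2 ^ n)" using pt nn by simp
    then show ?thesis using that(2)[of p] x True unfolding of_nat_le_iff by simp
  next
    case False
    then have "real p < 2 ^ n" using pt nn(2) t by linarith
    then have "real p < real (2 ^ n)" by simp
    then show ?thesis using that(1)[of p t] x False t unfolding of_nat_less_iff by simp
  qed
qed

lemma dyadic_avg_bound:
  assumes g: "continuous_on {0..1} g" and k: "k < 2 ^ n"
    and b: "\<And>x. x \<in> {cell_point n k 0..cell_point n k 1} \<Longrightarrow> \<bar>g x\<bar> \<le> M"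
  shows "\<bar>dyadic_avg g n k\<bar> \<le> M"
proof -
  have len: "cell_point n k 1 - cell_point n k 0 = 1 / 2 ^ n" "cell_point n k 0 \<le> cell_point n k 1"
    by (simp_all add: cell_point_def field_simps)
  have "norm (dyadic_int g n k) \<le> M * (cell_point n k 1 - cell_point n k 0)"
    unfolding dyadic_int_def
    using len b cell_subset[OF k] by (intro integral_bound continuous_on_subset[OF g]) (auto simp: subset_eq)
  then show ?thesis by (simp add: dyadic_avg_def len abs_mult field_simps)
qed

text \<open>At a dyadic point up to four averages enter, each at most \<open>M\<close> in modulus.
  The bound is stated for every point because \<open>Theta\<close> is defined with a supremum and
  not an essential supremum.\<close>

lemma haar_partial_sum_bound:
  assumes g: "continuous_on {0..1} g" and b: "\<And>x. x \<in> {0..1} \<Longrightarrow> \<bar>g x\<bar> \<le> M" and x: "x \<in> {0..1}"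
  shows "\<bar>haar_sum (haar_coeff g) n x\<bar> \<le> 4 * M"
proof -
  have db: "\<bar>dyadic_avg g n k\<bar> \<le> M" if "k < 2 ^ n" for n k
    using dyadic_avg_bound[OF g that] b cell_subset[OF that] by blast
  have M: "0 \<le> M" using b[OF x] by linarith
  have d0: "\<bar>dyadic_avg g 0 0\<bar> \<le> M" by (rule db) simp_all
  from x show ?thesis
  proof (cases rule: unit_interval_cell[of _ n])
    case (1 p t)
    then show ?thesis using db[of p n] d0 M by (simp add: haar_partial_sum_cell[OF g])
  next
    case (2 p)
    consider "p = 0" | "p = 2 ^ n" | "0 < p" "p < 2 ^ n" using 2(1) by linarith
    then show ?thesis
    proof cases
      case 1
      then have "x = 0" using 2 by (simp add: cell_point_def)
      then show ?thesis using haar_partial_sum_ends(1)[OF g, of n] d0 db[of 0 n] M by simp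
    next
      case 2
      then have "x = 1" using \<open>x = _\<close> by (simp add: cell_point_def)
      then show ?thesis using haar_partial_sum_ends(2)[OF g, of n] d0 db[of "2 ^ n - 1" n] M by simp
    next
      case 3
      obtain n' q where "q < 2 ^ n'" "haar_sum (haar_coeff g) n x =
         dyadic_avg g n (p - 1) + dyadic_avg g n p - dyadic_avg g n' q - dyadic_avg g 0 0"
        using haar_partial_sum_dyadic[OF g 3] 2(2) by auto
      moreover have "p - 1 < 2 ^ n" using 3 by simp
      ultimately show ?thesis using db[of q n'] db[of p n] db[of "p-1" n] d0 3 by linarith
    qed
  qed
qed


section \<open>Mean square error of the truncated expansion\<close>

lemma cell_length [simp]:
  "cell_point n k 0 \<le> cell_point n k 1" "cell_point n k 1 - cell_point n k 0 = 1 / 2 ^ n"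
  by (simp_all add: cell_point_def field_simps)

text \<open>The sum over cells of the integrated squared deviation from the mean, that is, the
  squared distance in L2 from \<open>g\<close> to the functions constant on cells of level
  \<open>n\<close>. In terms of integrals of \<open>g\<close> and of its square, refinement is
  purely algebraic.\<close>

definition dyadic_residual :: "(real \<Rightarrow> real) \<Rightarrow> nat \<Rightarrow> real" where
  "dyadic_residual g n = (\<Sum>k<2^n. dyadic_int (\<lambda>x. (g x)\<^sup>2) n k - 2 ^ n * (dyadic_int g n k)\<^sup>2)"

lemma sum_lessThan_double:
  fixes f :: "nat \<Rightarrow> real"
  shows "(\<Sum>k<2 * N. f k) = (\<Sum>k<N. f (2 * k) + f (2 * k + 1))"
  by (induction N) (simp_all add: sum.lessThan_Suc)

text \<open>With a and b the integrals over the two halves of a cell, 2 (a^2 + b^2) - (a + b)^2 = (a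
  - b)^2, and \<open>2 ^ n\<close> times this is the squared coefficient. Summed over the levels
  this becomes Parseval's identity.\<close>

lemma dyadic_residual_diff:
  assumes g: "continuous_on {0..1} g"
  shows "dyadic_residual g n = dyadic_residual g (Suc n) + (\<Sum>k<2^n. (haar_coeff g n k)\<^sup>2)"
proof -
  have g2: "continuous_on {0..1} (\<lambda>x. (g x)\<^sup>2)" by (intro continuous_intros g)
  show ?thesis
    unfolding dyadic_residual_def power_Suc sum_lessThan_double sum.distrib[symmetric]
  proof (intro sum.cong refl)
    fix k assume "k \<in> {..<2 ^ n :: nat}"
    then have k: "k < 2 ^ n" by simp
    have "(haar_coeff g n k)\<^sup>2 = 2 ^ n * (dyadic_int g (Suc n) (2 * k) - dyadic_int g (Suc n) (2 * k + 1))\<^sup>2"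
      unfolding haar_coeff_dyadic[OF g k] power_mult_distrib powr_half_sq[symmetric] by (simp add: power2_eq_square)
    then show "dyadic_int (\<lambda>x. (g x)\<^sup>2) n k - 2 ^ n * (dyadic_int g n k)\<^sup>2 =
         dyadic_int (\<lambda>x. (g x)\<^sup>2) (Suc n) (2 * k) - 2 * 2 ^ n * (dyadic_int g (Suc n) (2 * k))\<^sup>2 +
         (dyadic_int (\<lambda>x. (g x)\<^sup>2) (Suc n) (2 * k + 1) - 2 * 2 ^ n * (dyadic_int g (Suc n) (2 * k + 1))\<^sup>2) +
         (haar_coeff g n k)\<^sup>2"
      unfolding dyadic_int_split[OF g k] dyadic_int_split[OF g2 k] by (simp add: power2_eq_square algebra_simps)
  qed
qed

lemma dyadic_int_cell_variance:
  assumes g: "continuous_on {0..1} g" and k: "k < 2 ^ n"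
  shows "integral {cell_point n k 0..cell_point n k 1} (\<lambda>x. (g x - dyadic_avg g n k)\<^sup>2) =
    dyadic_int (\<lambda>x. (g x)\<^sup>2) n k - 2 ^ n * (dyadic_int g n k)\<^sup>2"
proof -
  let ?I = "{cell_point n k 0..cell_point n k 1}" and ?A = "dyadic_avg g n k"
  have c: "continuous_on ?I g" using continuous_on_subset[OF g cell_subset[OF k]] .
  have "integral ?I (\<lambda>x. (g x - ?A)\<^sup>2) = integral ?I (\<lambda>x. ((g x)\<^sup>2 - (2 * ?A) * g x) + ?A\<^sup>2)"
    by (simp add: power2_eq_square algebra_simps)
  also have "\<dots> = (integral ?I (\<lambda>x. (g x)\<^sup>2) - integral ?I (\<lambda>x. (2 * ?A) * g x)) + integral ?I (\<lambda>x. ?A\<^sup>2)"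
    by (subst Henstock_Kurzweil_Integration.integral_add Henstock_Kurzweil_Integration.integral_diff;
        (intro integrable_continuous_real continuous_intros c)?)+ (rule refl)
  also have "\<dots> = dyadic_int (\<lambda>x. (g x)\<^sup>2) n k - 2 * ?A * dyadic_int g n k + ?A\<^sup>2 / 2 ^ n"
    by (simp add: dyadic_int_def)
  also have "\<dots> = dyadic_int (\<lambda>x. (g x)\<^sup>2) n k - 2 ^ n * (dyadic_int g n k)\<^sup>2"
    by (simp add: dyadic_avg_def power2_eq_square field_simps)
  finally show ?thesis .
qed

lemma dyadic_avg_deviation:
  assumes g: "continuous_on {0..1} g" and k: "k < 2 ^ n"
    and x: "x \<in> {cell_point n k 0..cell_point n k 1}"
    and b: "\<And>y. y \<in> {cell_point n k 0..cell_point n k 1} \<Longrightarrow> \<bar>g y - g x\<bar> \<le> e"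
  shows "\<bar>g x - dyadic_avg g n k\<bar> \<le> e"
proof -
  let ?I = "{cell_point n k 0..cell_point n k 1}"
  have c: "continuous_on ?I g" using continuous_on_subset[OF g cell_subset[OF k]] .
  have "integral ?I (\<lambda>y. g y - g x) = integral ?I g - integral ?I (\<lambda>y. g x)"
    by (intro Henstock_Kurzweil_Integration.integral_diff integrable_continuous_real continuous_intros c)
  then have "integral ?I (\<lambda>y. g y - g x) = integral ?I g - g x / 2 ^ n" by simp
  then have "dyadic_avg (\<lambda>y. g y - g x) n k = dyadic_avg g n k - g x"
    unfolding dyadic_avg_def dyadic_int_def by (simp add: right_diff_distrib)
  moreover have "\<bar>dyadic_avg (\<lambda>y. g y - g x) n k\<bar> \<le> e"
    by (intro dyadic_avg_bound k b continuous_intros g)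
  ultimately show ?thesis by linarith
qed

text \<open>Uniform continuity bounds the oscillation on small cells. Completeness of the Haar
  system enters here: the residual is the entire tail of squared coefficients, with nothing left
  over.\<close>

lemma dyadic_residual_tendsto_0:
  assumes g: "continuous_on {0..1} g"
  shows "dyadic_residual g \<longlonglongrightarrow> 0"
proof (rule LIMSEQ_I)
  fix r :: real assume "0 < r"
  define e where "e = sqrt (r / 2)"
  have e: "0 < e" "e\<^sup>2 < r" using \<open>0 < r\<close> by (simp_all add: e_def)
  have "uniformly_continuous_on {0..1} g"
    using g by (intro compact_uniformly_continuous) auto
  then obtain d where d: "d > 0" "\<And>x y. x \<in> {0..1} \<Longrightarrow> y \<in> {0..1} \<Longrightarrow> dist y x < d \<Longrightarrow> dist (g y) (g x) < e"
    using e(1) unfolding uniformly_continuous_on_def by metis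
  obtain N where N: "(1/2::real) ^ N < d" using d(1) real_arch_pow_inv[of d "1/2"] by auto
  have "norm (dyadic_residual g n - 0) < r" if "n \<ge> N" for n
  proof -
    have "(1/2::real) ^ n \<le> (1/2) ^ N" using power_decreasing[OF that, of "1/2::real"] by simp
    then have n: "(1/2::real) ^ n < d" using N by linarith
    have cell: "integral {cell_point n k 0..cell_point n k 1} (\<lambda>x. (g x - dyadic_avg g n k)\<^sup>2) \<in> {0..e\<^sup>2 * (1 / 2 ^ n)}"
      if k: "k < 2 ^ n" for k
    proof -
      let ?I = "{cell_point n k 0..cell_point n k 1}"
      have c: "continuous_on ?I g" using continuous_on_subset[OF g cell_subset[OF k]] .
      have len: "cell_point n k 1 - cell_point n k 0 = 1 / 2 ^ n" "cell_point n k 0 \<le> cell_point n k 1"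
        by (simp_all add: cell_point_def field_simps)
      have dev: "\<bar>g x - dyadic_avg g n k\<bar> \<le> e" if x: "x \<in> ?I" for x
      proof (rule dyadic_avg_deviation[OF g k x])
        fix y assume y: "y \<in> ?I"
        have "dist y x \<le> (1/2) ^ n" using x y len unfolding dist_real_def power_one_over atLeastAtMost_iff by linarith
        then have "dist y x < d" using n by linarith
        then show "\<bar>g y - g x\<bar> \<le> e" using d(2)[of x y] x y cell_subset[OF k] by (auto simp: dist_real_def subset_eq)
      qed
      have int: "(\<lambda>x. (g x - dyadic_avg g n k)\<^sup>2) integrable_on ?I"
        by (intro integrable_continuous_real continuous_intros c)
      have "integral ?I (\<lambda>x. (g x - dyadic_avg g n k)\<^sup>2) \<le> integral ?I (\<lambda>x. e\<^sup>2)"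
        using dev by (intro integral_le int integrable_const_ivl) (metis abs_ge_zero power2_abs power_mono)
      also have "\<dots> = e\<^sup>2 * (1 / 2 ^ n)" by simp
      finally show ?thesis using int by (auto intro!: Henstock_Kurzweil_Integration.integral_nonneg)
    qed
    have "dyadic_residual g n = (\<Sum>k<2^n. integral {cell_point n k 0..cell_point n k 1} (\<lambda>x. (g x - dyadic_avg g n k)\<^sup>2))"
      unfolding dyadic_residual_def by (intro sum.cong refl) (simp add: dyadic_int_cell_variance[OF g])
    moreover have "\<dots> \<le> (\<Sum>k<(2::nat)^n. e\<^sup>2 * (1 / 2 ^ n))" using cell by (intro sum_mono) auto
    moreover have "\<dots> = e\<^sup>2" by simp
    moreover have "0 \<le> (\<Sum>k<2^n. integral {cell_point n k 0..cell_point n k 1} (\<lambda>x. (g x - dyadic_avg g n k)\<^sup>2))"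
      using cell by (intro sum_nonneg) auto
    ultimately show ?thesis using e(2) by simp
  qed
  then show "\<exists>no. \<forall>n\<ge>no. norm (dyadic_residual g n - 0) < r" by blast
qed

text \<open>By telescoping, the residual is the sum of the squared coefficients of levels at least
  \<open>n\<close>. The weight of each such level is at least
  \<open>(2 ^ n) powr (2 * \<alpha>)\<close>, because \<open>2 ^ (j + 1) - 1\<close> is at least
  \<open>2 ^ j\<close>.\<close>

lemma dyadic_residual_decay:
  assumes g: "continuous_on {0..1} g" and "0 < \<alpha>"
    and s: "summable (\<lambda>j. (2 ^ (j + 1) - 1) powr (2 * \<alpha>) * (\<Sum>k<2^j. (haar_coeff g j k)\<^sup>2))"
    and h: "(\<Sum>j. (2 ^ (j + 1) - 1) powr (2 * \<alpha>) * (\<Sum>k<2^j. (haar_coeff g j k)\<^sup>2)) \<le> H"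
  shows "dyadic_residual g n \<le> H * (2 ^ n) powr (- (2 * \<alpha>))"
proof -
  let ?D = "\<lambda>j. \<Sum>k<2^j. (haar_coeff g j k)\<^sup>2"
  let ?w = "\<lambda>j. (2 ^ (j + 1) - 1) powr (2 * \<alpha>)"
  have D0: "0 \<le> ?D j" for j by (intro sum_nonneg) simp
  have tel: "dyadic_residual g n = dyadic_residual g (n + N) + (\<Sum>i<N. ?D (n + i))" for N
    by (induction N) (simp_all add: dyadic_residual_diff[OF g, of "n + _"])
  have bound: "(2 ^ n) powr (2 * \<alpha>) * (\<Sum>i<N. ?D (n + i)) \<le> H" for N
  proof -
    have "(2 ^ n) powr (2 * \<alpha>) * (\<Sum>i<N. ?D (n + i)) \<le> (\<Sum>i<N. ?w (n + i) * ?D (n + i))"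
      unfolding sum_distrib_left
    proof (intro sum_mono mult_right_mono D0 powr_mono2)
      fix i
      have "(2::real) ^ n \<le> 2 ^ (n + i)" "(1::real) \<le> 2 ^ (n + i)" by (simp_all add: one_le_power power_increasing)
      moreover have "(2::real) ^ (n + i + 1) = 2 * 2 ^ (n + i)" by simp
      ultimately show "(2::real) ^ n \<le> 2 ^ (n + i + 1) - 1" by linarith
    qed (use \<open>0 < \<alpha>\<close> in auto)
    also have "\<dots> = (\<Sum>j\<in>(+) n ` {..<N}. ?w j * ?D j)" by (simp add: sum.reindex)
    also have "\<dots> \<le> (\<Sum>j. ?w j * ?D j)" by (intro sum_le_suminf s) (auto intro!: mult_nonneg_nonneg D0)
    finally show ?thesis using h by linarith
  qed
  have "(2 ^ n) powr (2 * \<alpha>) * (dyadic_residual g n - dyadic_residual g (n + N)) \<le> H" for N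
    using bound[of N] tel[of N] by simp
  moreover have "(\<lambda>N. (2 ^ n) powr (2 * \<alpha>) * (dyadic_residual g n - dyadic_residual g (n + N))) \<longlonglongrightarrow>
      (2 ^ n) powr (2 * \<alpha>) * (dyadic_residual g n - 0)"
    by (intro tendsto_intros LIMSEQ_ignore_initial_segment[OF dyadic_residual_tendsto_0[OF g], of n, unfolded add.commute[of _ n]])
  ultimately have "(2 ^ n) powr (2 * \<alpha>) * (dyadic_residual g n - 0) \<le> H"
    using LIMSEQ_le_const2 by blast
  then show ?thesis by (simp add: powr_minus field_simps)
qed

lemma borel_measurable_mu_continuous:
  assumes "continuous_on {0..1} g" shows "(g :: real \<Rightarrow> real) \<in> borel_measurable mu"
proof -
  have "sets mu = sets (restrict_space borel {0..1})"
    unfolding mu_def by (intro sets_restrict_space_cong) simp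
  then show ?thesis
    using borel_measurable_continuous_on_restrict[OF assms] by (simp cong: measurable_cong_sets)
qed

lemma borel_measurable_mu_haar [measurable]: "haar j k \<in> borel_measurable mu"
  unfolding haar_indicator[abs_def] mu_def by (intro measurable_restrict_space1) measurable

lemma AE_mu_not_finite:
  assumes "finite (F :: real set)" shows "AE x in mu. x \<in> {0..1} \<and> x \<notin> F"
proof -
  have "AE x in lborel. x \<notin> F"
    using assms by (intro AE_not_in) (auto intro!: finite_imp_null_set_lborel)
  then show ?thesis unfolding mu_def by (subst AE_restrict_space_iff) auto
qed

text \<open>An almost-everywhere identity is enough here: off the finitely many grid points the
  integrand is the squared deviation of \<open>g\<close> from its mean over the cell.\<close>

lemma haar_approximation_error:
  assumes g: "continuous_on {0..1} g"
  shows "(\<integral>x. (g x - dyadic_avg g 0 0 - haar_sum (haar_coeff g) n x)\<^sup>2 \<partial>mu) = dyadic_residual g n"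
proof -
  let ?I = "\<lambda>k. {cell_point n k 0..cell_point n k 1}"
  let ?F = "(\<lambda>p. cell_point n p 0) ` {..2^n}"
  have "(g x - dyadic_avg g 0 0 - haar_sum (haar_coeff g) n x)\<^sup>2 =
     (\<Sum>k<2^n. indicator (?I k) x * (g x - dyadic_avg g n k)\<^sup>2)"
    if x: "x \<in> {0..1}" "x \<notin> ?F" for x
  proof -
    obtain p t where pt: "p < 2 ^ n" "0 < t" "t < 1" "x = cell_point n p t"
      using unit_interval_cell[OF x(1), of n] x(2) by (metis atMost_iff imageI)
    \<comment> \<open>Closed cells meet only at grid points, which are excluded.\<close>
    have ind: "indicator (?I k) x = (if k = p then 1 else 0 :: real)" for k
    proof -
      have "k = p \<or> real k \<ge> real p + 1 \<or> real k + 1 \<le> real p" by linarith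
      then show ?thesis using pt(2,3) unfolding pt(4) by (auto simp: cell_point_def divide_le_cancel indicator_def)
    qed
    have "(\<Sum>k<2^n. indicator (?I k) x * (g x - dyadic_avg g n k)\<^sup>2) = (\<Sum>k<2^n. if k = p then (g x - dyadic_avg g n k)\<^sup>2 else 0)"
      unfolding ind by (intro sum.cong) auto
    also have "\<dots> = (g x - dyadic_avg g n p)\<^sup>2" using pt(1) by simp
    also have "\<dots> = (g x - dyadic_avg g 0 0 - haar_sum (haar_coeff g) n x)\<^sup>2"
      using haar_partial_sum_cell[OF g pt(1-3)] unfolding pt(4) by simp
    finally show ?thesis by simp
  qed
  moreover have "AE x in mu. x \<in> {0..1} \<and> x \<notin> ?F" by (rule AE_mu_not_finite) simp
  ultimately have ae: "AE x in mu. (g x - dyadic_avg g 0 0 - haar_sum (haar_coeff g) n x)\<^sup>2 =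
     (\<Sum>k<2^n. indicator (?I k) x * (g x - dyadic_avg g n k)\<^sup>2)" by auto
  have cont: "continuous_on {0..1} (\<lambda>x. (g x - dyadic_avg g n k)\<^sup>2)" for k
    by (intro continuous_intros g)
  note gm = borel_measurable_mu_continuous[OF g]
  have "(\<integral>x. (g x - dyadic_avg g 0 0 - haar_sum (haar_coeff g) n x)\<^sup>2 \<partial>mu) =
     (\<integral>x. (\<Sum>k<2^n. indicator (?I k) x * (g x - dyadic_avg g n k)\<^sup>2) \<partial>mu)"
  proof (rule integral_cong_AE[OF _ _ ae])
    show "(\<lambda>x. (g x - dyadic_avg g 0 0 - haar_sum (haar_coeff g) n x)\<^sup>2) \<in> borel_measurable mu"
      unfolding haar_sum_def using gm by measurable
    show "(\<lambda>x. \<Sum>k<2^n. indicator (?I k) x * (g x - dyadic_avg g n k)\<^sup>2) \<in> borel_measurable mu"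
      using set_integral_mu_interval(1)[OF cont cell_subset] by (intro borel_measurable_sum) auto
  qed
  also have "\<dots> = (\<Sum>k<2^n. integral (?I k) (\<lambda>x. (g x - dyadic_avg g n k)\<^sup>2))"
    using set_integral_mu_interval[OF cont cell_subset]
    by (subst Bochner_Integration.integral_sum) auto
  also have "\<dots> = dyadic_residual g n"
    unfolding dyadic_residual_def by (intro sum.cong refl) (simp add: dyadic_int_cell_variance[OF g])
  finally show ?thesis .
qed

text \<open>\<open>haar_reindexing\<close> enumerates a set of functions, whereas sums over levels
  are indexed by pairs. Injectivity of the indexing by pairs follows by counting: the set of
  functions has \<open>m_dim (l, L) - 1\<close> elements, as many as there are pairs.\<close>

lemma haar_reindexing_levels:
  assumes B: "haar_reindexing B" and j: "(l, L) \<in> J"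
  obtains \<beta> where "bij_betw \<beta> (SIGMA j:{..<Suc l}. {..<2^j}) {1..m_dim (l, L) - 1}"
    "\<And>j k. j \<le> l \<Longrightarrow> k < 2 ^ j \<Longrightarrow> B (l, L) (\<beta> (j, k)) = haar j k"
proof -
  let ?I = "{1..m_dim (l, L) - 1}" and ?X = "SIGMA j:{..<Suc l}. {..<2^j::nat}"
  let ?h = "\<lambda>(j, k). haar j k"
  have bij: "bij_betw (B (l, L)) ?I (?h ` ?X)"
  proof -
    have "{haar j1 k1 |j1 k1. j1 \<le> l \<and> k1 \<le> 2 ^ j1 - 1} = ?h ` ?X"
    proof -
      have le: "(k \<le> 2 ^ j - 1) = (k < 2 ^ j)" for k j :: nat
        using one_le_power[of "2::nat" j] by linarith
      show ?thesis unfolding le by (force simp: less_Suc_eq_le)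
    qed
    then show ?thesis using B j unfolding haar_reindexing_def by force
  qed
  have "card ?X = (\<Sum>j<Suc l. 2 ^ j)" by simp
  also have "\<dots> = 2 ^ (l + 1) - 1" by (induction l) (simp_all add: sum.lessThan_Suc)
  finally have "card ?X = card ?I" by (simp add: m_dim_def)
  then have "card (?h ` ?X) = card ?X" using bij_betw_same_card[OF bij] by simp
  then have "bij_betw ?h ?X (?h ` ?X)" by (simp add: bij_betw_def eq_card_imp_inj_on)
  moreover have "bij_betw (inv_into ?I (B (l, L))) (?h ` ?X) ?I" by (rule bij_betw_inv_into[OF bij])
  ultimately have "bij_betw (inv_into ?I (B (l, L)) \<circ> ?h) ?X ?I" by (rule bij_betw_trans)
  moreover have "B (l, L) ((inv_into ?I (B (l, L)) \<circ> ?h) (j, k)) = haar j k" if "j \<le> l" "k < 2 ^ j" for j k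
  proof -
    have "haar j k \<in> ?h ` ?X" using that by (force simp: less_Suc_eq_le)
    then show ?thesis using bij by (simp add: bij_betw_def f_inv_into_f)
  qed
  ultimately show ?thesis using that by blast
qed

lemma lin_comb_haar_sum:
  assumes "bij_betw \<beta> (SIGMA j:{..<Suc l}. {..<2^j}) {1..m_dim (l, L) - 1}"
    "\<And>j k. j \<le> l \<Longrightarrow> k < 2 ^ j \<Longrightarrow> B (l, L) (\<beta> (j, k)) = haar j k"
  shows "lin_comb B (l, L) \<theta> x = haar_sum (\<lambda>j k. \<theta> (\<beta> (j, k))) (Suc l) x"
proof -
  have "lin_comb B (l, L) \<theta> x = (\<Sum>jk\<in>(SIGMA j:{..<Suc l}. {..<2^j}). \<theta> (\<beta> jk) * B (l, L) (\<beta> jk) x)"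
    unfolding lin_comb_def by (rule sum.reindex_bij_betw[OF assms(1), symmetric])
  also have "\<dots> = (\<Sum>j<Suc l. \<Sum>k<2^j. \<theta> (\<beta> (j, k)) * B (l, L) (\<beta> (j, k)) x)"
    by (subst sum.Sigma) auto
  finally show ?thesis
    using assms(2) by (auto simp: haar_sum_def less_Suc_eq_le intro!: sum.cong)
qed


section \<open>The parameter spaces and the model densities\<close>

text \<open>Uniqueness of the product measure reduces the change of variables to boxes, and there to
  the affine rule for one coordinate. The volumes of all balls below come from this rule.\<close>

lemma emeasure_PiM_lborel_affine:
  fixes t :: "'i \<Rightarrow> real"
  assumes I: "finite I" and r: "0 < r" and A: "A \<in> sets (Pi\<^sub>M I (\<lambda>_. lborel))"
  shows "emeasure (Pi\<^sub>M I (\<lambda>_. lborel)) A = ennreal (r ^ card I) *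
    emeasure (Pi\<^sub>M I (\<lambda>_. lborel)) {\<theta> \<in> space (Pi\<^sub>M I (\<lambda>_. lborel)). (\<lambda>i\<in>I. t i + r * \<theta> i) \<in> A}"
proof -
  interpret product_sigma_finite "\<lambda>_::'i. lborel :: real measure" by standard
  let ?M = "Pi\<^sub>M I (\<lambda>_. lborel) :: ('i \<Rightarrow> real) measure"
  let ?T = "\<lambda>\<theta>. \<lambda>i\<in>I. t i + r * \<theta> i"
  have T: "?T \<in> measurable ?M ?M" by measurable
  let ?N = "density (distr ?M ?M ?T) (\<lambda>_. ennreal (r ^ card I))"
  have em: "emeasure ?N A = ennreal (r ^ card I) * emeasure ?M {\<theta> \<in> space ?M. ?T \<theta> \<in> A}" if "A \<in> sets ?M" for A
    using that T by (simp add: emeasure_density nn_integral_cmult emeasure_distr vimage_def Int_def conj_commute)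
  have "?N = ?M"
  proof (rule PiM_eqI[OF I])
    fix A :: "'i \<Rightarrow> real set" assume A: "\<And>i. i \<in> I \<Longrightarrow> A i \<in> sets lborel"
    let ?P = "\<lambda>i. (\<lambda>x. t i + r * x) -` A i"
    have one: "emeasure lborel (A i) = ennreal r * emeasure lborel (?P i)" if "i \<in> I" for i
    proof -
      have "emeasure lborel (A i) = emeasure (density (distr lborel borel (\<lambda>x. t i + r * x)) (\<lambda>_. ennreal \<bar>r\<bar>)) (A i)"
        using lborel_real_affine[of r "t i"] r by simp
      also have "\<dots> = ennreal r * emeasure lborel (?P i)"
        using A[OF that] r by (simp add: emeasure_density nn_integral_cmult emeasure_distr)
      finally show ?thesis .
    qed
    have P: "?P i \<in> sets lborel" if "i \<in> I" for i
      using measurable_sets[of "\<lambda>x. t i + r * x" lborel borel "A i"] A[OF that] by simp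
    have "{\<theta> \<in> space ?M. ?T \<theta> \<in> Pi\<^sub>E I A} = Pi\<^sub>E I ?P"
      by (auto simp: space_PiM PiE_def Pi_def extensional_def)
    moreover have "Pi\<^sub>E I A \<in> sets ?M" using A I by (intro sets_PiM_I_finite) auto
    ultimately have "emeasure ?N (Pi\<^sub>E I A) = ennreal (r ^ card I) * (\<Prod>i\<in>I. emeasure lborel (?P i))"
      using em emeasure_PiM[OF I P] by simp
    also have "\<dots> = (\<Prod>i\<in>I. emeasure lborel (A i))"
      using one r by (simp add: prod.distrib ennreal_power)
    finally show "emeasure ?N (Pi\<^sub>E I A) = (\<Prod>i\<in>I. emeasure lborel (A i))" .
  qed simp
  then show ?thesis using em[OF A] by simp
qed

lemma space_mu [simp]: "space mu = {0..1}"
  by (simp add: mu_def)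

lemma prob_space_mu: "prob_space mu"
  by (intro prob_spaceI) (simp add: mu_def emeasure_restrict_space)

interpretation mu: prob_space mu
  by (rule prob_space_mu)

text \<open>Finite ranges make every linear combination bounded and turn conditions over all points
  of the interval into finitely many.\<close>

lemma finite_range_haar: "finite (range (haar j k))"
proof (rule finite_subset)
  show "range (haar j k) \<subseteq> {2 powr (real j / 2) * c |c. c \<in> {0, 1, -1}}"
    by (force simp: haar_def haar_mother_eq)
qed simp

lemma sup_norm_le_iff:
  assumes "bdd_above ((\<lambda>x. \<bar>f x\<bar>) ` {0..1})"
  shows "sup_norm f \<le> r \<longleftrightarrow> (\<forall>x\<in>{0..1}. \<bar>f x\<bar> \<le> r)"
  unfolding sup_norm_def using assms by (subst cSUP_le_iff) auto

section \<open>Supremum-norm balls in the parameter space and their volumes\<close>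

locale haar_model =
  fixes B :: "nat \<times> nat \<Rightarrow> nat \<Rightarrow> real \<Rightarrow> real"
  assumes B: "haar_reindexing B"
begin

abbreviation idx :: "nat \<times> nat \<Rightarrow> nat set" where
  "idx j \<equiv> {1..m_dim j - 1}"

text \<open>Stated with a pointwise bound, so that no boundedness is hidden in a supremum. The
  centre enters only through its linear combination, so it may be the non-extensional zero
  function.\<close>

definition param_ball :: "nat \<times> nat \<Rightarrow> (nat \<Rightarrow> real) \<Rightarrow> real \<Rightarrow> (nat \<Rightarrow> real) set" where
  "param_ball j \<theta>\<^sub>0 r =
     {\<theta> \<in> space (param_space j). \<forall>x\<in>{0..1}. \<bar>lin_comb B j \<theta> x - lin_comb B j \<theta>\<^sub>0 x\<bar> \<le> r}"

lemma basis_haar: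
  assumes "j \<in> J" "i \<in> idx j"
  obtains j1 k1 where "B j i = haar j1 k1"
proof -
  obtain l L where j: "j = (l, L)" by force
  have "bij_betw (B (l, L)) {1..m_dim (l, L) - 1} {haar j1 k1 |j1 k1. j1 \<le> l \<and> k1 \<le> 2 ^ j1 - 1}"
    using B assms(1) unfolding haar_reindexing_def j by auto
  then have "B j i \<in> {haar j1 k1 |j1 k1. j1 \<le> l \<and> k1 \<le> 2 ^ j1 - 1}"
    using assms(2) unfolding j bij_betw_def by blast
  then show ?thesis using that by blast
qed

lemma basis_measurable: "j \<in> J \<Longrightarrow> i \<in> idx j \<Longrightarrow> B j i \<in> borel_measurable mu"
  by (metis basis_haar borel_measurable_mu_haar)

lemma finite_range_basis: "j \<in> J \<Longrightarrow> i \<in> idx j \<Longrightarrow> finite (range (B j i))"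
  by (metis basis_haar finite_range_haar)

lemma finite_range_basis_vector:
  assumes "j \<in> J" shows "finite (range (\<lambda>x. \<lambda>i\<in>idx j. B j i x))"
proof (rule finite_subset)
  show "range (\<lambda>x. \<lambda>i\<in>idx j. B j i x) \<subseteq> Pi\<^sub>E (idx j) (\<lambda>i. range (B j i))" by auto
  show "finite (Pi\<^sub>E (idx j) (\<lambda>i. range (B j i)))"
    using finite_range_basis[OF assms] by (intro finite_PiE) auto
qed

lemma lin_comb_basis_vector:
  "lin_comb B j \<theta> x = (\<lambda>v. \<Sum>i\<in>idx j. \<theta> i * v i) (\<lambda>i\<in>idx j. B j i x)"
  by (auto simp: lin_comb_def intro!: sum.cong)

lemma finite_range_lin_comb:
  assumes "j \<in> J" shows "finite (range (lin_comb B j \<theta>))"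
proof -
  have "range (lin_comb B j \<theta>) = (\<lambda>v. \<Sum>i\<in>idx j. \<theta> i * v i) ` range (\<lambda>x. \<lambda>i\<in>idx j. B j i x)"
    unfolding image_image lin_comb_basis_vector[symmetric] ..
  then show ?thesis using finite_range_basis_vector[OF assms] by simp
qed

lemma lin_comb_bounded:
  assumes "j \<in> J" obtains K where "\<And>x. \<bar>lin_comb B j \<theta> x\<bar> \<le> K"
proof -
  have "finite (abs ` range (lin_comb B j \<theta>))" using finite_range_lin_comb[OF assms] by simp
  then show ?thesis using that[of "Max (abs ` range (lin_comb B j \<theta>))"] by simp
qed

lemma lin_comb_zero [simp]: "lin_comb B j (\<lambda>_. 0) x = 0"
  by (simp add: lin_comb_def)

lemma Theta_eq_param_ball:
  assumes j: "j \<in> J" shows "Theta B j = param_ball j (\<lambda>_. 0) (real (snd j))"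
proof -
  have "bdd_above ((\<lambda>x. \<bar>lin_comb B j \<theta> x\<bar>) ` {0..1})" for \<theta>
    using lin_comb_bounded[OF j, of \<theta>] by (meson bdd_above.I2)
  then show ?thesis by (auto simp: Theta_def param_ball_def sup_norm_le_iff)
qed

text \<open>The intersection over all \<open>x\<close> is uncountable, but each condition depends on
  \<open>x\<close> only through the vector of basis values, which takes finitely many
  values.\<close>

lemma param_ball_measurable [measurable]:
  assumes j: "j \<in> J" shows "param_ball j \<theta>\<^sub>0 r \<in> sets (param_space j)"
proof -
  let ?V = "(\<lambda>x. \<lambda>i\<in>idx j. B j i x) ` {0..1}"
  have fin: "finite ?V" by (rule finite_subset[OF _ finite_range_basis_vector[OF j]]) auto
  have "param_ball j \<theta>\<^sub>0 r =
     {\<theta> \<in> space (param_space j). \<forall>v\<in>?V. \<bar>(\<Sum>i\<in>idx j. \<theta> i * v i) - (\<Sum>i\<in>idx j. \<theta>\<^sub>0 i * v i)\<bar> \<le> r}"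
    unfolding param_ball_def lin_comb_basis_vector by auto
  also have "\<dots> \<in> sets (param_space j)"
  proof (rule sets.sets_Collect_finite_All'[OF _ fin])
    fix v :: "nat \<Rightarrow> real"
    show "{\<theta> \<in> space (param_space j). \<bar>(\<Sum>i\<in>idx j. \<theta> i * v i) - (\<Sum>i\<in>idx j. \<theta>\<^sub>0 i * v i)\<bar> \<le> r} \<in> sets (param_space j)"
      unfolding param_space_def by measurable
  qed auto
  finally show ?thesis .
qed

lemma emeasure_param_ball_scale:
  assumes j: "j \<in> J" and r: "0 < r"
  shows "emeasure (param_space j) (param_ball j \<theta>\<^sub>0 r) =
    ennreal (r ^ (m_dim j - 1)) * emeasure (param_space j) (param_ball j (\<lambda>_. 0) 1)"
proof -
  have "lin_comb B j (\<lambda>i\<in>idx j. \<theta>\<^sub>0 i + r * \<theta> i) x - lin_comb B j \<theta>\<^sub>0 x = r * lin_comb B j \<theta> x" for \<theta> x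
    by (simp add: lin_comb_def algebra_simps sum.distrib sum_distrib_left)
  then have "{\<theta> \<in> space (param_space j). (\<lambda>i\<in>idx j. \<theta>\<^sub>0 i + r * \<theta> i) \<in> param_ball j \<theta>\<^sub>0 r} = param_ball j (\<lambda>_. 0) 1"
    using r by (auto simp: param_ball_def param_space_def space_PiM abs_mult)
  then show ?thesis
    using emeasure_PiM_lborel_affine[of "idx j" r "param_ball j \<theta>\<^sub>0 r" \<theta>\<^sub>0] param_ball_measurable[OF j, of \<theta>\<^sub>0 r] r
    unfolding param_space_def by simp
qed

lemma emeasure_box:
  "emeasure (param_space j) (Pi\<^sub>E (idx j) (\<lambda>_. {-r..r})) = (\<Prod>i\<in>idx j. ennreal (2 * r))" if "0 \<le> r"
proof -
  interpret product_sigma_finite "\<lambda>_::nat. lborel :: real measure" by standard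
  show ?thesis unfolding param_space_def using that by (subst emeasure_PiM) auto
qed

lemma unit_ball_pos:
  assumes j: "j \<in> J"
  shows "0 < emeasure (param_space j) (param_ball j (\<lambda>_. 0) 1)"
proof -
  have "\<exists>K. \<forall>i\<in>idx j. \<forall>x. \<bar>B j i x\<bar> \<le> K i"
  proof (intro exI ballI allI)
    fix i x assume "i \<in> idx j"
    then show "\<bar>B j i x\<bar> \<le> Max (abs ` range (B j i))" using finite_range_basis[OF j] by (intro Max_ge) auto
  qed
  then obtain K where K: "\<And>i x. i \<in> idx j \<Longrightarrow> \<bar>B j i x\<bar> \<le> K i" by blast
  have K0: "0 \<le> K i" if "i \<in> idx j" for i using K[OF that, of 0] by linarith
  \<comment> \<open>Coefficients in \<open>{-e..e}\<close> give a combination of modulus at most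
    \<open>e\<close> times the sum of the \<open>K i\<close>; the added 1 keeps the denominator
    positive.\<close>
  define e where "e = 1 / (1 + (\<Sum>i\<in>idx j. K i))"
  have S0: "0 \<le> (\<Sum>i\<in>idx j. K i)" using K0 by (intro sum_nonneg) auto
  then have e: "0 < e" "e * (\<Sum>i\<in>idx j. K i) \<le> 1" by (auto simp: e_def field_simps)
  have "Pi\<^sub>E (idx j) (\<lambda>_. {-e..e}) \<subseteq> param_ball j (\<lambda>_. 0) 1"
  proof
    fix \<theta> assume \<theta>: "\<theta> \<in> Pi\<^sub>E (idx j) (\<lambda>_. {-e..e})"
    have "\<bar>lin_comb B j \<theta> x\<bar> \<le> 1" for x
    proof -
      have "\<bar>lin_comb B j \<theta> x\<bar> \<le> (\<Sum>i\<in>idx j. \<bar>\<theta> i * B j i x\<bar>)" unfolding lin_comb_def by (rule sum_abs)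
      also have "\<dots> \<le> (\<Sum>i\<in>idx j. e * K i)"
        unfolding abs_mult using \<theta> K e(1) by (intro sum_mono mult_mono) (auto simp: PiE_def Pi_def abs_le_iff minus_le_iff)
      finally show ?thesis using e(2) by (simp add: sum_distrib_left)
    qed
    then show "\<theta> \<in> param_ball j (\<lambda>_. 0) 1" using \<theta> by (auto simp: param_ball_def param_space_def space_PiM PiE_def)
  qed
  then have "emeasure (param_space j) (Pi\<^sub>E (idx j) (\<lambda>_. {-e..e})) \<le> emeasure (param_space j) (param_ball j (\<lambda>_. 0) 1)"
    by (rule emeasure_mono) (rule param_ball_measurable[OF j])
  moreover have "0 < (\<Prod>i\<in>idx j. ennreal (2 * e))" using e(1) by (simp add: ennreal_power)
  ultimately show ?thesis using emeasure_box[of e j] e(1) by simp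
qed

text \<open>The supremum norm of a Haar sum dominates each of its coefficients, so the ball lies in
  a cube of side 2. This is linear independence in quantitative form.\<close>

lemma unit_ball_finite:
  assumes j: "j \<in> J"
  shows "emeasure (param_space j) (param_ball j (\<lambda>_. 0) 1) < \<infinity>"
proof -
  obtain l L where jl: "j = (l, L)" by force
  obtain \<beta> where \<beta>: "bij_betw \<beta> (SIGMA j:{..<Suc l}. {..<2^j}) (idx j)"
    "\<And>i k. i \<le> l \<Longrightarrow> k < 2 ^ i \<Longrightarrow> B j (\<beta> (i, k)) = haar i k"
    using haar_reindexing_levels[OF B] j unfolding jl by metis
  have "param_ball j (\<lambda>_. 0) 1 \<subseteq> Pi\<^sub>E (idx j) (\<lambda>_. {-1..1})"
  proof (intro subsetI PiE_I)
    fix \<theta> i assume \<theta>: "\<theta> \<in> param_ball j (\<lambda>_. 0) 1" and "i \<in> idx j"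
    then have "i \<in> \<beta> ` (SIGMA j:{..<Suc l}. {..<2^j})" using \<beta>(1) by (simp add: bij_betw_def)
    then obtain q k where i: "i = \<beta> (q, k)" and qk: "q < Suc l" "k < 2 ^ q" by auto
    have "\<bar>haar_sum (\<lambda>j k. \<theta> (\<beta> (j, k))) (Suc l) x\<bar> \<le> 1" if "x \<in> {0..1}" for x
      using \<theta> that lin_comb_haar_sum[of \<beta> l L B \<theta> x, OF \<beta>[unfolded jl], symmetric] by (simp add: param_ball_def jl)
    then have "\<bar>haar_sum (\<lambda>j k. \<theta> (\<beta> (j, k))) (Suc l) (cell_point (Suc l) p t)\<bar> \<le> 1"
      if "p < 2 ^ Suc l" "0 < t" "t < 1" for p t
      using cell_point_mem[OF that(1), of t] that by simp
    from haar_sum_coefficient_bound[OF this qk] have "\<bar>\<theta> (\<beta> (q, k))\<bar> \<le> 1" .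
    then show "\<theta> i \<in> {-1..1}" using i by (auto simp: abs_le_iff)
  qed (auto simp: param_ball_def param_space_def space_PiM)
  then have "emeasure (param_space j) (param_ball j (\<lambda>_. 0) 1) \<le> emeasure (param_space j) (Pi\<^sub>E (idx j) (\<lambda>_. {-1..1}))"
    by (rule emeasure_mono) (auto simp: param_space_def intro!: sets_PiM_I_finite)
  also have "\<dots> < \<infinity>"
    unfolding emeasure_box[of 1 j, OF zero_le_one] by (subst prod_ennreal) auto
  finally show ?thesis .
qed

lemma sets_Theta [measurable]: "j \<in> J \<Longrightarrow> Theta B j \<in> sets (param_space j)"
  by (simp add: Theta_eq_param_ball)

lemma emeasure_Theta:
  assumes j: "j \<in> J"
  shows "emeasure (param_space j) (Theta B j) =
     ennreal (real (snd j) ^ (m_dim j - 1)) * emeasure (param_space j) (param_ball j (\<lambda>_. 0) 1)"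
proof -
  have "0 < real (snd j)" using j by (auto simp: J_def)
  then show ?thesis unfolding Theta_eq_param_ball[OF j] by (rule emeasure_param_ball_scale[OF j])
qed

lemma prob_space_model_prior:
  assumes j: "j \<in> J" shows "prob_space (model_prior B j)"
proof -
  have "0 < real (snd j)" using j by (auto simp: J_def)
  then have "emeasure (param_space j) (Theta B j) \<noteq> 0" "emeasure (param_space j) (Theta B j) \<noteq> \<infinity>"
    using unit_ball_pos[OF j] unit_ball_finite[OF j] unfolding emeasure_Theta[OF j]
    by (auto simp: ennreal_mult_eq_top_iff)
  then show ?thesis unfolding model_prior_def by (rule prob_space_uniform_measure)
qed

lemma emeasure_model_prior_ball:
  assumes j: "j \<in> J" and r: "0 < r" and sub: "param_ball j \<theta>\<^sub>0 r \<subseteq> Theta B j"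
  shows "emeasure (model_prior B j) (param_ball j \<theta>\<^sub>0 r) = ennreal ((r / real (snd j)) ^ (m_dim j - 1))"
proof -
  have L: "0 < real (snd j)" using j by (auto simp: J_def)
  obtain u where u: "emeasure (param_space j) (param_ball j (\<lambda>_. 0) 1) = ennreal u" "0 < u"
    using unit_ball_pos[OF j] unit_ball_finite[OF j]
    by (cases "emeasure (param_space j) (param_ball j (\<lambda>_. 0) 1)") auto
  have "emeasure (model_prior B j) (param_ball j \<theta>\<^sub>0 r) =
     emeasure (param_space j) (param_ball j \<theta>\<^sub>0 r) / emeasure (param_space j) (Theta B j)"
    unfolding model_prior_def using j sub by (subst emeasure_uniform_measure) (auto simp: Int_absorb1)
  also have "\<dots> = ennreal ((r / real (snd j)) ^ (m_dim j - 1))"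
    unfolding emeasure_Theta[OF j] emeasure_param_ball_scale[OF j r] u(1)
    using L r u(2) by (simp add: ennreal_mult[symmetric] divide_ennreal power_divide)
  finally show ?thesis .
qed


section \<open>Model densities and their dependence on the parameter\<close>

lemma lin_comb_measurable_pair:
  assumes j: "j \<in> J"
  shows "(\<lambda>(\<theta>, x). lin_comb B j \<theta> x) \<in> borel_measurable (param_space j \<Otimes>\<^sub>M mu)"
proof -
  have "(\<lambda>z. \<Sum>i\<in>idx j. fst z i * B j i (snd z)) \<in> borel_measurable (param_space j \<Otimes>\<^sub>M mu)"
  proof (intro borel_measurable_sum borel_measurable_times)
    fix i assume i: "i \<in> idx j"
    show "(\<lambda>z. fst z i) \<in> borel_measurable (param_space j \<Otimes>\<^sub>M mu)"
      unfolding param_space_def using i by measurable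
    show "(\<lambda>z. B j i (snd z)) \<in> borel_measurable (param_space j \<Otimes>\<^sub>M mu)"
      using basis_measurable[OF j i] by measurable
  qed
  then show ?thesis by (simp add: lin_comb_def case_prod_beta')
qed

lemma lin_comb_measurable:
  assumes j: "j \<in> J" shows "lin_comb B j \<theta> \<in> borel_measurable mu"
  unfolding lin_comb_def using basis_measurable[OF j] by (intro borel_measurable_sum borel_measurable_times) auto

lemma log_normalizer_measurable:
  assumes j: "j \<in> J" shows "log_normalizer B j \<in> borel_measurable (param_space j)"
proof -
  note [measurable] = lin_comb_measurable_pair[OF j]
  have "(\<lambda>\<theta>. \<integral>x. exp (lin_comb B j \<theta> x) \<partial>mu) \<in> borel_measurable (param_space j)"
    by (intro mu.borel_measurable_lebesgue_integral) measurable
  then show ?thesis unfolding log_normalizer_def by measurable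
qed

lemma model_density_measurable_pair:
  assumes j: "j \<in> J"
  shows "(\<lambda>(\<theta>, x). model_density B j \<theta> x) \<in> borel_measurable (param_space j \<Otimes>\<^sub>M mu)"
proof -
  note [measurable] = lin_comb_measurable_pair[OF j] log_normalizer_measurable[OF j]
  show ?thesis unfolding model_density_def by measurable
qed

lemma model_density_measurable:
  assumes j: "j \<in> J" shows "model_density B j \<theta> \<in> borel_measurable mu"
  unfolding model_density_def using lin_comb_measurable[OF j] by measurable

lemma model_density_pos: "0 < model_density B j \<theta> x"
  by (simp add: model_density_def)

lemma integrable_exp_lin_comb:
  assumes j: "j \<in> J" shows "integrable mu (\<lambda>x. exp (lin_comb B j \<theta> x))"
proof -
  obtain K where "\<And>x. \<bar>lin_comb B j \<theta> x\<bar> \<le> K" using lin_comb_bounded[OF j] by blast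
  then show ?thesis using lin_comb_measurable[OF j]
    by (intro mu.integrable_const_bound[of _ "exp K"]) (auto simp: abs_le_iff)
qed

lemma normalizer_pos:
  assumes j: "j \<in> J" shows "0 < (\<integral>x. exp (lin_comb B j \<theta> x) \<partial>mu)"
proof -
  obtain K where K: "\<And>x. \<bar>lin_comb B j \<theta> x\<bar> \<le> K" using lin_comb_bounded[OF j] by blast
  have "exp (- K) = (\<integral>x. exp (- K) \<partial>mu)" by (simp add: mu.prob_space[simplified])
  also have "\<dots> \<le> (\<integral>x. exp (lin_comb B j \<theta> x) \<partial>mu)"
    using K by (intro integral_mono integrable_exp_lin_comb j) (auto simp: abs_le_iff minus_le_iff)
  finally show ?thesis by (meson exp_gt_zero less_le_trans)
qed

lemma model_density_eq:
  assumes j: "j \<in> J"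
  shows "model_density B j \<theta> x = exp (lin_comb B j \<theta> x) / (\<integral>x. exp (lin_comb B j \<theta> x) \<partial>mu)"
  unfolding model_density_def log_normalizer_def exp_add exp_minus
  using normalizer_pos[OF j] by (simp add: field_simps)

lemma model_density_integrable:
  assumes j: "j \<in> J" shows "integrable mu (model_density B j \<theta>)"
  unfolding model_density_eq[OF j, abs_def] using integrable_exp_lin_comb[OF j] by simp

lemma model_density_integral:
  assumes j: "j \<in> J" shows "(\<integral>x. model_density B j \<theta> x \<partial>mu) = 1"
  unfolding model_density_eq[OF j, abs_def] using normalizer_pos[OF j, of \<theta>] by simp

text \<open>One \<open>\<delta>\<close> comes from the exponent and one from the normalizer, hence
  the factor \<open>exp (2 * \<delta>)\<close>.\<close>

lemma model_density_ratio:
  assumes j: "j \<in> J" and d: "\<And>x. x \<in> {0..1} \<Longrightarrow> \<bar>lin_comb B j \<theta> x - lin_comb B j \<theta>' x\<bar> \<le> \<delta>"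
    and x: "x \<in> {0..1}"
  shows "model_density B j \<theta> x \<le> exp (2 * \<delta>) * model_density B j \<theta>' x"
proof -
  let ?Z = "\<lambda>\<theta>. \<integral>x. exp (lin_comb B j \<theta> x) \<partial>mu"
  have e: "exp (lin_comb B j \<theta> x) \<le> exp \<delta> * exp (lin_comb B j \<theta>' x)"
    using d[OF x] by (simp flip: exp_add)
  have "?Z \<theta>' \<le> (\<integral>x. exp \<delta> * exp (lin_comb B j \<theta> x) \<partial>mu)"
  proof (intro integral_mono integrable_exp_lin_comb j integrable_mult_right)
    fix x assume "x \<in> space mu"
    then have "\<bar>lin_comb B j \<theta> x - lin_comb B j \<theta>' x\<bar> \<le> \<delta>" using d by simp
    then show "exp (lin_comb B j \<theta>' x) \<le> exp \<delta> * exp (lin_comb B j \<theta> x)"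
      by (simp flip: exp_add)
  qed
  then have Z: "?Z \<theta>' \<le> exp \<delta> * ?Z \<theta>" by simp
  have "exp (lin_comb B j \<theta> x) * ?Z \<theta>' \<le> (exp \<delta> * exp (lin_comb B j \<theta>' x)) * (exp \<delta> * ?Z \<theta>)"
    using e Z normalizer_pos[OF j, of \<theta>'] by (intro mult_mono) (auto intro: less_imp_le)
  then have "exp (lin_comb B j \<theta> x) * ?Z \<theta>' \<le> exp (2 * \<delta>) * exp (lin_comb B j \<theta>' x) * ?Z \<theta>"
    unfolding mult_2 exp_add by (simp only: mult_ac)
  then show ?thesis
    unfolding model_density_eq[OF j] using normalizer_pos[OF j, of \<theta>] normalizer_pos[OF j, of \<theta>']
    by (simp add: field_simps)
qed

end

text \<open>A series over the naturals gives access to monotone convergence and to measurability of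
  countable sums. \<open>J\<close> is infinite, so \<open>from_nat_into\<close> enumerates it
  without repetition.\<close>

lemma infsum_J_suminf:
  fixes f :: "nat \<times> nat \<Rightarrow> ennreal"
  shows "(\<Sum>\<^sub>\<infinity>j\<in>J. f j) = (\<Sum>n. f (from_nat_into J n))"
proof -
  have "inj (\<lambda>l :: nat. (l, 1 :: nat))" by (rule injI) simp
  moreover have "range (\<lambda>l :: nat. (l, 1 :: nat)) \<subseteq> J" by (auto simp: J_def)
  ultimately have "infinite J" by (meson finite_subset range_inj_infinite)
  then have bij: "bij_betw (from_nat_into J) UNIV J" by (intro bij_betw_from_nat_into) auto
  have "((\<lambda>n. f (from_nat_into J n)) has_sum (\<Sum>\<^sub>\<infinity>n. f (from_nat_into J n))) UNIV"
    by (intro has_sum_infsum nonneg_summable_on_complete) simp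
  from has_sum_imp_sums[OF this] have "(\<Sum>n. f (from_nat_into J n)) = (\<Sum>\<^sub>\<infinity>n. f (from_nat_into J n))"
    by (simp add: sums_iff)
  also have "\<dots> = (\<Sum>\<^sub>\<infinity>j\<in>J. f j)" using infsum_reindex_bij_betw[OF bij] .
  finally show ?thesis ..
qed

lemma from_nat_into_J: "from_nat_into J n \<in> J"
  by (rule from_nat_into) (auto simp: J_def)


section \<open>Likelihoods and Hellinger affinity\<close>

lemma exp_le_quadratic:
  fixes y K :: real
  assumes "\<bar>y\<bar> \<le> K" shows "exp y \<le> 1 + y + exp K * y\<^sup>2"
proof -
  obtain t where t: "\<bar>t\<bar> \<le> \<bar>y\<bar>" "exp y = (\<Sum>m<2. y ^ m / fact m) + exp t / fact 2 * y ^ 2"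
    using Maclaurin_exp_le[of y 2] by auto
  have "exp t / 2 * y\<^sup>2 \<le> exp K * y\<^sup>2"
  proof (intro mult_right_mono)
    have "exp t \<le> exp K" using t(1) assms by simp
    then show "exp t / 2 \<le> exp K" using exp_gt_zero[of K] by linarith
  qed simp
  with t(2) show ?thesis by (simp add: numeral_2_eq_2)
qed

text \<open>Meant for the share of one model in the posterior, which is at most 1: a bound by a
  squared average becomes a bound by the average itself, whose mean is under control.\<close>

lemma ennreal_le_of_le_square:
  fixes q y :: ennreal
  assumes "q \<le> 1" "q \<le> y\<^sup>2" shows "q \<le> y"
proof (cases "y \<le> 1")
  case True
  then have "y\<^sup>2 \<le> y * 1" unfolding power2_eq_square by (intro mult_left_mono) auto
  with assms(2) show ?thesis by simp
qed (use assms in auto)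

lemma ennreal_inverse_antimono: "a \<le> b \<Longrightarrow> inverse b \<le> inverse (a :: ennreal)"
proof (cases "a = 0 \<or> b = top")
  case False
  assume ab: "a \<le> b"
  with False obtain x y where "a = ennreal x" "b = ennreal y" "0 < x" "0 \<le> y"
    by (cases a; cases b) (auto simp: top_unique)
  with ab show ?thesis by (auto simp: inverse_ennreal intro!: ennreal_leI le_imp_inverse_le)
qed auto

locale haar_posterior = haar_model +
  fixes f_o :: "real \<Rightarrow> real"
  assumes f_o_pos: "\<And>x. x \<in> {0..1} \<Longrightarrow> 0 < f_o x"
    and f_o_density: "(\<integral>x. f_o x \<partial>mu) = 1"
    and log_f_o_cont: "continuous_on {0..1} (\<lambda>x. ln (f_o x))"
begin

lemma f_o_cont: "continuous_on {0..1} f_o"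
proof -
  have "continuous_on {0..1} (\<lambda>x. exp (ln (f_o x)))" by (intro continuous_intros log_f_o_cont)
  then show ?thesis by (rule continuous_on_eq) (simp add: f_o_pos)
qed

lemma f_o_measurable [measurable]: "f_o \<in> borel_measurable mu"
  by (rule borel_measurable_mu_continuous[OF f_o_cont])

lemma integrable_f_o: "integrable mu f_o"
  using f_o_density not_integrable_integral_eq by fastforce

lemma nn_integral_f_o: "(\<integral>\<^sup>+x. ennreal (f_o x) \<partial>mu) = 1"
  using f_o_density f_o_pos by (subst nn_integral_eq_integral[OF integrable_f_o]) (auto simp: less_imp_le)

definition law :: "real measure" where "law = density mu (\<lambda>x. ennreal (f_o x))"

lemma space_law [simp]: "space law = {0..1}" and sets_law [measurable_cong]: "sets law = sets mu"
  by (simp_all add: law_def)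

sublocale law: prob_space law
proof
  have "emeasure law (space law) = (\<integral>\<^sup>+x. ennreal (f_o x) * indicator (space mu) x \<partial>mu)"
    unfolding law_def using sets.top[of mu] by (subst emeasure_density) auto
  also have "\<dots> = (\<integral>\<^sup>+x. ennreal (f_o x) \<partial>mu)" by (intro nn_integral_cong) simp
  finally show "emeasure law (space law) = 1" by (simp only: nn_integral_f_o)
qed

abbreviation sample_law :: "nat \<Rightarrow> (nat \<Rightarrow> real) measure" where
  "sample_law n \<equiv> joint_law f_o n"

lemma sample_law_eq: "sample_law n = Pi\<^sub>M {1..n} (\<lambda>_. law)"
  by (simp add: joint_law_def law_def)

lemma sets_sample_law [measurable_cong]: "sets (sample_law n) = sets (Pi\<^sub>M {1..n} (\<lambda>_. mu))"
  unfolding sample_law_eq by (intro sets_PiM_cong sets_law refl)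

lemma space_sample_law: "space (sample_law n) = Pi\<^sub>E {1..n} (\<lambda>_. {0..1})"
  unfolding sample_law_eq by (simp add: space_PiM)

lemma sample_mem: "x \<in> space (sample_law n) \<Longrightarrow> i \<in> {1..n} \<Longrightarrow> x i \<in> {0..1}"
  by (auto simp: space_sample_law PiE_iff)

lemma prob_space_sample_law: "prob_space (sample_law n)"
  unfolding sample_law_eq by (intro prob_space_PiM law.prob_space_axioms)

lemma nn_integral_sample_prod:
  assumes g: "g \<in> borel_measurable mu"
  shows "(\<integral>\<^sup>+x. (\<Prod>i\<in>{1..n}. g (x i)) \<partial>sample_law n) = (\<integral>\<^sup>+y. ennreal (f_o y) * g y \<partial>mu) ^ n"
proof -
  interpret product_sigma_finite "\<lambda>_ :: nat. law" by standard
  have "g \<in> borel_measurable law" using g by measurable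
  then have "(\<integral>\<^sup>+x. (\<Prod>i\<in>{1..n}. g (x i)) \<partial>sample_law n) = (\<Prod>i\<in>{1..n}. integral\<^sup>N law g)"
    unfolding sample_law_eq by (intro product_nn_integral_prod) auto
  also have "integral\<^sup>N law g = (\<integral>\<^sup>+y. ennreal (f_o y) * g y \<partial>mu)"
    unfolding law_def using g by (intro nn_integral_density) auto
  finally show ?thesis by simp
qed

definition likelihood :: "nat \<times> nat \<Rightarrow> nat \<Rightarrow> (nat \<Rightarrow> real) \<Rightarrow> (nat \<Rightarrow> real) \<Rightarrow> real" where
  "likelihood j n \<theta> x = (\<Prod>i\<in>{1..n}. model_density B j \<theta> (x i))"

definition true_likelihood :: "nat \<Rightarrow> (nat \<Rightarrow> real) \<Rightarrow> real" where
  "true_likelihood n x = (\<Prod>i\<in>{1..n}. f_o (x i))"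

definition root_ratio :: "nat \<times> nat \<Rightarrow> nat \<Rightarrow> (nat \<Rightarrow> real) \<Rightarrow> (nat \<Rightarrow> real) \<Rightarrow> real" where
  "root_ratio j n \<theta> x = (\<Prod>i\<in>{1..n}. sqrt (model_density B j \<theta> (x i) / f_o (x i)))"

definition affinity :: "nat \<times> nat \<Rightarrow> (nat \<Rightarrow> real) \<Rightarrow> real" where
  "affinity j \<theta> = (\<integral>y. sqrt (model_density B j \<theta> y * f_o y) \<partial>mu)"

definition component :: "nat \<times> nat \<Rightarrow> nat \<Rightarrow> (nat \<Rightarrow> real) \<Rightarrow> (real \<Rightarrow> real) set \<Rightarrow> ennreal" where
  "component j n x S = (\<integral>\<^sup>+\<theta>\<in>{\<theta> \<in> Theta B j. model_density B j \<theta> \<in> S}.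
     ennreal (likelihood j n \<theta> x) \<partial>model_prior B j)"

lemma evidence_eq:
  "evidence B w n x S = (\<Sum>k. ennreal (w (from_nat_into J k)) * component (from_nat_into J k) n x S)"
  by (simp add: evidence_def infsum_J_suminf component_def likelihood_def)

lemma likelihood_pos: "0 < likelihood j n \<theta> x"
  unfolding likelihood_def by (intro prod_pos) (simp add: model_density_pos)

lemma true_likelihood_pos: "x \<in> space (sample_law n) \<Longrightarrow> 0 < true_likelihood n x"
  unfolding true_likelihood_def using f_o_pos sample_mem by (intro prod_pos) blast

lemma true_likelihood_measurable [measurable]: "true_likelihood n \<in> borel_measurable (sample_law n)"
  unfolding true_likelihood_def by measurable

lemma density_factor_measurable:
  assumes j: "j \<in> J" and i: "i \<in> {1..n}"
  shows "(\<lambda>z. model_density B j (snd z) (fst z i)) \<in> borel_measurable (sample_law n \<Otimes>\<^sub>M param_space j)"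
    "(\<lambda>z. f_o (fst z i)) \<in> borel_measurable (sample_law n \<Otimes>\<^sub>M param_space j)"
proof -
  have "(\<lambda>z. (snd z, fst z i)) \<in> measurable (sample_law n \<Otimes>\<^sub>M param_space j) (param_space j \<Otimes>\<^sub>M mu)"
    using i by measurable
  from measurable_compose[OF this model_density_measurable_pair[OF j]]
  show "(\<lambda>z. model_density B j (snd z) (fst z i)) \<in> borel_measurable (sample_law n \<Otimes>\<^sub>M param_space j)"
    by simp
  show "(\<lambda>z. f_o (fst z i)) \<in> borel_measurable (sample_law n \<Otimes>\<^sub>M param_space j)"
    using i by measurable
qed

lemma likelihood_measurable_pair:
  assumes j: "j \<in> J"
  shows "(\<lambda>z. likelihood j n (snd z) (fst z)) \<in> borel_measurable (sample_law n \<Otimes>\<^sub>M param_space j)"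
  unfolding likelihood_def by (intro borel_measurable_prod density_factor_measurable j)

lemma root_ratio_measurable_pair:
  assumes j: "j \<in> J"
  shows "(\<lambda>z. root_ratio j n (snd z) (fst z)) \<in> borel_measurable (sample_law n \<Otimes>\<^sub>M param_space j)"
  unfolding root_ratio_def
proof (intro borel_measurable_prod)
  fix i assume "i \<in> {1..n}"
  note [measurable] = density_factor_measurable[OF j this]
  show "(\<lambda>z. sqrt (model_density B j (snd z) (fst z i) / f_o (fst z i))) \<in> borel_measurable (sample_law n \<Otimes>\<^sub>M param_space j)"
    by measurable
qed

lemma affinity_measurable:
  assumes j: "j \<in> J" shows "affinity j \<in> borel_measurable (param_space j)"
proof -
  note [measurable] = model_density_measurable_pair[OF j]
  have "(\<lambda>\<theta>. \<integral>y. sqrt (model_density B j \<theta> y * f_o y) \<partial>mu) \<in> borel_measurable (param_space j)"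
    by (intro mu.borel_measurable_lebesgue_integral) measurable
  then show ?thesis by (simp add: affinity_def[abs_def])
qed

lemma hellinger_measurable:
  assumes j: "j \<in> J"
  shows "{\<theta> \<in> space (param_space j). model_density B j \<theta> \<in> - hellinger_ball f_o s} \<in> sets (param_space j)"
proof -
  note [measurable] = model_density_measurable_pair[OF j]
  have [measurable]: "(\<lambda>\<theta>. \<integral>x. (sqrt (model_density B j \<theta> x) - sqrt (f_o x))\<^sup>2 \<partial>mu) \<in> borel_measurable (param_space j)"
    by (intro mu.borel_measurable_lebesgue_integral) measurable
  show ?thesis unfolding hellinger_ball_def hellinger_def by simp
qed

lemma Theta_restrict_measurable:
  assumes j: "j \<in> J" and S: "{\<theta> \<in> space (param_space j). model_density B j \<theta> \<in> S} \<in> sets (param_space j)"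
  shows "{\<theta> \<in> Theta B j. model_density B j \<theta> \<in> S} \<in> sets (param_space j)"
proof -
  have "{\<theta> \<in> Theta B j. model_density B j \<theta> \<in> S} = Theta B j \<inter> {\<theta> \<in> space (param_space j). model_density B j \<theta> \<in> S}"
    by (auto simp: Theta_def)
  then show ?thesis using S sets_Theta[OF j] by simp
qed

lemma sets_model_prior [measurable_cong]: "sets (model_prior B j) = sets (param_space j)"
  by (simp add: model_prior_def)

lemma component_measurable:
  assumes j: "j \<in> J" and S: "{\<theta> \<in> space (param_space j). model_density B j \<theta> \<in> S} \<in> sets (param_space j)"
  shows "(\<lambda>x. component j n x S) \<in> borel_measurable (sample_law n)"
proof -
  interpret prior: prob_space "model_prior B j" by (rule prob_space_model_prior[OF j])
  note [measurable] = likelihood_measurable_pair[OF j, of n] Theta_restrict_measurable[OF j S]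
  show ?thesis unfolding component_def by measurable
qed

lemma evidence_measurable:
  assumes "\<And>j. j \<in> J \<Longrightarrow> {\<theta> \<in> space (param_space j). model_density B j \<theta> \<in> S} \<in> sets (param_space j)"
  shows "(\<lambda>x. evidence B w n x S) \<in> borel_measurable (sample_law n)"
  unfolding evidence_eq
  by (intro borel_measurable_suminf_order borel_measurable_times_ennreal component_measurable from_nat_into_J assms) simp

lemma posterior_measurable:
  "(\<lambda>x. posterior B w n x (- hellinger_ball f_o s)) \<in> borel_measurable (sample_law n)"
proof -
  note [measurable] = evidence_measurable[where S = "- hellinger_ball f_o s" and w = w and n = n, OF hellinger_measurable]
    evidence_measurable[where S = UNIV and w = w and n = n, simplified]
  show ?thesis unfolding posterior_def by measurable
qed

text \<open>By Fubini, since each likelihood ratio has mean 1 under the true law and the prior is a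
  probability measure. Relative to the true likelihood, a model thus contributes in mean at most its
  prior weight, however large its dimension.\<close>

lemma nn_integral_component_ratio:
  assumes j: "j \<in> J" and S: "{\<theta> \<in> space (param_space j). model_density B j \<theta> \<in> S} \<in> sets (param_space j)"
  shows "(\<integral>\<^sup>+x. component j n x S / ennreal (true_likelihood n x) \<partial>sample_law n) \<le> 1"
proof -
  interpret prior: prob_space "model_prior B j" by (rule prob_space_model_prior[OF j])
  interpret sample: prob_space "sample_law n" by (rule prob_space_sample_law)
  interpret ps: pair_sigma_finite "sample_law n" "model_prior B j" ..
  let ?E = "{\<theta> \<in> Theta B j. model_density B j \<theta> \<in> S}"
  note [measurable] = likelihood_measurable_pair[OF j, of n] Theta_restrict_measurable[OF j S]
  have lm: "(\<lambda>z. ennreal (likelihood j n (snd z) (fst z)) * indicator ?E (snd z) / ennreal (true_likelihood n (fst z)))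
     \<in> borel_measurable (sample_law n \<Otimes>\<^sub>M model_prior B j)" by measurable
  have lm2: "(\<lambda>\<theta>. ennreal (likelihood j n \<theta> x) * indicator ?E \<theta>) \<in> borel_measurable (model_prior B j)"
    if "x \<in> space (sample_law n)" for x
  proof (intro borel_measurable_times_ennreal borel_measurable_indicator)
    show "(\<lambda>\<theta>. ennreal (likelihood j n \<theta> x)) \<in> borel_measurable (model_prior B j)"
      using measurable_compose[OF measurable_Pair1'[OF that] likelihood_measurable_pair[OF j]]
      by (simp add: measurable_cong_sets[OF sets_model_prior refl])
    show "?E \<in> sets (model_prior B j)"
      using Theta_restrict_measurable[OF j S] by (simp add: sets_model_prior)
  qed
  have "(\<integral>\<^sup>+x. component j n x S / ennreal (true_likelihood n x) \<partial>sample_law n) =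
     (\<integral>\<^sup>+x. \<integral>\<^sup>+\<theta>. ennreal (likelihood j n \<theta> x) * indicator ?E \<theta> / ennreal (true_likelihood n x) \<partial>model_prior B j \<partial>sample_law n)"
    unfolding component_def by (intro nn_integral_cong nn_integral_divide[symmetric] lm2)
  also have "\<dots> = (\<integral>\<^sup>+\<theta>. \<integral>\<^sup>+x. ennreal (likelihood j n \<theta> x) * indicator ?E \<theta> / ennreal (true_likelihood n x) \<partial>sample_law n \<partial>model_prior B j)"
    using lm by (intro ps.Fubini'[symmetric]) (simp add: case_prod_beta')
  also have "\<dots> \<le> (\<integral>\<^sup>+\<theta>. 1 \<partial>model_prior B j)"
  proof (intro nn_integral_mono)
    fix \<theta>
    have md: "model_density B j \<theta> \<in> borel_measurable mu" by (rule model_density_measurable[OF j])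
    have "(\<integral>\<^sup>+x. ennreal (likelihood j n \<theta> x) * indicator ?E \<theta> / ennreal (true_likelihood n x) \<partial>sample_law n)
      \<le> (\<integral>\<^sup>+x. (\<Prod>i\<in>{1..n}. ennreal (model_density B j \<theta> (x i) / f_o (x i))) \<partial>sample_law n)"
    proof (intro nn_integral_mono)
      fix x assume x: "x \<in> space (sample_law n)"
      have "(\<Prod>i\<in>{1..n}. ennreal (model_density B j \<theta> (x i) / f_o (x i))) = ennreal (\<Prod>i\<in>{1..n}. model_density B j \<theta> (x i) / f_o (x i))"
        using f_o_pos[OF sample_mem[OF x]] model_density_pos by (intro prod_ennreal) (auto simp: less_imp_le)
      also have "\<dots> = ennreal (likelihood j n \<theta> x) / ennreal (true_likelihood n x)"
        using likelihood_pos[of j n \<theta> x] true_likelihood_pos[OF x]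
        by (simp add: divide_ennreal likelihood_def true_likelihood_def prod_dividef)
      finally show "ennreal (likelihood j n \<theta> x) * indicator ?E \<theta> / ennreal (true_likelihood n x) \<le> (\<Prod>i\<in>{1..n}. ennreal (model_density B j \<theta> (x i) / f_o (x i)))"
        by (simp add: indicator_def)
    qed
    also have "\<dots> = (\<integral>\<^sup>+y. ennreal (f_o y) * ennreal (model_density B j \<theta> y / f_o y) \<partial>mu) ^ n"
      using md f_o_measurable by (intro nn_integral_sample_prod) measurable
    also have "(\<integral>\<^sup>+y. ennreal (f_o y) * ennreal (model_density B j \<theta> y / f_o y) \<partial>mu) = (\<integral>\<^sup>+y. ennreal (model_density B j \<theta> y) \<partial>mu)"
    proof (intro nn_integral_cong)
      fix y assume "y \<in> space mu"
      then show "ennreal (f_o y) * ennreal (model_density B j \<theta> y / f_o y) = ennreal (model_density B j \<theta> y)"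
        using f_o_pos[of y] model_density_pos[of j \<theta> y] by (simp flip: ennreal_mult)
    qed
    also have "\<dots> = 1"
      using model_density_integral[OF j, of \<theta>] model_density_pos
      by (subst nn_integral_eq_integral[OF model_density_integrable[OF j]]) (auto simp: less_imp_le)
    finally show "(\<integral>\<^sup>+x. ennreal (likelihood j n \<theta> x) * indicator ?E \<theta> / ennreal (true_likelihood n x) \<partial>sample_law n) \<le> 1" by simp
  qed
  also have "\<dots> = 1" by (simp add: prior.emeasure_space_1)
  finally show ?thesis .
qed

text \<open>The log density moves by at most \<open>2 * \<delta>\<close> per observation, and by
  half of that under the square root. For \<open>\<delta> = 1 / n\<close> both factors are
  constants.\<close>

lemma likelihood_ratio_ball:
  assumes j: "j \<in> J" and b: "\<And>y. y \<in> {0..1} \<Longrightarrow> \<bar>lin_comb B j \<theta> y - lin_comb B j \<theta>' y\<bar> \<le> \<delta>"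
    and x: "x \<in> space (sample_law n)"
  shows "likelihood j n \<theta> x \<le> exp (2 * real n * \<delta>) * likelihood j n \<theta>' x"
    and "root_ratio j n \<theta> x \<le> exp (real n * \<delta>) * root_ratio j n \<theta>' x"
proof -
  have r: "model_density B j \<theta> (x i) \<le> exp (2 * \<delta>) * model_density B j \<theta>' (x i)" if "i \<in> {1..n}" for i
    using model_density_ratio[OF j b sample_mem[OF x that]] .
  have "likelihood j n \<theta> x \<le> (\<Prod>i\<in>{1..n}. exp (2 * \<delta>) * model_density B j \<theta>' (x i))"
    unfolding likelihood_def using r model_density_pos by (intro prod_mono) (auto simp: less_imp_le)
  also have "\<dots> = exp (2 * real n * \<delta>) * likelihood j n \<theta>' x"
    by (simp add: prod.distrib likelihood_def mult_ac flip: exp_of_nat_mult)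
  finally show "likelihood j n \<theta> x \<le> exp (2 * real n * \<delta>) * likelihood j n \<theta>' x" .
  have "sqrt (model_density B j \<theta> (x i) / f_o (x i)) \<le> exp \<delta> * sqrt (model_density B j \<theta>' (x i) / f_o (x i))"
    if i: "i \<in> {1..n}" for i
  proof -
    have "sqrt (model_density B j \<theta> (x i) / f_o (x i)) \<le> sqrt (exp \<delta> ^ 2 * (model_density B j \<theta>' (x i) / f_o (x i)))"
      using r[OF i] f_o_pos[OF sample_mem[OF x i]]
      by (intro real_sqrt_le_mono) (simp add: divide_right_mono flip: exp_of_nat_mult)
    then show ?thesis by (simp only: real_sqrt_mult real_sqrt_abs abs_exp_cancel)
  qed
  then have "root_ratio j n \<theta> x \<le> (\<Prod>i\<in>{1..n}. exp \<delta> * sqrt (model_density B j \<theta>' (x i) / f_o (x i)))"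
    unfolding root_ratio_def using model_density_pos f_o_pos sample_mem[OF x]
    by (intro prod_mono) (auto simp: less_imp_le)
  also have "\<dots> = exp (real n * \<delta>) * root_ratio j n \<theta>' x"
    by (simp add: prod.distrib root_ratio_def flip: exp_of_nat_mult)
  finally show "root_ratio j n \<theta> x \<le> exp (real n * \<delta>) * root_ratio j n \<theta>' x" .
qed

lemma component_UNIV_lower:
  assumes j: "j \<in> J" and d: "0 < \<delta>" and sub: "param_ball j \<theta>\<^sub>0 \<delta> \<subseteq> Theta B j" and x: "x \<in> space (sample_law n)"
  shows "ennreal ((\<delta> / real (snd j)) ^ (m_dim j - 1) * exp (- 2 * real n * \<delta>) * likelihood j n \<theta>\<^sub>0 x) \<le> component j n x UNIV"
proof -
  let ?b = "param_ball j \<theta>\<^sub>0 \<delta>" and ?c = "exp (- 2 * real n * \<delta>) * likelihood j n \<theta>\<^sub>0 x"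
  have c: "0 \<le> ?c" using likelihood_pos[of j n \<theta>\<^sub>0 x] by simp
  have "ennreal ((\<delta> / real (snd j)) ^ (m_dim j - 1) * ?c) = ennreal ?c * emeasure (model_prior B j) ?b"
    unfolding emeasure_model_prior_ball[OF j d sub] using c d by (simp add: ennreal_mult[symmetric] mult.commute)
  also have "\<dots> = (\<integral>\<^sup>+\<theta>. ennreal ?c * indicator ?b \<theta> \<partial>model_prior B j)"
    using j by (subst nn_integral_cmult_indicator) (auto simp: sets_model_prior)
  also have "\<dots> \<le> component j n x UNIV"
    unfolding component_def
  proof (intro nn_integral_mono)
    fix \<theta>
    show "ennreal ?c * indicator ?b \<theta> \<le> ennreal (likelihood j n \<theta> x) * indicator {\<theta> \<in> Theta B j. model_density B j \<theta> \<in> UNIV} \<theta>"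
    proof (cases "\<theta> \<in> ?b")
      case True
      have "likelihood j n \<theta>\<^sub>0 x \<le> exp (2 * real n * \<delta>) * likelihood j n \<theta> x"
        using True by (intro likelihood_ratio_ball(1)[OF j _ x]) (auto simp: param_ball_def abs_minus_commute)
      then have "?c \<le> likelihood j n \<theta> x" by (simp add: exp_minus field_simps)
      then show ?thesis using True sub by (auto simp: ennreal_leI)
    qed simp
  qed
  finally show ?thesis by (simp add: mult.assoc)
qed

section \<open>Hellinger affinity and root likelihoods\<close>

lemma integrable_affinity:
  assumes j: "j \<in> J" shows "integrable mu (\<lambda>y. sqrt (model_density B j \<theta> y * f_o y))"
proof (rule Bochner_Integration.integrable_bound)
  show "integrable mu (\<lambda>y. (model_density B j \<theta> y + f_o y) / 2)"
    using model_density_integrable[OF j] integrable_f_o by auto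
  show "(\<lambda>y. sqrt (model_density B j \<theta> y * f_o y)) \<in> borel_measurable mu"
    using model_density_measurable[OF j] by measurable
  show "AE y in mu. norm (sqrt (model_density B j \<theta> y * f_o y)) \<le> norm ((model_density B j \<theta> y + f_o y) / 2)"
  proof (rule AE_I2)
    fix y assume "y \<in> space mu"
    then have "0 < f_o y" "0 < model_density B j \<theta> y" using f_o_pos model_density_pos by auto
    then show "norm (sqrt (model_density B j \<theta> y * f_o y)) \<le> norm ((model_density B j \<theta> y + f_o y) / 2)"
      using arith_geo_mean_sqrt[of "model_density B j \<theta> y" "f_o y"] by simp
  qed
qed

lemma affinity_nonneg: "0 \<le> affinity j \<theta>"
  unfolding affinity_def using f_o_pos model_density_pos
  by (intro Bochner_Integration.integral_nonneg) (auto simp: less_imp_le)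

lemma affinity_hellinger:
  assumes j: "j \<in> J" shows "(hellinger (model_density B j \<theta>) f_o)\<^sup>2 = 2 - 2 * affinity j \<theta>"
proof -
  have "(\<integral>x. (sqrt (model_density B j \<theta> x) - sqrt (f_o x))\<^sup>2 \<partial>mu) =
     (\<integral>x. model_density B j \<theta> x + f_o x - 2 * sqrt (model_density B j \<theta> x * f_o x) \<partial>mu)"
  proof (intro Bochner_Integration.integral_cong refl)
    fix x assume "x \<in> space mu"
    then have "0 < f_o x" "0 < model_density B j \<theta> x" using f_o_pos model_density_pos by auto
    then show "(sqrt (model_density B j \<theta> x) - sqrt (f_o x))\<^sup>2 = model_density B j \<theta> x + f_o x - 2 * sqrt (model_density B j \<theta> x * f_o x)"
      by (simp add: power2_diff real_sqrt_mult)
  qed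
  also have "\<dots> = 2 - 2 * affinity j \<theta>"
    using model_density_integrable[OF j] integrable_f_o integrable_affinity[OF j] model_density_integral[OF j] f_o_density
    by (simp add: affinity_def)
  finally have eq: "(\<integral>x. (sqrt (model_density B j \<theta> x) - sqrt (f_o x))\<^sup>2 \<partial>mu) = 2 - 2 * affinity j \<theta>" .
  have "0 \<le> (\<integral>x. (sqrt (model_density B j \<theta> x) - sqrt (f_o x))\<^sup>2 \<partial>mu)"
    by (intro Bochner_Integration.integral_nonneg) simp
  then show ?thesis unfolding hellinger_def eq by simp
qed

lemma affinity_small:
  assumes j: "j \<in> J" and s: "0 \<le> s" and "s < hellinger (model_density B j \<theta>) f_o"
  shows "affinity j \<theta> \<le> exp (- (s\<^sup>2 / 2))"
proof -
  have "s\<^sup>2 \<le> (hellinger (model_density B j \<theta>) f_o)\<^sup>2" using assms by (intro power_mono) auto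
  then have "affinity j \<theta> \<le> 1 + (- (s\<^sup>2 / 2))" unfolding affinity_hellinger[OF j] by simp
  also have "\<dots> \<le> exp (- (s\<^sup>2 / 2))" by (rule exp_ge_add_one_self)
  finally show ?thesis .
qed

lemma affinity_ratio:
  assumes j: "j \<in> J" and b: "\<And>y. y \<in> {0..1} \<Longrightarrow> \<bar>lin_comb B j \<theta> y - lin_comb B j \<theta>' y\<bar> \<le> \<delta>"
  shows "affinity j \<theta> \<le> exp \<delta> * affinity j \<theta>'"
proof -
  have "affinity j \<theta> \<le> (\<integral>y. exp \<delta> * sqrt (model_density B j \<theta>' y * f_o y) \<partial>mu)"
    unfolding affinity_def
  proof (intro integral_mono integrable_affinity j integrable_mult_right)
    fix y assume "y \<in> space mu"
    then have y: "y \<in> {0..1}" by simp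
    have "sqrt (model_density B j \<theta> y * f_o y) \<le> sqrt (exp \<delta> ^ 2 * (model_density B j \<theta>' y * f_o y))"
      using model_density_ratio[OF j b y] f_o_pos[OF y]
      by (intro real_sqrt_le_mono) (simp flip: exp_of_nat_mult mult.assoc)
    then show "sqrt (model_density B j \<theta> y * f_o y) \<le> exp \<delta> * sqrt (model_density B j \<theta>' y * f_o y)"
      by (simp add: real_sqrt_mult)
  qed
  then show ?thesis by (simp add: affinity_def)
qed

lemma nn_integral_root_ratio:
  assumes j: "j \<in> J"
  shows "(\<integral>\<^sup>+x. ennreal (root_ratio j n \<theta> x) \<partial>sample_law n) = ennreal (affinity j \<theta> ^ n)"
proof -
  have md: "model_density B j \<theta> \<in> borel_measurable mu" by (rule model_density_measurable[OF j])
  have "(\<integral>\<^sup>+x. ennreal (root_ratio j n \<theta> x) \<partial>sample_law n) =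
     (\<integral>\<^sup>+x. (\<Prod>i\<in>{1..n}. ennreal (sqrt (model_density B j \<theta> (x i) / f_o (x i)))) \<partial>sample_law n)"
    unfolding root_ratio_def using model_density_pos f_o_pos sample_mem
    by (intro nn_integral_cong prod_ennreal[symmetric]) (auto simp: less_imp_le)
  also have "\<dots> = (\<integral>\<^sup>+y. ennreal (f_o y) * ennreal (sqrt (model_density B j \<theta> y / f_o y)) \<partial>mu) ^ n"
    using md f_o_measurable by (intro nn_integral_sample_prod) measurable
  also have "(\<integral>\<^sup>+y. ennreal (f_o y) * ennreal (sqrt (model_density B j \<theta> y / f_o y)) \<partial>mu) =
     (\<integral>\<^sup>+y. ennreal (sqrt (model_density B j \<theta> y * f_o y)) \<partial>mu)"
  proof (intro nn_integral_cong)
    fix y assume "y \<in> space mu"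
    then have fy: "0 < f_o y" using f_o_pos by simp
    have md: "0 < model_density B j \<theta> y" by (rule model_density_pos)
    have "f_o y * sqrt (model_density B j \<theta> y / f_o y) = (sqrt (f_o y) * sqrt (f_o y)) * (sqrt (model_density B j \<theta> y) / sqrt (f_o y))"
      using fy by (simp add: real_sqrt_divide)
    also have "\<dots> = sqrt (model_density B j \<theta> y * f_o y)"
      using fy by (simp add: real_sqrt_mult del: real_sqrt_mult_self)
    finally show "ennreal (f_o y) * ennreal (sqrt (model_density B j \<theta> y / f_o y)) = ennreal (sqrt (model_density B j \<theta> y * f_o y))"
      using fy md by (simp flip: ennreal_mult)
  qed
  also have "\<dots> = ennreal (affinity j \<theta>)"
    unfolding affinity_def using f_o_pos model_density_pos
    by (intro nn_integral_eq_integral integrable_affinity[OF j] AE_I2) (auto simp: less_imp_le)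
  finally show ?thesis by (simp add: ennreal_power affinity_nonneg)
qed

text \<open>The square root of a likelihood at \<open>\<theta>\<close> is at most a multiple of its average over the ball of
  radius \<open>\<delta>\<close> around \<open>\<theta>\<close>, so its supremum over \<open>\<theta>\<close> is controlled by a single integral; no
  covering of the parameter set is needed.\<close>

lemma component_le_square:
  assumes j: "j \<in> J" and s: "0 \<le> s" and d: "0 < \<delta>"
  obtains Y where "Y \<in> borel_measurable (sample_law n)"
    "(\<integral>\<^sup>+x. Y x \<partial>sample_law n) \<le>
       ennreal (exp (2 * real n * \<delta> - real n * s\<^sup>2 / 2) * ((real (snd j) + \<delta>) / \<delta>) ^ (m_dim j - 1))"
    "\<And>x. x \<in> space (sample_law n) \<Longrightarrow>
       component j n x (- hellinger_ball f_o s) \<le> (Y x)\<^sup>2 * ennreal (true_likelihood n x)"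
proof -
  let ?M = "param_space j" and ?d = "m_dim j - 1" and ?L = "real (snd j)"
  let ?\<rho> = "exp (\<delta> - s\<^sup>2 / 2)"
  interpret prior: prob_space "model_prior B j" by (rule prob_space_model_prior[OF j])
  interpret sample: prob_space "sample_law n" by (rule prob_space_sample_law)
  interpret PM: product_sigma_finite "\<lambda>_::nat. lborel :: real measure" by standard
  interpret M: sigma_finite_measure ?M unfolding param_space_def by (rule PM.sigma_finite) simp
  interpret ps: pair_sigma_finite "sample_law n" ?M ..
  have L: "0 < ?L" using j by (auto simp: J_def)
  obtain u where u: "emeasure ?M (param_ball j (\<lambda>_. 0) 1) = ennreal u" "0 < u"
    using unit_ball_pos[OF j] unit_ball_finite[OF j]
    by (cases "emeasure ?M (param_ball j (\<lambda>_. 0) 1)") auto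
  \<comment> \<open>A fixed set that contains the ball of radius \<open>\<delta>\<close> around
    every parameter counted in the component, so \<open>Y\<close> does not depend on
    \<open>\<theta>\<close>. It is cut out by affinity because affinity changes over such a ball by
    at most the factor \<open>exp \<delta>\<close>, which is built into
    \<open>?\<rho>\<close>.\<close>
  define E where "E = {\<theta> \<in> param_ball j (\<lambda>_. 0) (?L + \<delta>). affinity j \<theta> \<le> ?\<rho>}"
  have E_sets [measurable]: "E \<in> sets ?M"
  proof -
    note [measurable] = affinity_measurable[OF j]
    have "{\<theta> \<in> space ?M. affinity j \<theta> \<le> ?\<rho>} \<in> sets ?M" by measurable
    moreover have "E = param_ball j (\<lambda>_. 0) (?L + \<delta>) \<inter> {\<theta> \<in> space ?M. affinity j \<theta> \<le> ?\<rho>}"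
      by (auto simp: E_def param_ball_def)
    ultimately show ?thesis using param_ball_measurable[OF j] by simp
  qed
  \<comment> \<open>One over the volume of a ball of radius \<open>\<delta>\<close>, times the loss
    from moving within that ball.\<close>
  define c where "c = exp (real n * \<delta>) / (\<delta> ^ ?d * u)"
  have c0: "0 \<le> c" using d u by (simp add: c_def)
  define Y where "Y = (\<lambda>x. ennreal c * (\<integral>\<^sup>+\<theta>. ennreal (root_ratio j n \<theta> x) * indicator E \<theta> \<partial>?M))"
  note [measurable] = root_ratio_measurable_pair[OF j, of n]
  have pm: "(\<lambda>z. ennreal (root_ratio j n (snd z) (fst z)) * indicator E (snd z)) \<in> borel_measurable (sample_law n \<Otimes>\<^sub>M ?M)"
    by measurable
  have inner: "(\<lambda>x. \<integral>\<^sup>+\<theta>. ennreal (root_ratio j n \<theta> x) * indicator E \<theta> \<partial>?M) \<in> borel_measurable (sample_law n)"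
    using M.borel_measurable_nn_integral[of "\<lambda>x \<theta>. ennreal (root_ratio j n \<theta> x) * indicator E \<theta>"] pm
    by (simp add: case_prod_beta')
  have m: "Y \<in> borel_measurable (sample_law n)"
    unfolding Y_def using inner by measurable
  have "(\<integral>\<^sup>+x. Y x \<partial>sample_law n) = ennreal c * (\<integral>\<^sup>+x. (\<integral>\<^sup>+\<theta>. ennreal (root_ratio j n \<theta> x) * indicator E \<theta> \<partial>?M) \<partial>sample_law n)"
    unfolding Y_def by (intro nn_integral_cmult inner)
  also have "(\<integral>\<^sup>+x. (\<integral>\<^sup>+\<theta>. ennreal (root_ratio j n \<theta> x) * indicator E \<theta> \<partial>?M) \<partial>sample_law n) =
     (\<integral>\<^sup>+\<theta>. (\<integral>\<^sup>+x. ennreal (root_ratio j n \<theta> x) * indicator E \<theta> \<partial>sample_law n) \<partial>?M)"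
    using pm by (intro ps.Fubini'[symmetric]) (simp add: case_prod_beta')
  also have "\<dots> \<le> (\<integral>\<^sup>+\<theta>. ennreal (?\<rho> ^ n) * indicator (param_ball j (\<lambda>_. 0) (?L + \<delta>)) \<theta> \<partial>?M)"
  proof (intro nn_integral_mono)
    fix \<theta>
    show "(\<integral>\<^sup>+x. ennreal (root_ratio j n \<theta> x) * indicator E \<theta> \<partial>sample_law n) \<le>
       ennreal (?\<rho> ^ n) * indicator (param_ball j (\<lambda>_. 0) (?L + \<delta>)) \<theta>"
    proof (cases "\<theta> \<in> E")
      case True
      then have "affinity j \<theta> ^ n \<le> ?\<rho> ^ n" by (intro power_mono affinity_nonneg) (auto simp: E_def)
      then show ?thesis using True nn_integral_root_ratio[OF j, of n \<theta>] by (simp add: E_def ennreal_leI)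
    qed simp
  qed
  also have "\<dots> = ennreal (?\<rho> ^ n) * emeasure ?M (param_ball j (\<lambda>_. 0) (?L + \<delta>))"
    using param_ball_measurable[OF j] by (intro nn_integral_cmult_indicator)
  also have "\<dots> = ennreal (?\<rho> ^ n * ((?L + \<delta>) ^ ?d * u))"
    unfolding emeasure_param_ball_scale[OF j add_pos_pos[OF L d]] u(1) using L d u(2) by (simp add: ennreal_mult)
  finally have "(\<integral>\<^sup>+x. Y x \<partial>sample_law n) \<le> ennreal c * ennreal (?\<rho> ^ n * ((?L + \<delta>) ^ ?d * u))"
    by (simp add: mult_left_mono)
  also have "\<dots> = ennreal (c * (?\<rho> ^ n * ((?L + \<delta>) ^ ?d * u)))"
    using c0 L d u by (simp add: ennreal_mult)
  \<comment> \<open>The volume \<open>u\<close> of the unit ball cancels, and a power of the ratio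
    of radii remains.\<close>
  also have "c * (?\<rho> ^ n * ((?L + \<delta>) ^ ?d * u)) = exp (real n * \<delta>) * ?\<rho> ^ n * ((?L + \<delta>) / \<delta>) ^ ?d"
    using d u by (simp add: c_def power_divide)
  also have "exp (real n * \<delta>) * ?\<rho> ^ n = exp (2 * real n * \<delta> - real n * s\<^sup>2 / 2)"
    by (simp add: algebra_simps flip: exp_of_nat_mult exp_add)
  finally have int: "(\<integral>\<^sup>+x. Y x \<partial>sample_law n) \<le>
       ennreal (exp (2 * real n * \<delta> - real n * s\<^sup>2 / 2) * ((?L + \<delta>) / \<delta>) ^ ?d)" .
  have "component j n x (- hellinger_ball f_o s) \<le> (Y x)\<^sup>2 * ennreal (true_likelihood n x)"
    if x: "x \<in> space (sample_law n)" for x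
  proof -
    have rr0: "0 \<le> root_ratio j n \<theta> x" for \<theta>
      unfolding root_ratio_def using f_o_pos sample_mem[OF x] model_density_pos
      by (intro prod_nonneg) (auto simp: less_imp_le)
    have root: "ennreal (root_ratio j n \<theta> x) \<le> Y x"
      if \<theta>: "\<theta> \<in> Theta B j" "model_density B j \<theta> \<in> - hellinger_ball f_o s" for \<theta>
    proof -
      have \<theta>L: "\<bar>lin_comb B j \<theta> y\<bar> \<le> ?L" if "y \<in> {0..1}" for y
        using \<theta>(1) that unfolding Theta_eq_param_ball[OF j] by (simp add: param_ball_def)
      have small: "affinity j \<theta> \<le> exp (- (s\<^sup>2 / 2))"
        using \<theta>(2) by (intro affinity_small j s) (simp add: hellinger_ball_def)
      have sub: "param_ball j \<theta> \<delta> \<subseteq> E"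
      proof
        fix \<theta>' assume "\<theta>' \<in> param_ball j \<theta> \<delta>"
        then have sp: "\<theta>' \<in> space ?M" and b: "\<And>y. y \<in> {0..1} \<Longrightarrow> \<bar>lin_comb B j \<theta>' y - lin_comb B j \<theta> y\<bar> \<le> \<delta>"
          by (auto simp: param_ball_def)
        have "\<bar>lin_comb B j \<theta>' y\<bar> \<le> ?L + \<delta>" if "y \<in> {0..1}" for y
          using b[OF that] \<theta>L[OF that] by linarith
        moreover have "affinity j \<theta>' \<le> exp \<delta> * affinity j \<theta>" by (rule affinity_ratio[OF j b])
        moreover have "exp \<delta> * affinity j \<theta> \<le> exp \<delta> * exp (- (s\<^sup>2 / 2))" using small by simp
        moreover have "exp \<delta> * exp (- (s\<^sup>2 / 2)) = ?\<rho>" by (simp flip: exp_add)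
        ultimately show "\<theta>' \<in> E" using sp by (simp add: E_def param_ball_def)
      qed
      have "ennreal (root_ratio j n \<theta> x) * ennreal (\<delta> ^ ?d * u) =
         (\<integral>\<^sup>+\<theta>'. ennreal (root_ratio j n \<theta> x) * indicator (param_ball j \<theta> \<delta>) \<theta>' \<partial>?M)"
        using param_ball_measurable[OF j, of \<theta> \<delta>] emeasure_param_ball_scale[OF j d, of \<theta>] u d
        by (subst nn_integral_cmult_indicator) (auto simp: ennreal_mult)
      also have "\<dots> \<le> (\<integral>\<^sup>+\<theta>'. ennreal (exp (real n * \<delta>)) * (ennreal (root_ratio j n \<theta>' x) * indicator E \<theta>') \<partial>?M)"
      proof (intro nn_integral_mono)
        fix \<theta>'
        show "ennreal (root_ratio j n \<theta> x) * indicator (param_ball j \<theta> \<delta>) \<theta>' \<le>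
           ennreal (exp (real n * \<delta>)) * (ennreal (root_ratio j n \<theta>' x) * indicator E \<theta>')"
        proof (cases "\<theta>' \<in> param_ball j \<theta> \<delta>")
          case True
          have "root_ratio j n \<theta> x \<le> exp (real n * \<delta>) * root_ratio j n \<theta>' x"
            using True by (intro likelihood_ratio_ball(2)[OF j _ x]) (auto simp: param_ball_def abs_minus_commute)
          then show ?thesis using True sub rr0 by (auto simp: ennreal_mult[symmetric] ennreal_leI)
        qed simp
      qed
      also have "\<dots> = ennreal (exp (real n * \<delta>)) * (\<integral>\<^sup>+\<theta>'. ennreal (root_ratio j n \<theta>' x) * indicator E \<theta>' \<partial>?M)"
        using measurable_compose[OF measurable_Pair1'[OF x] pm] by (intro nn_integral_cmult) simp
      finally have le: "ennreal (root_ratio j n \<theta> x) * ennreal (\<delta> ^ ?d * u) \<le>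
         ennreal (exp (real n * \<delta>)) * (\<integral>\<^sup>+\<theta>'. ennreal (root_ratio j n \<theta>' x) * indicator E \<theta>' \<partial>?M)" .
      have v: "0 < \<delta> ^ ?d * u" using d u by simp
      have "ennreal (root_ratio j n \<theta> x) = ennreal (root_ratio j n \<theta> x) * ennreal (\<delta> ^ ?d * u) * ennreal (1 / (\<delta> ^ ?d * u))"
        using v rr0 d u by (simp add: ennreal_mult[symmetric] mult.assoc)
      also have "\<dots> \<le> ennreal (exp (real n * \<delta>)) * (\<integral>\<^sup>+\<theta>'. ennreal (root_ratio j n \<theta>' x) * indicator E \<theta>' \<partial>?M) * ennreal (1 / (\<delta> ^ ?d * u))"
        by (intro mult_right_mono le) simp
      also have "\<dots> = (ennreal (exp (real n * \<delta>)) * ennreal (1 / (\<delta> ^ ?d * u))) * (\<integral>\<^sup>+\<theta>'. ennreal (root_ratio j n \<theta>' x) * indicator E \<theta>' \<partial>?M)"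
        by (simp add: mult_ac)
      also have "ennreal (exp (real n * \<delta>)) * ennreal (1 / (\<delta> ^ ?d * u)) = ennreal c"
        using v by (simp add: c_def ennreal_mult[symmetric])
      finally show ?thesis by (simp add: Y_def)
    qed
    have lik: "ennreal (likelihood j n \<theta> x) \<le> (Y x)\<^sup>2 * ennreal (true_likelihood n x)"
      if \<theta>: "\<theta> \<in> Theta B j" "model_density B j \<theta> \<in> - hellinger_ball f_o s" for \<theta>
    proof -
      have "likelihood j n \<theta> x = (root_ratio j n \<theta> x)\<^sup>2 * true_likelihood n x"
        unfolding likelihood_def root_ratio_def true_likelihood_def prod_power_distrib prod.distrib[symmetric]
      proof (intro prod.cong refl)
        fix i assume i: "i \<in> {1..n}"
        show "model_density B j \<theta> (x i) = (sqrt (model_density B j \<theta> (x i) / f_o (x i)))\<^sup>2 * f_o (x i)"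
          using f_o_pos[OF sample_mem[OF x i]] model_density_pos[of j \<theta> "x i"] by (simp add: less_imp_le)
      qed
      then have "ennreal (likelihood j n \<theta> x) = (ennreal (root_ratio j n \<theta> x))\<^sup>2 * ennreal (true_likelihood n x)"
        using true_likelihood_pos[OF x] rr0 by (simp add: ennreal_mult' ennreal_power)
      also have "\<dots> \<le> (Y x)\<^sup>2 * ennreal (true_likelihood n x)"
        by (intro mult_right_mono power_mono root \<theta>) auto
      finally show ?thesis .
    qed
    have "component j n x (- hellinger_ball f_o s) \<le> (\<integral>\<^sup>+\<theta>. (Y x)\<^sup>2 * ennreal (true_likelihood n x) \<partial>model_prior B j)"
      unfolding component_def using lik by (intro nn_integral_mono) (auto simp: indicator_def)
    then show ?thesis by (simp add: prior.emeasure_space_1)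
  qed
  with m int show ?thesis by (rule that)
qed

text \<open>Only a fixed parameter is treated; its neighbours follow deterministically from
  \<open>likelihood_ratio_ball\<close>. The integral bounded by \<open>exp \<kappa>\<close> is one
  plus the chi-square divergence, which gives an exponentially small exceptional set through a first
  moment.\<close>

lemma likelihood_lower_event:
  fixes n :: nat and t :: real
  assumes j: "j \<in> J" and chi: "(\<integral>\<^sup>+y. ennreal ((f_o y)\<^sup>2 / model_density B j \<theta> y) \<partial>mu) \<le> ennreal (exp \<kappa>)"
  defines "G \<equiv> {x \<in> space (sample_law n). exp (- real n * \<kappa> - t) * true_likelihood n x \<le> likelihood j n \<theta> x}"
  shows "G \<in> sets (sample_law n)" and "emeasure (sample_law n) (space (sample_law n) - G) \<le> ennreal (exp (- t))"
proof -
  let ?P = "sample_law n"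
  have md: "model_density B j \<theta> \<in> borel_measurable mu" by (rule model_density_measurable[OF j])
  have lm [measurable]: "likelihood j n \<theta> \<in> borel_measurable ?P"
    unfolding likelihood_def using md by measurable
  show G: "G \<in> sets ?P" unfolding G_def by measurable
  let ?u = "\<lambda>x. \<Prod>i\<in>{1..n}. ennreal (f_o (x i) / model_density B j \<theta> (x i))"
  have um: "?u \<in> borel_measurable ?P"
    using md by measurable
  have eq: "?u x = ennreal (true_likelihood n x / likelihood j n \<theta> x)" if "x \<in> space ?P" for x
    unfolding true_likelihood_def likelihood_def prod_dividef[symmetric]
    using f_o_pos sample_mem[OF that] model_density_pos by (intro prod_ennreal) (auto simp: less_imp_le)
  have "space ?P - G \<subseteq> {x \<in> space ?P. 1 \<le> ennreal (exp (- real n * \<kappa> - t)) * ?u x}"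
  proof
    fix x assume "x \<in> space ?P - G"
    then have x: "x \<in> space ?P" and l: "likelihood j n \<theta> x < exp (- real n * \<kappa> - t) * true_likelihood n x"
      by (auto simp: G_def)
    have "1 \<le> exp (- real n * \<kappa> - t) * (true_likelihood n x / likelihood j n \<theta> x)"
      using l likelihood_pos[of j n \<theta> x] by simp
    then have "ennreal 1 \<le> ennreal (exp (- real n * \<kappa> - t) * (true_likelihood n x / likelihood j n \<theta> x))"
      by (rule ennreal_leI)
    then have "1 \<le> ennreal (exp (- real n * \<kappa> - t)) * ?u x"
      unfolding eq[OF x] by (subst ennreal_mult'[symmetric]) (simp_all only: exp_ge_zero ennreal_1)
    then show "x \<in> {x \<in> space ?P. 1 \<le> ennreal (exp (- real n * \<kappa> - t)) * ?u x}"
      using x by (intro CollectI conjI)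
  qed
  then have "emeasure ?P (space ?P - G) \<le> emeasure ?P {x \<in> space ?P. 1 \<le> ennreal (exp (- real n * \<kappa> - t)) * ?u x}"
    by (rule emeasure_mono) (use um in measurable)
  also have "\<dots> \<le> ennreal (exp (- real n * \<kappa> - t)) * (\<integral>\<^sup>+x. ?u x * indicator (space ?P) x \<partial>?P)"
    using um by (intro nn_integral_Markov_inequality) auto
  also have "(\<integral>\<^sup>+x. ?u x * indicator (space ?P) x \<partial>?P) = (\<integral>\<^sup>+x. ?u x \<partial>?P)"
    by (intro nn_integral_cong) simp
  also have "\<dots> = (\<integral>\<^sup>+y. ennreal (f_o y) * ennreal (f_o y / model_density B j \<theta> y) \<partial>mu) ^ n"
    using md f_o_measurable by (intro nn_integral_sample_prod) measurable
  also have "(\<integral>\<^sup>+y. ennreal (f_o y) * ennreal (f_o y / model_density B j \<theta> y) \<partial>mu) = (\<integral>\<^sup>+y. ennreal ((f_o y)\<^sup>2 / model_density B j \<theta> y) \<partial>mu)"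
    using f_o_pos by (intro nn_integral_cong) (simp add: ennreal_mult'[symmetric] less_imp_le power2_eq_square)
  also have "ennreal (exp (- real n * \<kappa> - t)) * \<dots> ^ n \<le> ennreal (exp (- real n * \<kappa> - t)) * ennreal (exp \<kappa>) ^ n"
    by (intro mult_left_mono power_mono chi) auto
  also have "\<dots> = ennreal (exp (- t))"
    by (simp add: ennreal_power ennreal_mult[symmetric] flip: exp_of_nat_mult exp_add)
  finally show "emeasure ?P (space ?P - G) \<le> ennreal (exp (- t))" .
qed

text \<open>With \<open>?e\<close> the error in the logarithm, the integral is the product of the
  means of \<open>exp (- ?e)\<close> and \<open>exp ?e\<close> under \<open>f_o\<close>; the first
  of them is \<open>exp c\<close> times the normalizer. Their first-order terms \<open>- m\<close>
  and \<open>m\<close> cancel in the product, so the bound is quadratic in the error. The constant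
  \<open>c\<close> is free because normalization absorbs it.\<close>

lemma chi_square_bound:
  assumes j: "j \<in> J" and M0: "\<And>x. x \<in> {0..1} \<Longrightarrow> \<bar>ln (f_o x)\<bar> \<le> M0"
    and K: "\<And>x. x \<in> {0..1} \<Longrightarrow> \<bar>ln (f_o x) - c - lin_comb B j \<theta> x\<bar> \<le> K"
    and e: "(\<integral>x. (ln (f_o x) - c - lin_comb B j \<theta> x)\<^sup>2 \<partial>mu) \<le> \<epsilon>"
  shows "(\<integral>\<^sup>+y. ennreal ((f_o y)\<^sup>2 / model_density B j \<theta> y) \<partial>mu) \<le> ennreal (exp (2 * exp (K + M0) * \<epsilon>))"
proof -
  let ?e = "\<lambda>x. ln (f_o x) - c - lin_comb B j \<theta> x"
  have em [measurable]: "?e \<in> borel_measurable mu"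
    using lin_comb_measurable[OF j] f_o_measurable by measurable
  have fb: "f_o x \<le> exp M0" if "x \<in> {0..1}" for x
    using M0[OF that] f_o_pos[OF that] by (metis abs_le_iff exp_le_cancel_iff exp_ln)
  have bnd: "integrable mu h" if "h \<in> borel_measurable mu" "\<And>x. x \<in> {0..1} \<Longrightarrow> \<bar>h x\<bar> \<le> C" for h and C :: real
    using that by (intro mu.integrable_const_bound[of _ C]) auto
  have K0: "0 \<le> K" using K[of 0] by simp
  have e2: "(?e x)\<^sup>2 \<le> K\<^sup>2" if "x \<in> {0..1}" for x
    using K[OF that] by (metis abs_ge_zero power2_abs power_mono)
  have i2: "integrable mu (\<lambda>x. (?e x)\<^sup>2)" using e2 em by (intro bnd[of _ "K\<^sup>2"]) auto
  have if1: "integrable mu (\<lambda>x. f_o x * ?e x)"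
    using em f_o_pos fb K by (intro bnd[of _ "exp M0 * K"]) (auto simp: abs_mult less_imp_le intro!: mult_mono)
  have if2: "integrable mu (\<lambda>x. f_o x * (?e x)\<^sup>2)"
    using em f_o_pos fb e2 by (intro bnd[of _ "exp M0 * K\<^sup>2"]) (auto simp: abs_mult less_imp_le intro!: mult_mono)
  have ifp: "integrable mu (\<lambda>x. f_o x * exp (\<sigma> * ?e x))" if "\<bar>\<sigma>\<bar> = 1" for \<sigma>
  proof (intro bnd[of _ "exp M0 * exp K"])
    fix x :: real assume x: "x \<in> {0..1}"
    have "\<bar>\<sigma> * ?e x\<bar> \<le> K" using K[OF x] that by (simp add: abs_mult)
    then have "exp (\<sigma> * ?e x) \<le> exp K" by simp
    then show "\<bar>f_o x * exp (\<sigma> * ?e x)\<bar> \<le> exp M0 * exp K"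
      using f_o_pos[OF x] fb[OF x] by (auto simp: abs_mult intro!: mult_mono)
  qed (use em in measurable)
  define m v where "m = (\<integral>x. f_o x * ?e x \<partial>mu)" and "v = (\<integral>x. f_o x * (?e x)\<^sup>2 \<partial>mu)"
  have v0: "0 \<le> v" unfolding v_def using f_o_pos by (intro Bochner_Integration.integral_nonneg) (auto simp: less_imp_le)
  have "v \<le> (\<integral>x. exp M0 * (?e x)\<^sup>2 \<partial>mu)"
    unfolding v_def using i2 if2 fb by (intro integral_mono) (auto intro!: mult_right_mono)
  also have "\<dots> \<le> exp M0 * \<epsilon>" using e by simp
  finally have v: "v \<le> exp M0 * \<epsilon>" .
  \<comment> \<open>One Taylor estimate serves both factors, with \<open>\<sigma>\<close> equal to 1
    and to -1.\<close>
  have moment: "(\<integral>x. f_o x * exp (\<sigma> * ?e x) \<partial>mu) \<le> 1 + \<sigma> * m + exp K * v" if \<sigma>: "\<bar>\<sigma>\<bar> = 1" for \<sigma>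
  proof -
    have \<sigma>2: "\<sigma>\<^sup>2 = 1" using \<sigma> by (metis power2_abs one_power2)
    have "(\<integral>x. f_o x * exp (\<sigma> * ?e x) \<partial>mu) \<le> (\<integral>x. f_o x + \<sigma> * (f_o x * ?e x) + exp K * (f_o x * (?e x)\<^sup>2) \<partial>mu)"
    proof (intro integral_mono ifp[OF \<sigma>])
      fix x assume "x \<in> space mu"
      then have x: "x \<in> {0..1}" by simp
      have "\<bar>\<sigma> * ?e x\<bar> \<le> K" using K[OF x] \<sigma> by (simp add: abs_mult)
      then have "exp (\<sigma> * ?e x) \<le> 1 + \<sigma> * ?e x + exp K * (\<sigma> * ?e x)\<^sup>2" by (rule exp_le_quadratic)
      then have "f_o x * exp (\<sigma> * ?e x) \<le> f_o x * (1 + \<sigma> * ?e x + exp K * (?e x)\<^sup>2)"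
        using f_o_pos[OF x] \<sigma>2 by (intro mult_left_mono) (auto simp: power_mult_distrib)
      then show "f_o x * exp (\<sigma> * ?e x) \<le> f_o x + \<sigma> * (f_o x * ?e x) + exp K * (f_o x * (?e x)\<^sup>2)"
        by (simp add: algebra_simps)
    qed (use integrable_f_o if1 if2 in auto)
    also have "\<dots> = 1 + \<sigma> * m + exp K * v"
      using integrable_f_o if1 if2 f_o_density by (simp add: m_def v_def)
    finally show ?thesis .
  qed
  let ?Z = "\<integral>x. exp (lin_comb B j \<theta> x) \<partial>mu"
  have lc: "exp c * exp (lin_comb B j \<theta> x) = f_o x * exp (-1 * ?e x)" if "x \<in> {0..1}" for x
  proof -
    have "f_o x * exp (-1 * ?e x) = exp (ln (f_o x)) * exp (-1 * ?e x)" using f_o_pos[OF that] by simp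
    also have "\<dots> = exp c * exp (lin_comb B j \<theta> x)" by (simp flip: exp_add)
    finally show ?thesis ..
  qed
  have "exp c * ?Z = (\<integral>x. exp c * exp (lin_comb B j \<theta> x) \<partial>mu)" by simp
  also have "\<dots> = (\<integral>x. f_o x * exp (-1 * ?e x) \<partial>mu)"
    using lc by (intro Bochner_Integration.integral_cong) auto
  finally have Z: "exp c * ?Z \<le> 1 - m + exp K * v" using moment[of "-1"] by simp
  have ratio: "(f_o x)\<^sup>2 / model_density B j \<theta> x = (exp c * ?Z) * (f_o x * exp (1 * ?e x))" if "x \<in> {0..1}" for x
  proof -
    have "exp (-1 * ?e x) * exp (1 * ?e x) = 1" unfolding exp_add[symmetric] by simp
    then have "(f_o x)\<^sup>2 = (f_o x * f_o x) * (exp (-1 * ?e x) * exp (1 * ?e x))" by (simp add: power2_eq_square)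
    also have "\<dots> = (f_o x * exp (-1 * ?e x)) * (f_o x * exp (1 * ?e x))" by (simp only: mult_ac)
    finally have "(f_o x)\<^sup>2 = (exp c * exp (lin_comb B j \<theta> x)) * (f_o x * exp (1 * ?e x))"
      unfolding lc[OF that] .
    then show ?thesis unfolding model_density_eq[OF j] using normalizer_pos[OF j, of \<theta>] by (simp add: field_simps)
  qed
  have pos: "0 \<le> exp c * ?Z" using normalizer_pos[OF j, of \<theta>] by (simp add: less_imp_le)
  have "(\<integral>\<^sup>+y. ennreal ((f_o y)\<^sup>2 / model_density B j \<theta> y) \<partial>mu) = (\<integral>\<^sup>+y. ennreal ((exp c * ?Z) * (f_o y * exp (1 * ?e y))) \<partial>mu)"
    by (intro nn_integral_cong) (use ratio in simp)
  also have "\<dots> = ennreal (\<integral>y. (exp c * ?Z) * (f_o y * exp (1 * ?e y)) \<partial>mu)"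
    using ifp[of 1] pos f_o_pos by (intro nn_integral_eq_integral AE_I2) (auto simp: less_imp_le)
  also have "(\<integral>y. (exp c * ?Z) * (f_o y * exp (1 * ?e y)) \<partial>mu) = (exp c * ?Z) * (\<integral>y. f_o y * exp (1 * ?e y) \<partial>mu)" by simp
  also have "ennreal \<dots> \<le> ennreal (exp (2 * exp (K + M0) * \<epsilon>))"
  proof (rule ennreal_leI)
    have "(exp c * ?Z) * (\<integral>y. f_o y * exp (1 * ?e y) \<partial>mu) \<le> (1 - m + exp K * v) * (1 + 1 * m + exp K * v)"
      using Z moment[of 1] pos f_o_pos order.trans[OF pos Z]
      by (intro mult_mono Bochner_Integration.integral_nonneg) (auto simp: less_imp_le)
    \<comment> \<open>The product equals \<open>(1 + exp K * v)\<^sup>2 - m\<^sup>2\<close>.\<close>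
    also have "\<dots> \<le> (1 + exp K * v)\<^sup>2" by (simp add: power2_eq_square algebra_simps)
    also have "\<dots> \<le> (exp (exp K * v))\<^sup>2"
      using v0 by (intro power_mono exp_ge_add_one_self) (auto intro!: add_nonneg_nonneg)
    also have "\<dots> = exp (2 * (exp K * v))" by (simp flip: exp_double)
    also have "\<dots> \<le> exp (2 * exp (K + M0) * \<epsilon>)"
      using mult_left_mono[OF v, of "exp K"] by (simp add: exp_add mult_ac)
    finally show "(exp c * ?Z) * (\<integral>y. f_o y * exp (1 * ?e y) \<partial>mu) \<le> exp (2 * exp (K + M0) * \<epsilon>)" .
  qed
  finally show ?thesis .
qed

section \<open>A finite-sample bound for the posterior\<close>


text \<open>On the event where the evidence is at least \<open>D\<close> times the true likelihood,
  the share of each model in the bad posterior mass has two mean bounds: the prior weight over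
  \<open>D\<close>, effective for large models, and the square root of that times the mean of an
  averaged root likelihood, effective for small ones. Keeping the minimum postpones the choice
  between them to the summation over \<open>J\<close>.\<close>

lemma posterior_bound:
  fixes w b :: "nat \<times> nat \<Rightarrow> real" and n :: nat and s \<delta> t \<kappa> \<epsilon> :: real
  assumes w: "\<And>j. j \<in> J \<Longrightarrow> 0 < w j" and j0: "j\<^sub>0 \<in> J" and d: "0 < \<delta>" and s: "0 \<le> s" and \<epsilon>: "0 < \<epsilon>"
    and sub: "param_ball j\<^sub>0 \<theta>\<^sub>0 \<delta> \<subseteq> Theta B j\<^sub>0"
    and chi: "(\<integral>\<^sup>+y. ennreal ((f_o y)\<^sup>2 / model_density B j\<^sub>0 \<theta>\<^sub>0 y) \<partial>mu) \<le> ennreal (exp \<kappa>)"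
  defines "D \<equiv> w j\<^sub>0 * (\<delta> / real (snd j\<^sub>0)) ^ (m_dim j\<^sub>0 - 1) * exp (- 2 * real n * \<delta> - real n * \<kappa> - t)"
  assumes b: "\<And>j. j \<in> J \<Longrightarrow> min (w j / D)
      (sqrt (w j / D) * (exp (2 * real n * \<delta> - real n * s\<^sup>2 / 2) * ((real (snd j) + \<delta>) / \<delta>) ^ (m_dim j - 1))) \<le> b j"
  shows "emeasure (sample_law n) {x \<in> space (sample_law n). \<bar>posterior B w n x (- hellinger_ball f_o s)\<bar> > \<epsilon>} \<le>
    ennreal (exp (- t)) + ennreal (1 / \<epsilon>) * (\<Sum>\<^sub>\<infinity>j\<in>J. ennreal (b j))"
proof -
  let ?P = "sample_law n" and ?S = "- hellinger_ball f_o s" and ?e = "from_nat_into J"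
  let ?U = "\<lambda>x. evidence B w n x UNIV"
  interpret sample: prob_space ?P by (rule prob_space_sample_law)
  have L0: "0 < real (snd j\<^sub>0)" using j0 by (auto simp: J_def)
  have D: "0 < D" unfolding D_def using w[OF j0] d L0 by simp
  define G where "G = {x \<in> space ?P. exp (- real n * \<kappa> - t) * true_likelihood n x \<le> likelihood j\<^sub>0 n \<theta>\<^sub>0 x}"
  have G [measurable]: "G \<in> sets ?P" and bad: "emeasure ?P (space ?P - G) \<le> ennreal (exp (- t))"
    unfolding G_def using likelihood_lower_event[OF j0 chi] by auto
  have U_ge: "ennreal (w j) * component j n x UNIV \<le> ?U x" if jJ: "j \<in> J" for j x
  proof -
    obtain k where k: "j = ?e k" using from_nat_into_surj[OF _ jJ] by auto
    have "(\<lambda>k. ennreal (w (?e k)) * component (?e k) n x UNIV) k \<le> (\<Sum>k. ennreal (w (?e k)) * component (?e k) n x UNIV)"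
      using sum_le_suminf[of "\<lambda>k. ennreal (w (?e k)) * component (?e k) n x UNIV" "{k}"] by simp
    then show ?thesis unfolding evidence_eq k .
  qed
  have U_lower: "ennreal (D * true_likelihood n x) \<le> ?U x" if "x \<in> G" for x
  proof -
    have x: "x \<in> space ?P" and l: "exp (- real n * \<kappa> - t) * true_likelihood n x \<le> likelihood j\<^sub>0 n \<theta>\<^sub>0 x"
      using that by (auto simp: G_def)
    let ?c = "(\<delta> / real (snd j\<^sub>0)) ^ (m_dim j\<^sub>0 - 1) * exp (- 2 * real n * \<delta>)"
    have "D * true_likelihood n x = w j\<^sub>0 * (?c * (exp (- real n * \<kappa> - t) * true_likelihood n x))"
      unfolding D_def by (simp add: mult_ac flip: exp_add)
    also have "\<dots> \<le> w j\<^sub>0 * (?c * likelihood j\<^sub>0 n \<theta>\<^sub>0 x)"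
      using l w[OF j0] d L0 by (intro mult_left_mono) (auto simp: less_imp_le)
    finally have "ennreal (D * true_likelihood n x) \<le> ennreal (w j\<^sub>0 * (?c * likelihood j\<^sub>0 n \<theta>\<^sub>0 x))"
      by (rule ennreal_leI)
    also have "\<dots> = ennreal (w j\<^sub>0) * ennreal (?c * likelihood j\<^sub>0 n \<theta>\<^sub>0 x)"
      using w[OF j0] by (intro ennreal_mult') auto
    also have "\<dots> \<le> ennreal (w j\<^sub>0) * component j\<^sub>0 n x UNIV"
      by (intro mult_left_mono component_UNIV_lower j0 d sub x) simp
    also have "\<dots> \<le> ?U x" by (rule U_ge[OF j0])
    finally show ?thesis .
  qed
  have cm: "(\<lambda>x. component j n x ?S) \<in> borel_measurable ?P" if "j \<in> J" for j
    by (rule component_measurable[OF that hellinger_measurable[OF that]])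
  have Um [measurable]: "?U \<in> borel_measurable ?P"
    by (rule evidence_measurable) simp
  define q where "q = (\<lambda>j x. ennreal (w j) * component j n x ?S / ?U x * indicator G x)"
  have qm: "q j \<in> borel_measurable ?P" if "j \<in> J" for j
    unfolding q_def using cm[OF that] by measurable
  have q_ratio: "q j x \<le> ennreal (w j / D) * (component j n x ?S / ennreal (true_likelihood n x)) * indicator G x"
    if j: "j \<in> J" for j x
  proof (cases "x \<in> G")
    case True
    then have tp: "0 < true_likelihood n x" by (intro true_likelihood_pos) (simp add: G_def)
    have "q j x \<le> ennreal (w j) * component j n x ?S / ennreal (D * true_likelihood n x)"
      unfolding q_def using U_lower[OF True] True by (simp add: divide_ennreal_def mult_left_mono ennreal_inverse_antimono)
    also have "\<dots> = ennreal (w j) * component j n x ?S * inverse (ennreal D * ennreal (true_likelihood n x))"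
      using D by (simp add: divide_ennreal_def ennreal_mult')
    also have "\<dots> = (ennreal (w j) * inverse (ennreal D)) * (component j n x ?S / ennreal (true_likelihood n x))"
      using D tp by (subst ennreal_inverse_mult) (auto simp: divide_ennreal_def mult_ac)
    also have "ennreal (w j) * inverse (ennreal D) = ennreal (w j / D)"
      using D w[OF j] by (simp add: divide_ennreal[symmetric] divide_ennreal_def)
    finally show ?thesis using True by simp
  qed (simp add: q_def)
  have q_int: "(\<integral>\<^sup>+x. q j x \<partial>?P) \<le> ennreal (b j)" if j: "j \<in> J" for j
  proof -
    have wD: "0 < w j / D" using w[OF j] D by simp
    have "(\<integral>\<^sup>+x. q j x \<partial>?P) \<le> (\<integral>\<^sup>+x. ennreal (w j / D) * (component j n x ?S / ennreal (true_likelihood n x)) \<partial>?P)"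
    proof (intro nn_integral_mono)
      fix x show "q j x \<le> ennreal (w j / D) * (component j n x ?S / ennreal (true_likelihood n x))"
        using q_ratio[OF j, of x] by (cases "x \<in> G") (auto simp: q_def)
    qed
    also have "\<dots> = ennreal (w j / D) * (\<integral>\<^sup>+x. component j n x ?S / ennreal (true_likelihood n x) \<partial>?P)"
      by (intro nn_integral_cmult borel_measurable_divide_ennreal cm[OF j]
        measurable_compose[OF true_likelihood_measurable measurable_ennreal])
    also have "\<dots> \<le> ennreal (w j / D) * 1"
      by (intro mult_left_mono nn_integral_component_ratio[OF j hellinger_measurable[OF j]]) simp
    finally have first: "(\<integral>\<^sup>+x. q j x \<partial>?P) \<le> ennreal (w j / D)" by simp
    let ?r = "exp (2 * real n * \<delta> - real n * s\<^sup>2 / 2) * ((real (snd j) + \<delta>) / \<delta>) ^ (m_dim j - 1)"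
    obtain Y where Y: "Y \<in> borel_measurable ?P" "(\<integral>\<^sup>+x. Y x \<partial>?P) \<le> ennreal ?r"
      "\<And>x. x \<in> space ?P \<Longrightarrow> component j n x ?S \<le> (Y x)\<^sup>2 * ennreal (true_likelihood n x)"
      using component_le_square[OF j s d, where n = n] by blast
    have "q j x \<le> ennreal (sqrt (w j / D)) * Y x" if x: "x \<in> space ?P" for x
    proof (rule ennreal_le_of_le_square)
      have "ennreal (w j) * component j n x ?S \<le> ennreal (w j) * component j n x UNIV"
        unfolding component_def by (intro mult_left_mono nn_integral_mono) (auto simp: indicator_def)
      also have "\<dots> \<le> ?U x" by (rule U_ge[OF j])
      finally have "ennreal (w j) * component j n x ?S / ?U x \<le> ?U x / ?U x" by (rule divide_right_mono_ennreal)
      \<comment> \<open>In \<open>ennreal\<close> the quotient is 0 when the evidence is 0 or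
        infinite.\<close>
      also have "\<dots> \<le> 1"
        by (cases "?U x = 0 \<or> ?U x = \<infinity>") (auto simp: less_top)
      finally show "q j x \<le> 1" by (auto simp: q_def indicator_def)
      have tp: "0 < true_likelihood n x" by (rule true_likelihood_pos[OF x])
      have "q j x \<le> ennreal (w j / D) * (component j n x ?S / ennreal (true_likelihood n x))"
        using q_ratio[OF j, of x] by (cases "x \<in> G") (auto simp: q_def)
      also have "\<dots> \<le> ennreal (w j / D) * ((Y x)\<^sup>2 * ennreal (true_likelihood n x) / ennreal (true_likelihood n x))"
        by (intro mult_left_mono divide_right_mono_ennreal Y(3) x) simp
      also have "(Y x)\<^sup>2 * ennreal (true_likelihood n x) / ennreal (true_likelihood n x) = (Y x)\<^sup>2"
        using tp by (intro mult_divide_eq_ennreal) auto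
      also have "ennreal (w j / D) = (ennreal (sqrt (w j / D)))\<^sup>2"
        using wD by (simp add: ennreal_power)
      finally show "q j x \<le> (ennreal (sqrt (w j / D)) * Y x)\<^sup>2" by (simp add: power_mult_distrib)
    qed
    then have "(\<integral>\<^sup>+x. q j x \<partial>?P) \<le> (\<integral>\<^sup>+x. ennreal (sqrt (w j / D)) * Y x \<partial>?P)" by (rule nn_integral_mono)
    also have "\<dots> = ennreal (sqrt (w j / D)) * (\<integral>\<^sup>+x. Y x \<partial>?P)" by (intro nn_integral_cmult Y)
    also have "\<dots> \<le> ennreal (sqrt (w j / D)) * ennreal ?r" by (intro mult_left_mono Y) simp
    also have "\<dots> = ennreal (sqrt (w j / D) * ?r)" using wD d by (simp add: ennreal_mult)
    finally have "(\<integral>\<^sup>+x. q j x \<partial>?P) \<le> ennreal (min (w j / D) (sqrt (w j / D) * ?r))"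
      using first by (auto simp: min_def)
    also have "\<dots> \<le> ennreal (b j)" by (intro ennreal_leI b j)
    finally show ?thesis .
  qed
  have ratio: "evidence B w n x ?S / ?U x * indicator G x = (\<Sum>k. q (?e k) x)" for x
    unfolding evidence_eq[of w n x ?S] q_def divide_ennreal_def mult.assoc ennreal_suminf_multc[symmetric] ..
  have "(\<integral>\<^sup>+x. evidence B w n x ?S / ?U x * indicator G x \<partial>?P) = (\<Sum>k. \<integral>\<^sup>+x. q (?e k) x \<partial>?P)"
    unfolding ratio by (intro nn_integral_suminf qm from_nat_into_J)
  also have "\<dots> \<le> (\<Sum>k. ennreal (b (?e k)))"
    by (intro suminf_le q_int from_nat_into_J) auto
  also have "\<dots> = (\<Sum>\<^sub>\<infinity>j\<in>J. ennreal (b j))" by (simp add: infsum_J_suminf)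
  finally have int: "(\<integral>\<^sup>+x. evidence B w n x ?S / ?U x * indicator G x \<partial>?P) \<le> (\<Sum>\<^sub>\<infinity>j\<in>J. ennreal (b j))" .
  have Sm [measurable]: "(\<lambda>x. evidence B w n x ?S) \<in> borel_measurable ?P"
    by (rule evidence_measurable[OF hellinger_measurable])
  let ?R = "{x \<in> G. 1 \<le> ennreal (1 / \<epsilon>) * (evidence B w n x ?S / ?U x)}"
  have R: "?R \<in> sets ?P"
  proof -
    have "?R = G \<inter> {x \<in> space ?P. 1 \<le> ennreal (1 / \<epsilon>) * (evidence B w n x ?S / ?U x)}"
      using sets.sets_into_space[OF G] by auto
    then show ?thesis by simp
  qed
  have "{x \<in> space ?P. \<bar>posterior B w n x ?S\<bar> > \<epsilon>} \<subseteq> (space ?P - G) \<union> ?R"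
  proof
    fix x assume x: "x \<in> {x \<in> space ?P. \<bar>posterior B w n x ?S\<bar> > \<epsilon>}"
    define r where "r = evidence B w n x ?S / ?U x"
    have r: "enn2real r > \<epsilon>" using x by (simp add: posterior_def r_def)
    have "ennreal 1 \<le> ennreal (1 / \<epsilon> * enn2real r)" using r \<epsilon> by (intro ennreal_leI) simp
    also have "\<dots> = ennreal (1 / \<epsilon>) * ennreal (enn2real r)" using \<epsilon> by (intro ennreal_mult) auto
    \<comment> \<open>\<open>enn2real\<close> sends infinity to 0, so in general only this
      inequality holds.\<close>
    also have "\<dots> \<le> ennreal (1 / \<epsilon>) * r" by (intro mult_left_mono) (cases r, auto)
    finally show "x \<in> (space ?P - G) \<union> ?R" using x by (auto simp: r_def)
  qed
  then have "emeasure ?P {x \<in> space ?P. \<bar>posterior B w n x ?S\<bar> > \<epsilon>} \<le> emeasure ?P ((space ?P - G) \<union> ?R)"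
    using R G by (intro emeasure_mono) auto
  also have "\<dots> \<le> emeasure ?P (space ?P - G) + emeasure ?P ?R"
    using R G by (intro emeasure_subadditive) auto
  also have "\<dots> \<le> ennreal (exp (- t)) + ennreal (1 / \<epsilon>) * (\<Sum>\<^sub>\<infinity>j\<in>J. ennreal (b j))"
  proof (intro add_mono bad)
    have "emeasure ?P ?R \<le> ennreal (1 / \<epsilon>) * (\<integral>\<^sup>+x. evidence B w n x ?S / ?U x * indicator G x \<partial>?P)"
      by (intro nn_integral_Markov_inequality G) measurable
    also have "\<dots> \<le> ennreal (1 / \<epsilon>) * (\<Sum>\<^sub>\<infinity>j\<in>J. ennreal (b j))" by (intro mult_left_mono int) simp
    finally show "emeasure ?P ?R \<le> ennreal (1 / \<epsilon>) * (\<Sum>\<^sub>\<infinity>j\<in>J. ennreal (b j))" .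
  qed
  finally show ?thesis .
qed

end


section \<open>Prior weights and the approximating parameter\<close>

lemma infsum_ennreal_real:
  fixes f :: "'a \<Rightarrow> real"
  assumes "f summable_on A" and nn: "\<And>x. x \<in> A \<Longrightarrow> 0 \<le> f x"
  shows "(\<Sum>\<^sub>\<infinity>x\<in>A. ennreal (f x)) = ennreal (\<Sum>\<^sub>\<infinity>x\<in>A. f x)"
proof -
  have "(\<Sum>\<^sub>\<infinity>x\<in>A. ennreal (f x)) = (SUP F\<in>{F. finite F \<and> F \<subseteq> A}. sum (\<lambda>x. ennreal (f x)) F)"
    by (rule nonneg_infsum_complete) simp
  also have "\<dots> = (SUP F\<in>{F. finite F \<and> F \<subseteq> A}. ennreal (sum f F))"
    using nn by (intro SUP_cong refl sum_ennreal) auto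
  also have "\<dots> = ennreal (\<Sum>\<^sub>\<infinity>x\<in>A. f x)"
    by (rule infsum_nonneg_is_SUPREMUM_ennreal[OF assms, symmetric])
  finally show ?thesis .
qed

text \<open>The reference series for summing the bounds over all models.\<close>

lemma summable_on_J_exp: "(\<lambda>(l, L). exp (- real l - real L)) summable_on J"
proof -
  have geo: "summable (\<lambda>n. exp (- real n))"
  proof -
    have "(\<lambda>n. exp (- real n)) = (\<lambda>n. exp (-1) ^ n)" by (simp flip: exp_of_nat_mult)
    then show ?thesis by (simp add: summable_geometric)
  qed
  then have hs: "((\<lambda>n. exp (- real n)) has_sum (\<Sum>n. exp (- real n))) UNIV"
    by (intro sums_nonneg_imp_has_sum summable_sums) auto
  have "(\<lambda>(l, L). exp (- real l - real L)) summable_on (SIGMA l:(UNIV::nat set). (UNIV::nat set))"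
  proof (rule summable_on_SigmaI)
    fix l :: nat
    have "((\<lambda>L. exp (- real l) * exp (- real L)) has_sum (exp (- real l) * (\<Sum>n. exp (- real n)))) UNIV"
      by (rule has_sum_cmult_right[OF hs])
    then show "((\<lambda>L. case (l, L) of (l, L) \<Rightarrow> exp (- real l - real L)) has_sum (exp (- real l) * (\<Sum>n. exp (- real n)))) UNIV"
      by (simp flip: exp_add)
    show "(\<lambda>l. exp (- real l) * (\<Sum>n. exp (- real n))) summable_on UNIV"
      using has_sum_imp_summable[OF hs] by (intro summable_on_cmult_left)
  qed auto
  then show ?thesis by (rule summable_on_subset_banach) auto
qed

lemma dimension_ge: "real l + 2 \<le> real (m_dim (l, L))"
proof -
  have "l + 2 \<le> 2 ^ (l + 1)" by (induction l) auto
  then have "real (l + 2) \<le> real (2 ^ (l + 1))" by (rule of_nat_mono)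
  then show ?thesis by (simp add: m_dim_def)
qed

text \<open>Lets a factor \<open>exp (- (m * L))\<close> left over from the prior weight, with
  \<open>m\<close> the dimension, pay for the summation over \<open>l\<close> and
  \<open>L\<close>.\<close>

lemma dimension_times_level:
  assumes "1 \<le> L" shows "real l + real L \<le> real (m_dim (l, L)) * real L"
proof -
  have "0 \<le> real l * (real L - 1)" using assms by simp
  then have "real l + real L \<le> (real l + 2) * real L" by (simp add: algebra_simps)
  also have "\<dots> \<le> real (m_dim (l, L)) * real L" by (intro mult_right_mono dimension_ge) simp
  finally show ?thesis .
qed

lemma powr_dimension: "2 powr ((real l + 1) / 2) = sqrt (real (m_dim (l, L)))"
proof -
  have "real (m_dim (l, L)) = 2 powr (real l + 1)" by (simp add: m_dim_def powr_add powr_realpow)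
  then show ?thesis by (simp add: powr_half_sqrt[symmetric] powr_powr)
qed

lemma A_const_eq:
  "A_const (l, L) = sqrt (real (m_dim (l, L))) * (19.28 * (2 * real L + 1) * exp (real L)) + 0.06"
  by (simp add: A_const_def powr_dimension[of l L])

lemma normalizing_constant_pos:
  assumes "(weight a \<gamma> has_sum 1) J" shows "0 < a"
proof (rule ccontr)
  assume "\<not> 0 < a"
  have "((\<lambda>j. - weight a \<gamma> j) has_sum (- 1)) J"
    using assms by (simp add: has_sum_uminus)
  moreover have "0 \<le> - weight a \<gamma> j" if "j \<in> J" for j
    using \<open>\<not> 0 < a\<close> by (simp add: weight_def mult_nonpos_nonneg)
  ultimately have "0 \<le> (- 1 :: real)" by (rule has_sum_nonneg)
  then show False by simp
qed

text \<open>The first term of \<open>eta\<close> is at least \<open>4 * m\<close> times a logarithm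
  of a multiple of \<open>A_const\<close>, and \<open>A_const\<close> is at least
  \<open>sqrt m * exp L\<close>. The positive second term and the factors above 1 only help.\<close>

lemma weight_upper:
  assumes a: "0 < a" and g: "0 < \<gamma>" "\<gamma> < 1 / 4" "0.13 * \<gamma> / sqrt (1 - 4 * \<gamma>) = 0.0056"
    and j: "(l, L) \<in> J"
  shows "weight a \<gamma> (l, L) \<le> a * exp (- 2 * real (m_dim (l, L)) * ln (real (m_dim (l, L))) - 4 * real (m_dim (l, L)) * real L)"
proof -
  let ?m = "real (m_dim (l, L))" and ?\<tau> = "1 - 4 * \<gamma>"
  have m: "2 \<le> ?m" using dimension_ge[of l L] by linarith
  have \<tau>: "0 < ?\<tau>" "?\<tau> < 1" using g by auto
  \<comment> \<open>The equation for \<open>\<gamma>\<close> fixes this constant at about 1072. It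
    exceeds 1 and may therefore be dropped inside the logarithm.\<close>
  have K: "46.2 * sqrt ?\<tau> / \<gamma> = 46.2 * 0.13 / 0.0056" using g(1,3) \<tau> by (simp add: field_simps)
  have A: "sqrt ?m * exp (real L) \<le> A_const (l, L)"
  proof -
    have "sqrt ?m * exp (real L) = 1 * (sqrt ?m * exp (real L))" by simp
    also have "\<dots> \<le> (19.28 * (2 * real L + 1)) * (sqrt ?m * exp (real L))"
      using m by (intro mult_right_mono) auto
    also have "\<dots> \<le> (19.28 * (2 * real L + 1)) * (sqrt ?m * exp (real L)) + 0.06" by simp
    also have "\<dots> = A_const (l, L)" unfolding A_const_eq by (simp only: mult_ac)
    finally show ?thesis .
  qed
  have A0: "0 < sqrt ?m * exp (real L)" using m by simp
  have "ln ?m / 2 + real L = ln (sqrt ?m * exp (real L))"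
    using m by (simp add: ln_mult ln_sqrt)
  also have "\<dots> \<le> ln (46.2 * A_const (l, L) * sqrt ?\<tau> / \<gamma>)"
  proof -
    have "46.2 * A_const (l, L) * sqrt ?\<tau> / \<gamma> = (46.2 * sqrt ?\<tau> / \<gamma>) * A_const (l, L)" by simp
    also have "\<dots> = (46.2 * 0.13 / 0.0056) * A_const (l, L)" unfolding K ..
    finally have "sqrt ?m * exp (real L) \<le> 46.2 * A_const (l, L) * sqrt ?\<tau> / \<gamma>"
      using A A0 by simp
    then show ?thesis using A0 by (intro ln_mono) auto
  qed
  finally have lnA: "ln ?m / 2 + real L \<le> ln (46.2 * A_const (l, L) * sqrt ?\<tau> / \<gamma>)" .
  have lm: "0 \<le> ln ?m" using m by simp
  have "4 * ?m * (ln ?m / 2 + real L) \<le> 4 * ?m / ?\<tau> * ln (46.2 * A_const (l, L) * sqrt ?\<tau> / \<gamma>)"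
  proof (intro mult_mono lnA)
    have "4 * ?m * ?\<tau> \<le> 4 * ?m * 1" using \<tau> m by (intro mult_left_mono) auto
    then show "4 * ?m \<le> 4 * ?m / ?\<tau>" using \<tau> by (simp add: field_simps)
  qed (use lm \<tau> m in auto)
  moreover have "0 \<le> 8 * C_const (l, L) / ?\<tau>" using \<tau> m by (simp add: C_const_def)
  ultimately have eta: "4 * ?m * (ln ?m / 2 + real L) \<le> eta \<gamma> (l, L)" by (simp add: eta_def)
  have "0 \<le> 4 * ?m * (ln ?m / 2 + real L)" using lm m by (intro mult_nonneg_nonneg add_nonneg_nonneg) auto
  then have "1 * eta \<gamma> (l, L) \<le> (1 + ?\<tau> / 8) * eta \<gamma> (l, L)" using eta \<tau> by (intro mult_right_mono) auto
  then have "- (1 + ?\<tau> / 8) * eta \<gamma> (l, L) \<le> - 2 * ?m * ln ?m - 4 * ?m * real L"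
  proof -
    have "2 * ?m * ln ?m + 4 * ?m * real L \<le> eta \<gamma> (l, L)" using eta by (simp add: algebra_simps)
    moreover have "eta \<gamma> (l, L) \<le> (1 + ?\<tau> / 8) * eta \<gamma> (l, L)"
      using \<open>1 * eta \<gamma> (l, L) \<le> _\<close> by simp
    moreover have "- (1 + ?\<tau> / 8) * eta \<gamma> (l, L) = - ((1 + ?\<tau> / 8) * eta \<gamma> (l, L))" by (rule mult_minus_left)
    moreover have "- 2 * ?m * ln ?m - 4 * ?m * real L = - (2 * ?m * ln ?m + 4 * ?m * real L)" by simp
    ultimately show ?thesis by (simp only: neg_le_iff_le)
  qed
  then show ?thesis unfolding weight_def using a by (intro mult_left_mono) auto
qed

text \<open>For fixed \<open>L\<close> every term of \<open>eta\<close> is of order at most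
  \<open>m * ln m\<close>. Constants are absorbed through \<open>1 \<le> ln m / ln 2\<close>, valid
  since \<open>m\<close> is at least 2; hence the divisions by \<open>ln 2\<close> in
  \<open>C\<close>.\<close>

lemma weight_lower:
  assumes a: "0 < a" and g: "0 < \<gamma>" "\<gamma> < 1 / 4"
  obtains C where "0 \<le> C"
    "\<And>l. a * exp (- C * real (m_dim (l, L)) * ln (real (m_dim (l, L)))) \<le> weight a \<gamma> (l, L)"
proof -
  let ?\<tau> = "1 - 4 * \<gamma>"
  have \<tau>: "0 < ?\<tau>" using g by auto
  define A' where "A' = 19.28 * (2 * real L + 1) * exp (real L) + 0.06"
  define Q where "Q = \<bar>ln (46.2 * sqrt ?\<tau> / \<gamma> * A')\<bar>"
  define C where "C = (1 + ?\<tau> / 8) * (4 / ?\<tau> * (1 / 2 + Q / ln 2) + 8 / ?\<tau> * (1 / ln 2 + real L / ln 2))"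
  have A': "0 < A'" by (simp add: A'_def add_pos_pos)
  have ln2: "0 < ln (2::real)" by simp
  have C0: "0 \<le> C" unfolding C_def Q_def using \<tau> ln2 by (intro mult_nonneg_nonneg add_nonneg_nonneg divide_nonneg_pos) auto
  moreover have "a * exp (- C * real (m_dim (l, L)) * ln (real (m_dim (l, L)))) \<le> weight a \<gamma> (l, L)" for l
  proof -
    let ?m = "real (m_dim (l, L))"
    have m: "2 \<le> ?m" using dimension_ge[of l L] by linarith
    have lnm: "ln 2 \<le> ln ?m" using m by simp
    have one: "1 \<le> ln ?m / ln 2" using lnm ln2 by simp
    have A: "A_const (l, L) \<le> sqrt ?m * A'"
    proof -
      have "sqrt ?m * A' = sqrt ?m * (19.28 * (2 * real L + 1) * exp (real L)) + sqrt ?m * 0.06"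
        unfolding A'_def by (rule distrib_left)
      moreover have "1 * 0.06 \<le> sqrt ?m * 0.06" using m by (intro mult_right_mono) auto
      ultimately show ?thesis unfolding A_const_eq by simp
    qed
    have Ap: "0 < A_const (l, L)" unfolding A_const_eq by (simp add: add_nonneg_pos)
    let ?X = "46.2 * A_const (l, L) * sqrt ?\<tau> / \<gamma>"
    have "?X = 46.2 * sqrt ?\<tau> / \<gamma> * A_const (l, L)" by simp
    also have "\<dots> \<le> 46.2 * sqrt ?\<tau> / \<gamma> * (sqrt ?m * A')"
      using A \<tau> g(1) by (intro mult_left_mono) auto
    also have "\<dots> = sqrt ?m * (46.2 * sqrt ?\<tau> / \<gamma> * A')" by simp
    finally have X: "?X \<le> sqrt ?m * (46.2 * sqrt ?\<tau> / \<gamma> * A')" .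
    have "0 < ?X" using Ap \<tau> g(1) by simp
    then have "ln ?X \<le> ln (sqrt ?m * (46.2 * sqrt ?\<tau> / \<gamma> * A'))" using X by (intro ln_mono) auto
    also have "\<dots> = ln ?m / 2 + ln (46.2 * sqrt ?\<tau> / \<gamma> * A')"
      using m \<tau> g(1) A' by (subst ln_mult) (auto simp: ln_sqrt)
    also have "\<dots> \<le> ln ?m / 2 + Q * 1" by (simp add: Q_def)
    also have "\<dots> \<le> ln ?m / 2 + Q * (ln ?m / ln 2)" by (intro add_left_mono mult_left_mono one) (simp add: Q_def)
    also have "\<dots> = (1 / 2 + Q / ln 2) * ln ?m" by (simp add: algebra_simps)
    finally have lnX: "ln ?X \<le> (1 / 2 + Q / ln 2) * ln ?m" .
    have "C_const (l, L) = ?m * 1 + 1 * real L" by (simp add: C_const_def)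
    also have "\<dots> \<le> ?m * (ln ?m / ln 2) + (?m * (ln ?m / ln 2)) * real L"
    proof (intro add_mono mult_left_mono mult_right_mono one)
      have "1 * 1 \<le> ?m * (ln ?m / ln 2)" using m one by (intro mult_mono) auto
      then show "1 \<le> ?m * (ln ?m / ln 2)" by simp
    qed auto
    also have "\<dots> = (1 / ln 2 + real L / ln 2) * (?m * ln ?m)" by (simp add: algebra_simps)
    finally have C: "C_const (l, L) \<le> (1 / ln 2 + real L / ln 2) * (?m * ln ?m)" .
    have "eta \<gamma> (l, L) = 4 * ?m / ?\<tau> * ln ?X + 8 / ?\<tau> * C_const (l, L)" by (simp add: eta_def)
    also have "\<dots> \<le> 4 * ?m / ?\<tau> * ((1 / 2 + Q / ln 2) * ln ?m) + 8 / ?\<tau> * ((1 / ln 2 + real L / ln 2) * (?m * ln ?m))"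
      using lnX C \<tau> m by (intro add_mono mult_left_mono) auto
    also have "\<dots> = (4 / ?\<tau> * (1 / 2 + Q / ln 2) + 8 / ?\<tau> * (1 / ln 2 + real L / ln 2)) * (?m * ln ?m)"
    proof -
      have "4 * m / t * (u * y) + 8 / t * (v * (m * y)) = (4 / t * u + 8 / t * v) * (m * y)" for m t u v y :: real
        by (simp add: algebra_simps)
      then show ?thesis .
    qed
    finally have "(1 + ?\<tau> / 8) * eta \<gamma> (l, L) \<le> (1 + ?\<tau> / 8) * ((4 / ?\<tau> * (1 / 2 + Q / ln 2) + 8 / ?\<tau> * (1 / ln 2 + real L / ln 2)) * (?m * ln ?m))"
      using \<tau> by (intro mult_left_mono) auto
    also have "\<dots> = C * ?m * ln ?m" by (simp add: C_def mult.assoc)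
    finally have "- C * ?m * ln ?m \<le> - (1 + ?\<tau> / 8) * eta \<gamma> (l, L)"
      by (simp only: mult_minus_left neg_le_iff_le)
    then show ?thesis unfolding weight_def using a by (intro mult_left_mono) auto
  qed
  ultimately show ?thesis by (rule that)
qed

context haar_posterior
begin

text \<open>The bound \<open>7 * M0\<close> is loose because the partial Haar sum is only bounded by \<open>4 * M0\<close> at
  dyadic points.\<close>

lemma approximating_parameter:
  assumes M0: "\<And>x. x \<in> {0..1} \<Longrightarrow> \<bar>ln (f_o x)\<bar> \<le> M0" and L: "1 \<le> L" and \<alpha>: "0 < \<alpha>"
    and s: "summable (\<lambda>j. (2 ^ (j + 1) - 1) powr (2 * \<alpha>) * (\<Sum>k<2^j. (haar_coeff (\<lambda>x. ln (f_o x)) j k)\<^sup>2))"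
    and h: "(\<Sum>j. (2 ^ (j + 1) - 1) powr (2 * \<alpha>) * (\<Sum>k<2^j. (haar_coeff (\<lambda>x. ln (f_o x)) j k)\<^sup>2)) \<le> H"
  obtains \<theta> where "\<And>x. x \<in> {0..1} \<Longrightarrow> \<bar>lin_comb B (l, L) \<theta> x\<bar> \<le> 4 * M0"
    "(\<integral>\<^sup>+y. ennreal ((f_o y)\<^sup>2 / model_density B (l, L) \<theta> y) \<partial>mu) \<le>
       ennreal (exp (2 * exp (7 * M0) * (H * (real (m_dim (l, L))) powr (- (2 * \<alpha>)))))"
proof -
  let ?g = "\<lambda>x. ln (f_o x)"
  have j: "(l, L) \<in> J" using L by (simp add: J_def)
  obtain \<beta> where \<beta>: "bij_betw \<beta> (SIGMA j:{..<Suc l}. {..<2^j}) (idx (l, L))"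
    "\<And>i k. i \<le> l \<Longrightarrow> k < 2 ^ i \<Longrightarrow> B (l, L) (\<beta> (i, k)) = haar i k"
    by (rule haar_reindexing_levels[OF B j]) blast
  \<comment> \<open>Indexed through \<open>B\<close> itself; at \<open>\<beta> (j, k)\<close> it is
    the Haar coefficient of level \<open>j\<close> and position \<open>k\<close>.\<close>
  define \<theta> where "\<theta> = (\<lambda>i. \<integral>x. ?g x * B (l, L) i x \<partial>mu)"
  have lc: "lin_comb B (l, L) \<theta> x = haar_sum (haar_coeff ?g) (Suc l) x" for x
  proof -
    have "lin_comb B (l, L) \<theta> x = haar_sum (\<lambda>j k. \<theta> (\<beta> (j, k))) (Suc l) x"
      by (rule lin_comb_haar_sum[where \<beta> = \<beta> and B = B and l = l and L = L, OF \<beta>])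
    also have "\<dots> = haar_sum (haar_coeff ?g) (Suc l) x"
      unfolding haar_sum_def by (intro sum.cong refl) (simp add: \<theta>_def \<beta>(2) haar_coeff_def less_Suc_eq_le)
    finally show ?thesis .
  qed
  have bound: "\<bar>lin_comb B (l, L) \<theta> x\<bar> \<le> 4 * M0" if "x \<in> {0..1}" for x
    unfolding lc by (rule haar_partial_sum_bound[OF log_f_o_cont M0 that])
  let ?c = "dyadic_avg ?g 0 0"
  have c: "\<bar>?c\<bar> \<le> M0"
    using cell_subset[of 0 0] by (intro dyadic_avg_bound log_f_o_cont M0) auto
  have "(\<integral>\<^sup>+y. ennreal ((f_o y)\<^sup>2 / model_density B (l, L) \<theta> y) \<partial>mu) \<le>
      ennreal (exp (2 * exp (6 * M0 + M0) * (H * (2 ^ Suc l) powr (- (2 * \<alpha>)))))"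
  proof (rule chi_square_bound[OF j M0])
    \<comment> \<open>\<open>M0\<close> for the logarithm, \<open>M0\<close> for its mean and
      \<open>4 * M0\<close> for the partial sum; a further \<open>M0\<close> for the size of
      \<open>f_o\<close> makes up the 7.\<close>
    fix x :: real assume x: "x \<in> {0..1}"
    show "\<bar>ln (f_o x) - ?c - lin_comb B (l, L) \<theta> x\<bar> \<le> 6 * M0"
      using M0[OF x] c bound[OF x] by linarith
  next
    show "(\<integral>x. (ln (f_o x) - ?c - lin_comb B (l, L) \<theta> x)\<^sup>2 \<partial>mu) \<le> H * (2 ^ Suc l) powr (- (2 * \<alpha>))"
      unfolding lc haar_approximation_error[OF log_f_o_cont]
      by (rule dyadic_residual_decay[OF log_f_o_cont \<alpha> s h])
  qed
  then show ?thesis using that[of \<theta>] bound by (simp add: m_dim_def)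
qed

end


section \<open>The contraction rate\<close>

text \<open>Each factor of the denominator costs a multiple of \<open>r\<close> in the exponent. The
  12 is the product of the constants in \<open>m \<le> 4 * N\<close> and
  \<open>ln m \<le> 3 * ln n\<close>; the term \<open>4 * (1 + ln L)\<close> pays for the prior mass
  of the ball; the 3 covers \<open>2 + r\<close>, where 2 is \<open>2 * n * \<delta>\<close> at
  \<open>\<delta> = 1 / n\<close> and \<open>r\<close> is the exponent of the exceptional
  probability.\<close>

lemma denominator_lower:
  fixes a C\<^sub>1 C\<^sub>2 \<beta> w \<kappa> m L :: real and n k :: nat
  defines "N \<equiv> real n powr \<beta>" and "r \<equiv> real n powr \<beta> * ln (real n)"
  assumes a: "0 < a" and n: "3 \<le> n" and \<beta>: "0 < \<beta>" "\<beta> < 1" and C: "0 \<le> C\<^sub>1" "0 \<le> C\<^sub>2"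
    and m: "2 \<le> m" "m \<le> 4 * N" "real k \<le> m" and L: "1 \<le> L"
    and w: "a * exp (- C\<^sub>1 * m * ln m) \<le> w" and \<kappa>: "real n * \<kappa> \<le> C\<^sub>2 * N"
  shows "exp (- (\<bar>ln a\<bar> + 12 * C\<^sub>1 + 4 * (1 + ln L) + C\<^sub>2 + 3) * r) \<le>
    w * (1 / real n / L) ^ k * exp (- 2 - real n * \<kappa> - r)"
proof -
  have "exp 1 \<le> real n" using exp_le n by linarith
  then have ln1: "1 \<le> ln (real n)" using n by (simp add: ln_ge_iff)
  have N1: "1 \<le> N" unfolding N_def using n \<beta> by (simp add: ge_one_powr_ge_zero)
  have Nn: "N \<le> real n" unfolding N_def using n \<beta> powr_mono[of \<beta> 1 "real n"] by simp
  have rN: "r = N * ln (real n)" by (simp add: r_def N_def)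
  have r_ge: "N \<le> r" using N1 ln1 mult_left_mono[of 1 "ln (real n)" N] by (simp add: rN)
  then have r1: "1 \<le> r" using N1 by linarith
  have lnm: "0 \<le> ln m" "ln m \<le> 3 * ln (real n)"
  proof -
    have "ln m \<le> ln (4 * real n)" using m Nn by (intro ln_mono) auto
    also have "\<dots> = 2 * ln 2 + ln (real n)" using n ln_realpow[of 2 2] by (simp add: ln_mult)
    also have "\<dots> \<le> 3 * ln (real n)" using ln1 ln_le_minus_one[of 2] by simp
    finally show "ln m \<le> 3 * ln (real n)" .
  qed (use m in simp)
  have "m * ln m \<le> (4 * N) * (3 * ln (real n))" using m lnm N1 by (intro mult_mono) auto
  then have e1: "C\<^sub>1 * (m * ln m) \<le> C\<^sub>1 * (12 * r)" using C by (intro mult_left_mono) (auto simp: rN)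
  have lnL: "0 \<le> ln L" using L by simp
  have "real k * (ln (real n) + ln L) \<le> (4 * N) * (ln (real n) * (1 + ln L))"
  proof (intro mult_mono)
    have "1 * ln L \<le> ln (real n) * ln L" using ln1 lnL by (intro mult_right_mono)
    then show "ln (real n) + ln L \<le> ln (real n) * (1 + ln L)" by (simp add: algebra_simps)
  qed (use m ln1 lnL N1 in auto)
  then have e2: "real k * (ln (real n) + ln L) \<le> 4 * (1 + ln L) * r" by (simp add: rN mult_ac)
  have e3: "real n * \<kappa> \<le> C\<^sub>2 * r" using \<kappa> mult_left_mono[OF r_ge C(2)] by linarith
  have e4: "- ln a \<le> \<bar>ln a\<bar> * r" using mult_left_mono[OF r1, of "\<bar>ln a\<bar>"] by linarith
  have "- (\<bar>ln a\<bar> + 12 * C\<^sub>1 + 4 * (1 + ln L) + C\<^sub>2 + 3) * r =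
      - (\<bar>ln a\<bar> * r) - C\<^sub>1 * (12 * r) - 4 * (1 + ln L) * r - C\<^sub>2 * r - 3 * r"
    by (simp add: algebra_simps)
  also have "\<dots> \<le> (ln a + - C\<^sub>1 * m * ln m) + - real k * (ln (real n) + ln L) + (- 2 - real n * \<kappa> - r)"
    using e1 e2 e3 e4 r1 by (simp add: mult.assoc)
  finally have "exp (- (\<bar>ln a\<bar> + 12 * C\<^sub>1 + 4 * (1 + ln L) + C\<^sub>2 + 3) * r) \<le>
      exp ((ln a + - C\<^sub>1 * m * ln m) + - real k * (ln (real n) + ln L) + (- 2 - real n * \<kappa> - r))"
    by simp
  also have "\<dots> = exp (ln a + - C\<^sub>1 * m * ln m) * exp (- real k * (ln (real n) + ln L)) * exp (- 2 - real n * \<kappa> - r)"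
    by (simp only: exp_add)
  also have "exp (ln a + - C\<^sub>1 * m * ln m) = a * exp (- C\<^sub>1 * m * ln m)" unfolding exp_add using a by simp
  also have "exp (- real k * (ln (real n) + ln L)) = (1 / real n / L) ^ k"
  proof -
    have "exp (- real k * (ln (real n) + ln L)) = exp (real k * - (ln (real n) + ln L))"
      by (simp only: mult_minus_left mult_minus_right)
    also have "\<dots> = exp (- (ln (real n) + ln L)) ^ k" by (rule exp_of_nat_mult)
    also have "exp (- (ln (real n) + ln L)) = 1 / real n / L"
    proof -
      have "0 < real n" "0 < L" using n L by auto
      then show ?thesis unfolding exp_minus exp_add by (simp add: field_simps)
    qed
    finally show ?thesis .
  qed
  also have "a * exp (- C\<^sub>1 * m * ln m) * (1 / real n / L) ^ k * exp (- 2 - real n * \<kappa> - r) \<le>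
      w * (1 / real n / L) ^ k * exp (- 2 - real n * \<kappa> - r)"
    using w L by (intro mult_right_mono) auto
  finally show ?thesis .
qed

text \<open>Models of dimension at most \<open>K * N\<close> are handled by their complexity, all others by the
  smallness of their prior weight.\<close>

lemma model_term_bound:
  fixes a C \<beta> w D m L q \<sigma> :: real and n k :: nat
  defines "r \<equiv> real n powr \<beta> * ln (real n)" and "K \<equiv> (C + 1) / (2 * \<beta>) + 1"
  assumes a: "0 < a" and n: "3 \<le> n" and \<beta>: "0 < \<beta>" "\<beta> < 1" and C: "0 \<le> C"
    and D: "exp (- C * r) \<le> D" and w: "0 < w" "w \<le> a * exp (- 2 * m * ln m - 4 * m * L)"
    and m: "2 \<le> m" "real k \<le> m" and L: "1 \<le> L" and q: "q \<le> m * L"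
    and \<sigma>: "\<sigma> = (C + 2 * K + 6) * r"
  shows "min (w / D) (sqrt (w / D) * (exp (2 - \<sigma> / 2) * ((L + 1 / real n) / (1 / real n)) ^ k))
    \<le> (a + sqrt a) * exp (- r) * exp (- q)"
proof -
  define N where "N = real n powr \<beta>"
  have "exp 1 \<le> real n" using exp_le n by linarith
  then have ln1: "1 \<le> ln (real n)" using n by (simp add: ln_ge_iff)
  have N1: "1 \<le> N" unfolding N_def using n \<beta> by (simp add: ge_one_powr_ge_zero)
  have rN: "r = N * ln (real n)" by (simp add: r_def N_def)
  have r_ge: "N \<le> r" using N1 ln1 mult_left_mono[of 1 "ln (real n)" N] by (simp add: rN)
  then have r1: "1 \<le> r" using N1 by linarith
  have K1: "1 \<le> K" using C \<beta> by (simp add: K_def)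
  have mL: "0 \<le> m * L" "0 \<le> m * ln m" using m L by auto
  have "w / D \<le> (a * exp (- 2 * m * ln m - 4 * m * L)) / exp (- C * r)"
    using w D a by (intro frac_le) auto
  also have "\<dots> = a * (exp (- 2 * m * ln m - 4 * m * L) / exp (- C * r))" by simp
  also have "\<dots> = a * exp (- 2 * m * ln m - 4 * m * L + C * r)"
    unfolding exp_diff[symmetric] by simp
  finally have wD: "w / D \<le> a * exp (- 2 * m * ln m - 4 * m * L + C * r)" .
  have Dp: "0 < D" using D by (meson exp_gt_zero less_le_trans)
  show ?thesis
  proof (cases "m \<le> K * N")
    \<comment> \<open>Here \<open>m\<close> exceeds \<open>N\<close>, so \<open>ln m\<close> is at
      least \<open>\<beta> * ln n\<close>. The threshold satisfies
      \<open>2 * (K * \<beta>) = C + 1 + 2 * \<beta>\<close>, so the weight beats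
      \<open>1 / D\<close> with a margin \<open>exp (- r)\<close>, and \<open>4 * m * L\<close>
      leaves room for \<open>q\<close>.\<close>
    case False
    have lnm: "\<beta> * ln (real n) \<le> ln m"
    proof -
      have "1 * N \<le> K * N" using K1 N1 by (intro mult_right_mono) auto
      then have "N \<le> m" using False by linarith
      then have "ln N \<le> ln m" using N1 by (intro ln_mono) auto
      then show ?thesis using n by (simp add: N_def ln_powr)
    qed
    have "K * N * (\<beta> * ln (real n)) \<le> m * ln m"
      using False lnm K1 N1 \<beta> ln1 m by (intro mult_mono) auto
    then have "2 * (K * \<beta>) * r \<le> 2 * (m * ln m)" by (simp add: rN mult_ac)
    moreover have "2 * (K * \<beta>) = C + 1 + 2 * \<beta>" using \<beta> by (simp add: K_def field_simps)
    moreover have "(C + 1) * r \<le> (C + 1 + 2 * \<beta>) * r" using r1 \<beta> by (intro mult_right_mono) auto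
    ultimately have "(C + 1) * r \<le> 2 * (m * ln m)" by (simp only:)
    then have "- 2 * m * ln m - 4 * m * L + C * r \<le> - r + - q"
      using q mL by (simp add: algebra_simps)
    then have "a * exp (- 2 * m * ln m - 4 * m * L + C * r) \<le> (a + sqrt a) * exp (- r + - q)"
      using a by (intro mult_mono) auto
    also have "\<dots> = (a + sqrt a) * exp (- r) * exp (- q)" by (simp only: exp_add mult.assoc)
    finally show ?thesis using wD by (simp add: min_le_iff_disj)
  next
    \<comment> \<open>Half of \<open>\<sigma>\<close> is \<open>(C / 2 + K + 3) * r\<close>: the
      first part pays for \<open>sqrt (1 / D)\<close>, the second for the volume ratio, and the
      third leaves \<open>2 - 3 * r \<le> - r\<close>. The square root of the weight keeps
      \<open>2 * m * L\<close> in the exponent; one \<open>m * L\<close> absorbs the rest of the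
      volume ratio and the other absorbs \<open>q\<close>.\<close>
    case True
    have base: "(L + 1 / real n) / (1 / real n) \<le> exp (ln (real n) + L)"
    proof -
      have "(L + 1 / real n) / (1 / real n) = real n * L + 1" using n by (simp add: field_simps)
      also have "\<dots> \<le> real n * (1 + L)" using n by (simp add: algebra_simps)
      also have "\<dots> \<le> real n * exp L" by (intro mult_left_mono exp_ge_add_one_self) auto
      finally show ?thesis using n by (simp add: exp_add)
    qed
    have "((L + 1 / real n) / (1 / real n)) ^ k \<le> exp (ln (real n) + L) ^ k"
      using base L by (intro power_mono) auto
    also have "\<dots> = exp (real k * (ln (real n) + L))" by (rule exp_of_nat_mult[symmetric])
    also have "\<dots> \<le> exp (K * r + m * L)"
    proof -
      have "real k * (ln (real n) + L) \<le> m * (ln (real n) + L)" using m ln1 L by (intro mult_right_mono) auto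
      moreover have "m * ln (real n) \<le> (K * N) * ln (real n)" using True ln1 by (intro mult_right_mono) auto
      ultimately show ?thesis by (simp add: rN algebra_simps)
    qed
    finally have pw: "((L + 1 / real n) / (1 / real n)) ^ k \<le> exp (K * r + m * L)" .
    let ?x = "- 2 * m * ln m - 4 * m * L + C * r"
    have "sqrt (w / D) \<le> sqrt (a * exp ?x)" using wD by (intro real_sqrt_le_mono)
    also have "\<dots> = sqrt a * exp (?x / 2)"
    proof -
      have "exp ?x = exp (?x / 2) ^ 2" by (simp flip: exp_of_nat_mult)
      then show ?thesis by (simp add: real_sqrt_mult)
    qed
    finally have sq: "sqrt (w / D) \<le> sqrt a * exp (?x / 2)" .
    have "sqrt (w / D) * (exp (2 - \<sigma> / 2) * ((L + 1 / real n) / (1 / real n)) ^ k) \<le>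
        (sqrt a * exp (?x / 2)) * (exp (2 - \<sigma> / 2) * exp (K * r + m * L))"
      using sq pw a L w Dp by (intro mult_mono mult_left_mono mult_nonneg_nonneg) auto
    also have "\<dots> = sqrt a * exp (?x / 2 + (2 - \<sigma> / 2 + (K * r + m * L)))" by (simp only: exp_add mult.assoc)
    also have "\<dots> \<le> (a + sqrt a) * exp (- r + - q)"
    proof (intro mult_mono)
      have eq: "?x / 2 + (2 - \<sigma> / 2 + (K * r + m * L)) = 2 - 3 * r - m * ln m - m * L"
        unfolding \<sigma> by (simp add: field_simps)
      show "exp (?x / 2 + (2 - \<sigma> / 2 + (K * r + m * L))) \<le> exp (- r + - q)"
        unfolding eq exp_le_cancel_iff using r1 q mL by linarith
    qed (use a in auto)
    also have "\<dots> = (a + sqrt a) * exp (- r) * exp (- q)" by (simp only: exp_add mult.assoc)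
    finally show ?thesis by (simp add: min_le_iff_disj)
  qed
qed

lemma dyadic_level:
  assumes "1 \<le> (N :: real)"
  obtains l :: nat where "N \<le> 2 ^ l" "2 ^ l \<le> 2 * N"
proof -
  define l where "l = nat \<lceil>log 2 N\<rceil>"
  have "0 \<le> log 2 N" using assms by simp
  then have l: "log 2 N \<le> real l" "real l \<le> log 2 N + 1" unfolding l_def by linarith+
  have "2 powr log 2 N \<le> 2 powr real l" "2 powr real l \<le> 2 powr (log 2 N + 1)" using l by auto
  then show ?thesis using that[of l] assms by (simp add: powr_add powr_realpow)
qed

theorem lemma3:
  fixes f_o :: "real \<Rightarrow> real" and M0 H0 \<alpha> \<gamma> a :: real
    and B :: "nat \<times> nat \<Rightarrow> nat \<Rightarrow> real \<Rightarrow> real"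
  assumes f_o_pos: "\<forall>x\<in>{0..1}. f_o x > 0"
    and f_o_density: "(\<integral>x. f_o x \<partial>mu) = 1"
    and log_f_o_cont: "continuous_on {0..1} (\<lambda>x. ln (f_o x))"
    and log_f_o_bound: "sup_norm (\<lambda>x. ln (f_o x)) \<le> M0"
    and H0_pos: "H0 > 0"
    and alpha: "0 < \<alpha>" "\<alpha> < 1"
    and haar_summable: "summable (\<lambda>j1. (2 ^ (j1 + 1) - 1) powr (2 * \<alpha>) *
      (\<Sum>k1 = 0..2 ^ j1 - 1. (haar_coeff (\<lambda>x. ln (f_o x)) j1 k1)\<^sup>2))"
    and haar_bound: "(\<Sum>j1. (2 ^ (j1 + 1) - 1) powr (2 * \<alpha>) *
      (\<Sum>k1 = 0..2 ^ j1 - 1. (haar_coeff (\<lambda>x. ln (f_o x)) j1 k1)\<^sup>2)) \<le> H0\<^sup>2"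
    and B: "haar_reindexing B"
    and gamma: "0 < \<gamma>" "\<gamma> < 1 / 4" "0.13 * \<gamma> / sqrt (1 - 4 * \<gamma>) = 0.0056"
    and a_normalizing: "(weight a \<gamma> has_sum 1) J"
  shows "\<exists>s. proportional s (\<lambda>n. real n powr (- \<alpha> / (1 + 2 * \<alpha>)) * sqrt (ln (real n))) \<and>
    tends_to_zero_in_prob (joint_law f_o)
      (\<lambda>n x. posterior B (weight a \<gamma>) n x (- hellinger_ball f_o (s n)))"
proof -
  let ?g = "\<lambda>x. ln (f_o x)"
  define \<beta> where "\<beta> = 1 / (1 + 2 * \<alpha>)"
  have \<beta>: "0 < \<beta>" "\<beta> < 1" using alpha by (auto simp: \<beta>_def)
  \<comment> \<open>At dimension \<open>n powr \<beta>\<close> the accumulated squared bias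
    \<open>n * m powr (- (2 * \<alpha>))\<close> and the dimension \<open>m\<close> are of the same
    order; the first identity expresses this balance.\<close>
  have \<beta>\<alpha>: "1 - 2 * \<alpha> * \<beta> = \<beta>" "- \<alpha> / (1 + 2 * \<alpha>) = - \<alpha> * \<beta>" using alpha by (auto simp: \<beta>_def field_simps)
  interpret haar_posterior B f_o
    by unfold_locales (use B f_o_pos f_o_density log_f_o_cont in auto)
  have a: "0 < a" by (rule normalizing_constant_pos[OF a_normalizing])
  have M0: "\<bar>?g x\<bar> \<le> M0" if x: "x \<in> {0..1}" for x
  proof -
    have "compact ((\<lambda>x. \<bar>?g x\<bar>) ` {0..1})"
      by (intro compact_continuous_image continuous_intros log_f_o_cont) simp
    then have "bdd_above ((\<lambda>x. \<bar>?g x\<bar>) ` {0..1})" by (intro bounded_imp_bdd_above compact_imp_bounded)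
    then have "\<bar>?g x\<bar> \<le> sup_norm ?g" unfolding sup_norm_def by (intro cSUP_upper x)
    then show ?thesis using log_f_o_bound by linarith
  qed
  have M0_nonneg: "0 \<le> M0" using M0[of 0] by simp
  have level: "{0..2 ^ j - 1} = {..<2 ^ j :: nat}" for j
  proof -
    have "x \<le> 2 ^ j - 1 \<longleftrightarrow> x < 2 ^ j" for x :: nat
      using one_le_power[of "2::nat" j] by linarith
    then show ?thesis by (simp add: set_eq_iff)
  qed
  note hs = haar_summable[unfolded level] and hb = haar_bound[unfolded level]
  \<comment> \<open>\<open>4 * M0\<close> bounds the approximating function at every point, and the
    extra 1 leaves room for a ball of radius \<open>1 / n\<close> inside
    \<open>Theta\<close>.\<close>
  define L\<^sub>0 where "L\<^sub>0 = nat \<lceil>4 * M0\<rceil> + 1"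
  have L0: "1 \<le> L\<^sub>0" "4 * M0 + 1 \<le> real L\<^sub>0" using M0_nonneg unfolding L\<^sub>0_def by linarith+
  obtain C\<^sub>1 where C1: "0 \<le> C\<^sub>1"
    "\<And>l. a * exp (- C\<^sub>1 * real (m_dim (l, L\<^sub>0)) * ln (real (m_dim (l, L\<^sub>0)))) \<le> weight a \<gamma> (l, L\<^sub>0)"
    using weight_lower[OF a gamma(1,2), of L\<^sub>0] by blast
  define C\<^sub>2 where "C\<^sub>2 = 2 * exp (7 * M0) * H0\<^sup>2"
  have C2: "0 \<le> C\<^sub>2" by (simp add: C\<^sub>2_def)
  define C where "C = \<bar>ln a\<bar> + 12 * C\<^sub>1 + 4 * (1 + ln (real L\<^sub>0)) + C\<^sub>2 + 3"
  have C: "0 \<le> C" unfolding C_def using C1 C2 L0(1) by (intro add_nonneg_nonneg mult_nonneg_nonneg) auto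
  define K where "K = (C + 1) / (2 * \<beta>) + 1"
  \<comment> \<open>The square of the constant is the factor that \<open>model_term_bound\<close>
    demands in \<open>n * (s n)\<^sup>2 = (C + 2 * K + 6) * r\<close>.\<close>
  define S where "S = sqrt (C + 2 * K + 6)"
  have K: "0 \<le> K" unfolding K_def using C \<beta> by simp
  have S: "0 < S" "S\<^sup>2 = C + 2 * K + 6" unfolding S_def using C K by auto
  define s where "s = (\<lambda>n. S * (real n powr (- \<alpha> / (1 + 2 * \<alpha>)) * sqrt (ln (real n))))"
  define Tot where "Tot = (\<Sum>\<^sub>\<infinity>(l, L)\<in>J. exp (- real l - real L))"
  have Tot: "0 \<le> Tot" unfolding Tot_def by (intro infsum_nonneg) auto
  let ?bad = "\<lambda>\<epsilon> n. {x \<in> space (sample_law n). \<bar>posterior B (weight a \<gamma>) n x (- hellinger_ball f_o (s n))\<bar> > \<epsilon>}"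
  have bad: "measure (sample_law n) (?bad \<epsilon> n) \<le> (1 + 1 / \<epsilon> * ((a + sqrt a) * Tot)) * (1 / real n)"
    if n: "3 \<le> n" and \<epsilon>: "0 < \<epsilon>" for n \<epsilon>
  proof -
    interpret sample: prob_space "sample_law n" by (rule prob_space_sample_law)
    define N where "N = real n powr \<beta>"
    define r where "r = N * ln (real n)"
    \<comment> \<open>The restriction to \<open>n\<close> at least 3 enters through
      \<open>exp 1 \<le> 3\<close>, which makes \<open>ln n\<close> at least 1.\<close>
    have "exp 1 \<le> real n" using exp_le n by linarith
    then have ln1: "1 \<le> ln (real n)" using n by (simp add: ln_ge_iff)
    have N1: "1 \<le> N" unfolding N_def using n \<beta> by (simp add: ge_one_powr_ge_zero)
    obtain l where l: "N \<le> 2 ^ l" "2 ^ l \<le> 2 * N" using dyadic_level[OF N1] .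
    let ?j = "(l, L\<^sub>0)" and ?m = "real (m_dim (l, L\<^sub>0))"
    have j0: "?j \<in> J" using L0 by (simp add: J_def)
    have m: "2 \<le> ?m" "N \<le> ?m" "?m \<le> 4 * N"
      using l N1 dimension_ge[of l L\<^sub>0] by (auto simp: m_dim_def)
    obtain \<theta> where \<theta>: "\<And>x. x \<in> {0..1} \<Longrightarrow> \<bar>lin_comb B ?j \<theta> x\<bar> \<le> 4 * M0"
      "(\<integral>\<^sup>+y. ennreal ((f_o y)\<^sup>2 / model_density B ?j \<theta> y) \<partial>mu) \<le>
       ennreal (exp (2 * exp (7 * M0) * (H0\<^sup>2 * ?m powr (- (2 * \<alpha>)))))"
      using approximating_parameter[OF M0 L0(1) alpha(1) hs hb, where l = l] by blast
    define \<kappa> where "\<kappa> = 2 * exp (7 * M0) * (H0\<^sup>2 * ?m powr (- (2 * \<alpha>)))"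
    have \<kappa>: "real n * \<kappa> \<le> C\<^sub>2 * N"
    proof -
      have "?m powr (- (2 * \<alpha>)) \<le> N powr (- (2 * \<alpha>))" using m N1 alpha by (intro powr_mono2') auto
      then have "real n * \<kappa> \<le> real n * (2 * exp (7 * M0) * (H0\<^sup>2 * N powr (- (2 * \<alpha>))))"
        unfolding \<kappa>_def by (intro mult_left_mono) auto
      also have "\<dots> = C\<^sub>2 * (real n powr 1 * real n powr (- (2 * \<alpha> * \<beta>)))"
        using n by (simp add: C\<^sub>2_def N_def powr_powr mult_ac)
      also have "real n powr 1 * real n powr (- (2 * \<alpha> * \<beta>)) = N"
        using \<beta>\<alpha>(1) unfolding powr_add[symmetric] N_def by simp
      finally show ?thesis .
    qed
    let ?\<delta> = "1 / real n"
    have \<delta>: "0 < ?\<delta>" "?\<delta> \<le> 1" using n by auto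
    have sub: "param_ball ?j \<theta> ?\<delta> \<subseteq> Theta B ?j"
    proof
      fix \<theta>' assume \<theta>': "\<theta>' \<in> param_ball ?j \<theta> ?\<delta>"
      have "\<bar>lin_comb B ?j \<theta>' x\<bar> \<le> real L\<^sub>0" if x: "x \<in> {0..1}" for x
      proof -
        have "\<bar>lin_comb B ?j \<theta>' x - lin_comb B ?j \<theta> x\<bar> \<le> ?\<delta>" using \<theta>' x by (auto simp: param_ball_def)
        then show ?thesis using \<theta>(1)[OF x] \<delta> L0(2) by linarith
      qed
      then show "\<theta>' \<in> Theta B ?j" using \<theta>' unfolding Theta_eq_param_ball[OF j0] by (auto simp: param_ball_def)
    qed
    have s0: "0 \<le> s n" unfolding s_def using S ln1 by simp
    have s2: "real n * (s n)\<^sup>2 = (C + 2 * K + 6) * r"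
    proof -
      have "(real n powr (- \<alpha> / (1 + 2 * \<alpha>)))\<^sup>2 = real n powr (- (2 * \<alpha> * \<beta>))"
        unfolding \<beta>\<alpha>(2) power2_eq_square powr_add[symmetric] by (simp add: mult.assoc)
      moreover have "real n * real n powr (- (2 * \<alpha> * \<beta>)) = N"
      proof -
        have "real n powr 1 * real n powr (- (2 * \<alpha> * \<beta>)) = N"
          using \<beta>\<alpha>(1) unfolding powr_add[symmetric] N_def by simp
        then show ?thesis using n by simp
      qed
      ultimately show ?thesis
        using S(2) ln1 by (simp add: s_def power_mult_distrib r_def)
    qed
    \<comment> \<open>The exponent \<open>t\<close> of the exceptional event is taken equal to
      \<open>r\<close>, so that its probability has the order of the other error terms.\<close>
    define D where "D = weight a \<gamma> ?j * (?\<delta> / real (snd ?j)) ^ (m_dim ?j - 1) * exp (- 2 * real n * ?\<delta> - real n * \<kappa> - r)"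
    have D: "exp (- C * r) \<le> D"
      using denominator_lower[OF a n \<beta> C1(1) C2 m(1) m(3)[unfolded N_def] _ _ C1(2) \<kappa>[unfolded N_def], of "m_dim ?j - 1" "real L\<^sub>0"]
        L0(1) n unfolding C_def r_def N_def D_def by simp
    let ?b = "\<lambda>(l, L). (a + sqrt a) * exp (- r) * exp (- real l - real L)"
    have each: "min (weight a \<gamma> j / D) (sqrt (weight a \<gamma> j / D) *
        (exp (2 * real n * ?\<delta> - real n * (s n)\<^sup>2 / 2) * ((real (snd j) + ?\<delta>) / ?\<delta>) ^ (m_dim j - 1))) \<le> ?b j"
      if j: "j \<in> J" for j
    proof -
      obtain l' L' where jj: "j = (l', L')" by force
      have L': "1 \<le> L'" using j by (simp add: J_def jj)
      have "min (weight a \<gamma> j / D) (sqrt (weight a \<gamma> j / D) *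
        (exp (2 - real n * (s n)\<^sup>2 / 2) * ((real L' + ?\<delta>) / ?\<delta>) ^ (m_dim j - 1)))
        \<le> (a + sqrt a) * exp (- r) * exp (- (real l' + real L'))"
        unfolding r_def N_def
      proof (rule model_term_bound[OF a n \<beta> C])
        show "exp (- C * (real n powr \<beta> * ln (real n))) \<le> D" using D unfolding r_def N_def .
        show "0 < weight a \<gamma> j" using a by (simp add: weight_def)
        show "weight a \<gamma> j \<le> a * exp (- 2 * real (m_dim j) * ln (real (m_dim j)) - 4 * real (m_dim j) * real L')"
          using weight_upper[OF a gamma] j unfolding jj by blast
        show "2 \<le> real (m_dim j)" using dimension_ge[of l' L'] unfolding jj by linarith
        show "real l' + real L' \<le> real (m_dim j) * real L'" using dimension_times_level[OF L'] unfolding jj .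
        show "real n * (s n)\<^sup>2 = (C + 2 * ((C + 1) / (2 * \<beta>) + 1) + 6) * (real n powr \<beta> * ln (real n))"
          using s2 unfolding K_def r_def N_def .
      qed (use L' in auto)
      moreover have "2 * real n * ?\<delta> = 2" using n by simp
      moreover have "- (real l' + real L') = - real l' - real L'" by simp
      ultimately show ?thesis unfolding jj by simp
    qed
    have w: "0 < weight a \<gamma> j" for j using a by (simp add: weight_def)
    have "emeasure (sample_law n) (?bad \<epsilon> n) \<le>
        ennreal (exp (- r)) + ennreal (1 / \<epsilon>) * (\<Sum>\<^sub>\<infinity>j\<in>J. ennreal (?b j))"
      by (rule posterior_bound[OF w j0 \<delta>(1) s0 \<epsilon> sub \<theta>(2)[folded \<kappa>_def] each[unfolded D_def]])
    also have "(\<Sum>\<^sub>\<infinity>j\<in>J. ennreal (?b j)) = ennreal (\<Sum>\<^sub>\<infinity>j\<in>J. (a + sqrt a) * exp (- r) * (case j of (l, L) \<Rightarrow> exp (- real l - real L)))"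
      using a by (subst infsum_ennreal_real[symmetric])
        (auto simp: case_prod_beta' intro!: summable_on_cmult_right summable_on_J_exp[unfolded case_prod_beta'])
    also have "(\<Sum>\<^sub>\<infinity>j\<in>J. (a + sqrt a) * exp (- r) * (case j of (l, L) \<Rightarrow> exp (- real l - real L))) = (a + sqrt a) * exp (- r) * Tot"
      unfolding Tot_def by (intro infsum_cmult_right summable_on_J_exp)
    also have "ennreal (exp (- r)) + ennreal (1 / \<epsilon>) * ennreal ((a + sqrt a) * exp (- r) * Tot) =
        ennreal ((1 + 1 / \<epsilon> * ((a + sqrt a) * Tot)) * exp (- r))"
      using a \<epsilon> Tot by (simp add: ennreal_mult'[symmetric] ennreal_plus[symmetric] algebra_simps del: ennreal_plus)
    also have "\<dots> \<le> ennreal ((1 + 1 / \<epsilon> * ((a + sqrt a) * Tot)) * (1 / real n))"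
    proof (intro ennreal_leI mult_left_mono)
      \<comment> \<open>As \<open>N\<close> is at least 1, \<open>exp (- r)\<close> is at most
        \<open>1 / n\<close>, a convenient null sequence.\<close>
      have "1 * ln (real n) \<le> r" unfolding r_def using N1 ln1 by (intro mult_right_mono) auto
      then have "exp (- r) \<le> exp (- ln (real n))" by simp
      then show "exp (- r) \<le> 1 / real n" using n by (simp add: exp_minus inverse_eq_divide)
    qed (use a \<epsilon> Tot in auto)
    finally show ?thesis
      using a \<epsilon> Tot by (simp add: sample.emeasure_eq_measure)
  qed
  have lim: "(\<lambda>n. measure (sample_law n) (?bad \<epsilon> n)) \<longlonglongrightarrow> 0" if \<epsilon>: "0 < \<epsilon>" for \<epsilon>
  proof (rule real_tendsto_sandwich)
    show "\<forall>\<^sub>F n in sequentially. 0 \<le> measure (sample_law n) (?bad \<epsilon> n)" by simp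
    show "\<forall>\<^sub>F n in sequentially. measure (sample_law n) (?bad \<epsilon> n) \<le> (1 + 1 / \<epsilon> * ((a + sqrt a) * Tot)) * (1 / real n)"
      using eventually_ge_at_top[of 3] by eventually_elim (rule bad[OF _ \<epsilon>])
    show "(\<lambda>n. (1 + 1 / \<epsilon> * ((a + sqrt a) * Tot)) * (1 / real n)) \<longlonglongrightarrow> 0"
      by (intro tendsto_mult_right_zero lim_1_over_n)
  qed simp
  have "proportional s (\<lambda>n. real n powr (- \<alpha> / (1 + 2 * \<alpha>)) * sqrt (ln (real n)))"
    unfolding proportional_def s_def using S(1) by blast
  moreover have "tends_to_zero_in_prob sample_law (\<lambda>n x. posterior B (weight a \<gamma>) n x (- hellinger_ball f_o (s n)))"
    unfolding tends_to_zero_in_prob_def using lim posterior_measurable by blast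
  ultimately show ?thesis by blast
qed

end
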